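(* Assume in addition $\mathbb E X_0^3<\infty$ and $\mathbb E\varepsilon_1^3<\infty$. Then $\sqrt n(\tilde\alpha_n-\alpha)\to\mathcal N(0,\sigma_{\alpha,\varepsilon}^2)$ in distribution. Moreover, conditionally on the values $(Y_{s_1-1},Y_{s_2-1},Y_{s_1+1},Y_{s_2+1})$, $$\begin{bmatrix}\sqrt n(\tilde\theta_{1,n}-L_1)\\ \sqrt n(\tilde\theta_{2,n}-L_2)\end{bmatrix}\to\mathcal N\Big(\begin{bmatrix}0\\0\end{bmatrix},\sigma_{\alpha,\varepsilon}^2\,e_{\alpha,\varepsilon}e_{\alpha,\varepsilon}^\top\Big),$$ where $L_i=Y_{s_i}-\frac{\alpha}{1+\alpha^2}(Y_{s_i-1}+Y_{s_i+1})-\frac{1-\alpha}{1+\alpha^2}\mu_\varepsilon$ and $$e_{\alpha,\varepsilon}=\frac{1}{(1+\alpha^2)^2}\begin{bmatrix}(\alpha^2-1)(Y_{s_1-1}+Y_{s_1+1})+(1+2\alpha-\alpha^2)\mu_\varepsilon\\(\alpha^2-1)(Y_{s_2-1}+Y_{s_2+1})+(1+2\alpha-\alpha^2)\mu_\varepsilon\end{bmatrix}.$$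
   Context: INAR(1) process: Let $\alpha\in(0,1)$. Let $(\varepsilon_k)_{k\in\mathbb N}$ be i.i.d. non-negative integer-valued random variables with $\mathbb E\varepsilon_1^2<\infty$ and $\mathbb P(\varepsilon_1\ne 0)>0$; write $\mu_\varepsilon=\mathbb E\varepsilon_1$ (assumed known), $\sigma_\varepsilon^2=\operatorname{Var}\varepsilon_1$. For each $k\in\mathbb N$ let $(\xi_{k,j})_{j\in\mathbb N}$ be i.i.d. Bernoulli random variables with mean $\alpha$, these sequences being mutually independent and independent of $(\varepsilon_k)$. Let $X_0$ be a non-negative integer-valued random variable with $\mathbb E X_0^2<\infty$, independent of all $\xi_{k,j}$ and $\varepsilon_k$, and set $X_k=\sum_{j=1}^{X_{k-1}}\xi_{k,j}+\varepsilon_k$ for $k\in\mathbb N$. This Markov chain has a unique stationary distribution; $\tilde X$ denotes a random variable with it, and $\sigma_{\alpha,\varepsilon}^2=\frac{\alpha(1-\alpha)\mathbb E\tilde X^3+\sigma_\varepsilon^2\mathbb E\tilde X^2}{(\mathbb E\tilde X^2)^2}$. Two non-neighbouring additive outliers: fix known $s_1,s_2\in\mathbb N$ with $s_1<s_2-1$ and $\theta_1,\theta_2\in\mathbb N$; $Y_k=X_k+\delta_{k,s_1}\theta_1+\delta_{k,s_2}\theta_2$; $\mathbf Y_n=(Y_0,\dots,Y_n)$. For $n\ge s_2+1$, $$Q_n(\mathbf y_n;\alpha',\theta_1',\theta_2')=\sum_{\substack{k=1\\k\notin\{s_1,s_1+1,s_2,s_2+1\}}}^n(y_k-\alpha'y_{k-1}-\mu_\varepsilon)^2+\sum_{i=1}^2\Big[(y_{s_i}-\alpha'y_{s_i-1}-\mu_\varepsilon-\theta_i')^2+(y_{s_i+1}-\alpha'y_{s_i}-\mu_\varepsilon+\alpha'\theta_i')^2\Big],$$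 and $(\tilde\alpha_n,\tilde\theta_{1,n},\tilde\theta_{2,n})$ is the unique global minimizer over $\mathbb R^3$ of $Q_n(\mathbf Y_n;\cdot)$ when it exists uniquely, and $(0,0,0)$ otherwise. Conditional convergence: for random vectors $\zeta_n$ and a random vector $\eta$ with values in $\mathbb Z_+^d$, "conditionally on the values $\eta$, $\zeta_n\to\mathcal N(0,\Sigma(\eta))$" means: for every $m$ with $\mathbb P(\eta=m)>0$, the conditional distribution of $\zeta_n$ given $\{\eta=m\}$ converges weakly to $\mathcal N(0,\Sigma(m))$. *)

theory Defs
  imports "HOL-Probability.Probability"
begin

datatype inar_idx = I0 | IE nat | IX nat nat

definition inar_index_set :: "inar_idx set" where
  "inar_index_set = {I0} \<union> IE ` {1..} \<union> {IX k j | k j. 1 \<le> k \<and> 1 \<le> j}"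

definition inar_family ::
  "('a \<Rightarrow> nat) \<Rightarrow> (nat \<Rightarrow> 'a \<Rightarrow> nat) \<Rightarrow> (nat \<Rightarrow> nat \<Rightarrow> 'a \<Rightarrow> nat)
     \<Rightarrow> inar_idx \<Rightarrow> 'a \<Rightarrow> nat" where
  "inar_family X0 eps xi i = (case i of I0 \<Rightarrow> X0 | IE k \<Rightarrow> eps k | IX k j \<Rightarrow> xi k j)"

primrec inar_X ::
  "('a \<Rightarrow> nat) \<Rightarrow> (nat \<Rightarrow> 'a \<Rightarrow> nat) \<Rightarrow> (nat \<Rightarrow> nat \<Rightarrow> 'a \<Rightarrow> nat) \<Rightarrow> nat \<Rightarrow> 'a \<Rightarrow> nat" where
  "inar_X X0 eps xi 0 \<omega> = X0 \<omega>"
| "inar_X X0 eps xi (Suc k) \<omega> =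
     (\<Sum>j = 1..inar_X X0 eps xi k \<omega>. xi (Suc k) j \<omega>) + eps (Suc k) \<omega>"

definition inar_kernel :: "real \<Rightarrow> nat pmf \<Rightarrow> nat \<Rightarrow> nat pmf" where
  "inar_kernel \<alpha> pe x = bind_pmf (binomial_pmf x \<alpha>) (\<lambda>b. map_pmf (\<lambda>e. b + e) pe)"

definition inar_stationary :: "real \<Rightarrow> nat pmf \<Rightarrow> nat pmf" where
  "inar_stationary \<alpha> pe = (THE \<pi>. bind_pmf \<pi> (inar_kernel \<alpha> pe) = \<pi>)"

definition stat_moment :: "real \<Rightarrow> nat pmf \<Rightarrow> nat \<Rightarrow> real" where
  "stat_moment \<alpha> pe k = measure_pmf.expectation (inar_stationary \<alpha> pe) (\<lambda>x. real x ^ k)"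

definition sigma2_ae :: "real \<Rightarrow> nat pmf \<Rightarrow> real \<Rightarrow> real" where
  "sigma2_ae \<alpha> pe s2e =
     (\<alpha> * (1 - \<alpha>) * stat_moment \<alpha> pe 3 + s2e * stat_moment \<alpha> pe 2) / (stat_moment \<alpha> pe 2)\<^sup>2"

definition inar_Y ::
  "('a \<Rightarrow> nat) \<Rightarrow> (nat \<Rightarrow> 'a \<Rightarrow> nat) \<Rightarrow> (nat \<Rightarrow> nat \<Rightarrow> 'a \<Rightarrow> nat)
     \<Rightarrow> nat \<Rightarrow> nat \<Rightarrow> nat \<Rightarrow> nat \<Rightarrow> nat \<Rightarrow> 'a \<Rightarrow> nat" where
  "inar_Y X0 eps xi s1 s2 \<theta>1 \<theta>2 k \<omega> =
     inar_X X0 eps xi k \<omega> + (if k = s1 then \<theta>1 else 0) + (if k = s2 then \<theta>2 else 0)"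

definition Qn :: "real \<Rightarrow> nat \<Rightarrow> nat \<Rightarrow> nat \<Rightarrow> (nat \<Rightarrow> real) \<Rightarrow> real \<times> real \<times> real \<Rightarrow> real" where
  "Qn \<mu> s1 s2 n y p = (case p of (a, t1, t2) \<Rightarrow>
     (\<Sum>k \<in> {1..n} - {s1, s1 + 1, s2, s2 + 1}. (y k - a * y (k - 1) - \<mu>)\<^sup>2)
     + ((y s1 - a * y (s1 - 1) - \<mu> - t1)\<^sup>2 + (y (s1 + 1) - a * y s1 - \<mu> + a * t1)\<^sup>2)
     + ((y s2 - a * y (s2 - 1) - \<mu> - t2)\<^sup>2 + (y (s2 + 1) - a * y s2 - \<mu> + a * t2)\<^sup>2))"

definition cls_est :: "real \<Rightarrow> nat \<Rightarrow> nat \<Rightarrow> nat \<Rightarrow> (nat \<Rightarrow> real) \<Rightarrow> real \<times> real \<times> real" where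
  "cls_est \<mu> s1 s2 n y =
     (if \<exists>!p. \<forall>q. Qn \<mu> s1 s2 n y p \<le> Qn \<mu> s1 s2 n y q
      then THE p. \<forall>q. Qn \<mu> s1 s2 n y p \<le> Qn \<mu> s1 s2 n y q
      else (0, 0, 0))"

definition normal_law :: "real \<Rightarrow> real measure" where
  "normal_law v = (if v = 0 then return lborel 0 else density lborel (normal_density 0 (sqrt v)))"

(* P is the centred bivariate normal law N(0, [[a,b],[b,c]]):
   every linear functional t1 x + t2 y has law N(0, t^T Sigma t) *)
definition gaussian2 :: "real \<Rightarrow> real \<Rightarrow> real \<Rightarrow> (real \<times> real) measure \<Rightarrow> bool" where
  "gaussian2 a b c P \<longleftrightarrow> prob_space P \<and> sets P = sets borel \<and>
     (\<forall>t1 t2. distr P borel (\<lambda>(x, y). t1 * x + t2 * y)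
              = normal_law (t1\<^sup>2 * a + 2 * t1 * t2 * b + t2\<^sup>2 * c))"

definition weak_conv2 :: "(nat \<Rightarrow> (real \<times> real) measure) \<Rightarrow> (real \<times> real) measure \<Rightarrow> bool" where
  "weak_conv2 Pn P \<longleftrightarrow>
     (\<forall>f :: real \<times> real \<Rightarrow> real. continuous_on UNIV f \<and> bounded (range f) \<longrightarrow>
        (\<lambda>n. integral\<^sup>L (Pn n) f) \<longlonglongrightarrow> integral\<^sup>L P f)"

end

theory Submission
  imports Defs "HOL-Real_Asymp.Real_Asymp"
begin

text \<open>For fixed \<open>a\<close> the criterion is quadratic in the outlier sizes. Minimising over them leaves
  \<open>A a\<^sup>2 - 2 B a\<close> plus a bounded rational function of \<open>a\<close>, so for large \<open>A\<close> the minimiser is unique and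
  within \<open>O(1/A)\<close> of \<open>B / A\<close>. Up to terms that depend only on the path until time \<open>s2 + 1\<close>, \<open>A\<close> is the sum of
  \<open>X\<^sub>k\<^sup>2\<close> and \<open>B - \<alpha> A\<close> is the martingale with increments \<open>X\<^sub>k (X\<^sub>k\<^sub>+\<^sub>1 - \<alpha> X\<^sub>k - \<mu>)\<close>. The estimated outlier
  sizes are smooth functions of the estimated \<open>\<alpha>\<close> once that path segment is fixed, so both claims follow by
  conditioning on the segment from one central limit theorem and one law of large numbers for the chain
  started at a fixed state.

  Both limit theorems come from one estimate for characteristic functions of additive functionals.
  It rests on two properties of the kernel: it contracts differences of bounded functions by \<open>\<alpha>\<close>,
  which gives the stationary law and geometric ergodicity, and it is monotone, so moments and tails of
  the chain are dominated by those of the stationary law. Third moments are therefore enough for uniform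
  integrability.\<close>

section \<open>Kernel of the INAR(1) chain\<close>

text \<open>The path up to time \<open>s2 + 1\<close> contains the contaminated observations, their
  neighbours and the four conditioning values. Once it is fixed, the outliers enter only through
  constants, and all three scaled errors are asymptotically multiples of one scalar variable; hence
  the covariance matrix of rank one. The first multiple is 1 for every segment, so averaging over
  all segments gives the unconditional claim; the other two depend on the segment only through the
  four conditioning values, so averaging over the segments with given values gives the conditional
  one.

  The moment assumption shapes the limit theorems. The conditional variance of a martingale
  increment grows like X^3, so third moments just control its mean; a variance bound for the sum of
  X^2 would already ask for fourth moments. Both theorems are therefore stated for characteristic
  functions, where only N times the one-step change matters, dominated by a multiple of 1 + x^3. As
  the contraction concerns bounded functions only, its limit is truncated before the chain is
  allowed to mix.\<close>

abbreviation pexp :: "'a pmf \<Rightarrow> ('a \<Rightarrow> 'b) \<Rightarrow> 'b :: {banach, second_countable_topology}" where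
  "pexp p \<equiv> integral\<^sup>L (measure_pmf p)"

text \<open>Characteristic functions make complex values necessary. Boundedness makes every integral
  exist, and the real identity is applied to each coordinate.\<close>

lemma integral_bind_pmf_bounded:
  fixes f :: "'b \<Rightarrow> 'c :: euclidean_space"
  assumes B: "\<And>y. norm (f y) \<le> B"
  shows "pexp (bind_pmf p k) f
         = pexp p (\<lambda>x. pexp (k x) f)"
proof -
  have int: "integrable (measure_pmf q) f" for q :: "'b pmf"
    by (rule measure_pmf.integrable_const_bound[where B=B]) (auto simp: B)
  have bnd: "norm (pexp q f) \<le> B" for q :: "'b pmf"
  proof -
    have "norm (pexp q f) \<le> pexp q (\<lambda>y. norm (f y))"
      by (rule integral_norm_bound)
    also have "\<dots> \<le> B"
      by (rule measure_pmf.integral_le_const) (auto simp: B int integrable_norm)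
    finally show ?thesis .
  qed
  have int2: "integrable (measure_pmf p) (\<lambda>x. pexp (k x) f)"
    by (rule measure_pmf.integrable_const_bound[where B=B]) (auto simp: bnd)
  show ?thesis
  proof (rule euclidean_eqI)
    fix b :: 'c assume b: "b \<in> Basis"
    have "\<bar>f y \<bullet> b\<bar> \<le> B" for y
      using Basis_le_norm[OF b, of "f y"] B[of y] by linarith
    then have "pexp (bind_pmf p k) (\<lambda>y. f y \<bullet> b)
       = pexp p (\<lambda>x. pexp (k x) (\<lambda>y. f y \<bullet> b))"
      unfolding measure_pmf_bind
      by (intro integral_bind[where K="count_space UNIV" and B=B and B'=1])
        (auto simp: measure_pmf.finite_measure_axioms measure_pmf.emeasure_space_1
           space_subprob_algebra measure_pmf.subprob_space_axioms)
    then show "pexp (bind_pmf p k) f \<bullet> b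
       = pexp p (\<lambda>x. pexp (k x) f) \<bullet> b"
      using int int2 by simp
  qed
qed

lemma norm_expectation_le:
  fixes f :: "'b \<Rightarrow> 'c :: {banach, second_countable_topology}"
  assumes B: "\<And>y. norm (f y) \<le> B"
  shows "norm (pexp q f) \<le> B"
proof -
  have "norm (pexp q f) \<le> pexp q (\<lambda>y. norm (f y))"
    by (rule integral_norm_bound)
  also have "\<dots> \<le> B"
    by (rule measure_pmf.integral_le_const)
      (auto simp: B intro!: measure_pmf.integrable_const_bound[where B=B])
  finally show ?thesis .
qed

lemma integrable_pmf_bounded:
  fixes f :: "'b \<Rightarrow> 'c :: {banach, second_countable_topology}"
  assumes B: "\<And>y. norm (f y) \<le> B"
  shows "integrable (measure_pmf q) f"
  by (rule measure_pmf.integrable_const_bound[where B=B]) (auto simp: B)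

text \<open>The chain is studied through its kernel alone; the probability space enters only in
  \<open>inar_process\<close>. \<open>innovation\<close> lets the chain climb from every state,
  which gives the stationary law unbounded support.\<close>

locale inar =
  fixes \<alpha> :: real and pe :: "nat pmf"
  assumes \<alpha>_pos: "0 < \<alpha>" and \<alpha>_less_1: "\<alpha> < 1"
    and third_moment: "integrable (measure_pmf pe) (\<lambda>e. real e ^ 3)"
    and innovation: "pmf pe 0 < 1"
begin

abbreviation K :: "nat \<Rightarrow> nat pmf" where "K \<equiv> inar_kernel \<alpha> pe"

lemma \<alpha>_01 [simp]: "\<alpha> \<in> {0..1}" "0 \<le> \<alpha>" "\<alpha> \<le> 1"
  using \<alpha>_pos \<alpha>_less_1 by auto

lemma K_0: "K 0 = pe"
proof -
  have "(+) 0 = (\<lambda>x. x :: nat)" by auto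
  then show ?thesis
    by (simp add: inar_kernel_def binomial_pmf_0 bind_return_pmf pmf.map_ident)
qed

text \<open>One more individual at the start adds one independent survival indicator to the next
  state. Contraction, monotonicity and the moment formulas all come from this recursion in
  \<open>x\<close>.\<close>

lemma K_Suc: "K (Suc x) = bind_pmf (bernoulli_pmf \<alpha>) (\<lambda>b. map_pmf (\<lambda>z. of_bool b + z) (K x))"
proof -
  have "K (Suc x) = bind_pmf (bernoulli_pmf \<alpha>) (\<lambda>b. bind_pmf (binomial_pmf x \<alpha>)
     (\<lambda>k. map_pmf (\<lambda>e. (if b then 1 else 0) + k + e) pe))"
    by (simp add: inar_kernel_def binomial_pmf_Suc bind_assoc_pmf bind_return_pmf)
  also have "\<dots> = bind_pmf (bernoulli_pmf \<alpha>) (\<lambda>b. map_pmf (\<lambda>z. of_bool b + z) (K x))"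
    by (intro bind_pmf_cong refl)
      (auto simp: inar_kernel_def map_bind_pmf pmf.map_comp o_def of_bool_def add.assoc)
  finally show ?thesis .
qed

lemma expectation_K_Suc:
  fixes f :: "nat \<Rightarrow> 'c :: euclidean_space"
  assumes B: "\<And>y. norm (f y) \<le> B"
  shows "pexp (K (Suc x)) f
     = \<alpha> *\<^sub>R pexp (K x) (\<lambda>z. f (Suc z))
       + (1 - \<alpha>) *\<^sub>R pexp (K x) f"
  unfolding K_Suc using B
  by (subst integral_bind_pmf_bounded[where B=B])
     (auto simp: integral_measure_pmf[of UNIV] UNIV_bool)

lemma nn_integral_K_Suc:
  "(\<integral>\<^sup>+ y. f y \<partial>K (Suc x)) = ennreal \<alpha> * (\<integral>\<^sup>+ z. f (Suc z) \<partial>K x) + ennreal (1 - \<alpha>) * (\<integral>\<^sup>+ z. f z \<partial>K x)"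
  unfolding K_Suc by (simp add: mult.commute)

text \<open>The value at \<open>x\<close> is split with the weights \<alpha> and 1 - \<alpha> and
  compared term by term with the recursion. Values in \<open>ennreal\<close> admit unbounded
  \<open>f\<close> without integrability conditions.\<close>

lemma nn_integral_K_mono:
  assumes "mono (f :: nat \<Rightarrow> ennreal)"
  shows "mono (\<lambda>x. \<integral>\<^sup>+ y. f y \<partial>K x)"
proof (rule incseq_SucI)
  fix x
  have "(\<integral>\<^sup>+ z. f z \<partial>K x) = ennreal \<alpha> * (\<integral>\<^sup>+ z. f z \<partial>K x) + ennreal (1 - \<alpha>) * (\<integral>\<^sup>+ z. f z \<partial>K x)"
    by (simp flip: distrib_right ennreal_plus)
  also have "\<dots> \<le> ennreal \<alpha> * (\<integral>\<^sup>+ z. f (Suc z) \<partial>K x) + ennreal (1 - \<alpha>) * (\<integral>\<^sup>+ z. f z \<partial>K x)"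
    by (intro add_mono mult_left_mono nn_integral_mono) (auto intro: monoD[OF assms])
  finally show "(\<integral>\<^sup>+ z. f z \<partial>K x) \<le> (\<integral>\<^sup>+ y. f y \<partial>K (Suc x))"
    unfolding nn_integral_K_Suc .
qed

primrec Kn :: "nat \<Rightarrow> nat \<Rightarrow> nat pmf" where
  "Kn 0 x = return_pmf x"
| "Kn (Suc k) x = bind_pmf (Kn k x) K"

lemma Kn_Suc': "Kn (Suc k) x = bind_pmf (K x) (Kn k)"
proof (induction k)
  case (Suc k)
  have "Kn (Suc (Suc k)) x = bind_pmf (Kn (Suc k) x) K" by simp
  also have "\<dots> = bind_pmf (K x) (\<lambda>y. bind_pmf (Kn k y) K)"
    by (subst Suc.IH) (simp add: bind_assoc_pmf)
  finally show ?case by simp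
qed (simp add: bind_return_pmf bind_return_pmf')

lemma nn_integral_Kn_mono:
  "mono (f :: nat \<Rightarrow> ennreal) \<Longrightarrow> mono (\<lambda>x. \<integral>\<^sup>+ y. f y \<partial>Kn k x)"
proof (induction k arbitrary: f)
  case (Suc k)
  show ?case using Suc.IH[OF nn_integral_K_mono[OF Suc.prems]] by simp
qed simp

abbreviation (input) Tn :: "nat \<Rightarrow> (nat \<Rightarrow> 'c) \<Rightarrow> nat \<Rightarrow> 'c::euclidean_space" where
  "Tn k f x \<equiv> pexp (Kn k x) f"

lemma Tn_Suc:
  fixes f :: "nat \<Rightarrow> 'c :: euclidean_space"
  assumes B: "\<And>y. norm (f y) \<le> B"
  shows "Tn (Suc k) f x = pexp (K x) (Tn k f)"
  unfolding Kn_Suc' by (rule integral_bind_pmf_bounded[OF B])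

text \<open>Each of the \<open>x + 1\<close> individuals survives independently, so the kernel intertwines
  the difference operator with \<open>\<alpha>\<close> times itself.\<close>

lemma Tn_difference:
  fixes f :: "nat \<Rightarrow> 'c :: euclidean_space"
  assumes B: "\<And>y. norm (f y) \<le> B"
  shows "Tn k f (Suc x) - Tn k f x = \<alpha> ^ k *\<^sub>R Tn k (\<lambda>y. f (Suc y) - f y) x"
proof (induction k arbitrary: x)
  case (Suc k)
  have Bd: "norm (f (Suc y) - f y) \<le> B + B" for y
    using norm_triangle_ineq4[of "f (Suc y)" "f y"] B[of y] B[of "Suc y"] by linarith
  have BT: "norm (Tn k f y) \<le> B" for y
    by (rule norm_expectation_le[OF B])
  have "Tn (Suc k) f (Suc x) - Tn (Suc k) f x
     = \<alpha> *\<^sub>R (pexp (K x) (\<lambda>z. Tn k f (Suc z)) - pexp (K x) (Tn k f))"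
    by (subst (1 2) Tn_Suc[OF B]) (simp add: expectation_K_Suc[OF BT] algebra_simps)
  also have "\<dots> = \<alpha> *\<^sub>R (pexp (K x) (\<lambda>z. Tn k f (Suc z) - Tn k f z))"
    by (subst Bochner_Integration.integral_diff) (auto intro!: integrable_pmf_bounded[where B=B] BT)
  also have "\<dots> = \<alpha> ^ Suc k *\<^sub>R pexp (K x) (\<lambda>z. Tn k (\<lambda>y. f (Suc y) - f y) z)"
    by (simp add: Suc.IH)
  also have "\<dots> = \<alpha> ^ Suc k *\<^sub>R Tn (Suc k) (\<lambda>y. f (Suc y) - f y) x"
    by (subst Tn_Suc[OF Bd]) simp
  finally show ?case .
qed simp

text \<open>Raising the start by one unit costs \<open>\<alpha> ^ k\<close> times the largest jump 2
  B of \<open>f\<close>. The total grows linearly in the start, so first moments turn this into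
  convergence.\<close>

lemma Tn_lipschitz_0:
  fixes f :: "nat \<Rightarrow> 'c :: euclidean_space"
  assumes B: "\<And>y. norm (f y) \<le> B"
  shows "norm (Tn k f x - Tn k f 0) \<le> 2 * B * \<alpha> ^ k * x"
proof (induction x)
  case (Suc x)
  have Bd: "norm (f (Suc y) - f y) \<le> 2 * B" for y
    using norm_triangle_ineq4[of "f (Suc y)" "f y"] B[of y] B[of "Suc y"] by linarith
  have "norm (Tn k f (Suc x) - Tn k f x) \<le> \<alpha> ^ k * (2 * B)"
    unfolding Tn_difference[OF B]
    using norm_expectation_le[OF Bd, of "Kn k x" "\<lambda>y. y"]
    by (simp add: mult_left_mono)
  then have "norm (Tn k f (Suc x) - Tn k f 0) \<le> \<alpha> ^ k * (2 * B) + 2 * B * \<alpha> ^ k * x"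
    using Suc norm_triangle_ineq[of "Tn k f (Suc x) - Tn k f x" "Tn k f x - Tn k f 0"] by simp
  then show ?case by (simp add: algebra_simps)
qed simp

end

text \<open>Produces a drift inequality from a third moment that is cubic in the state: a leading
  coefficient below \<beta> leaves room to swallow the lower order terms.\<close>

lemma cubic_absorb:
  fixes a b c d \<beta> :: real
  assumes "a < \<beta>"
  obtains C where "0 \<le> C" "\<And>x. 0 \<le> x \<Longrightarrow> a * x ^ 3 + b * x\<^sup>2 + c * x + d \<le> \<beta> * x ^ 3 + C"
proof -
  define \<delta> where "\<delta> = \<beta> - a"
  define A where "A = \<bar>b\<bar> + \<bar>c\<bar> + \<bar>d\<bar>"
  \<comment> \<open>Beyond X one has x^2 + x + 1 \<le> 3 x^2 and 3 A \<le> \<delta> x, so the spare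
    cubic term wins; up to X the lower order terms are bounded by their value at X.\<close>
  define X where "X = 3 * A / \<delta> + 1"
  have \<delta>: "\<delta> > 0" and A: "A \<ge> 0" using assms by (auto simp: \<delta>_def A_def)
  have X: "X \<ge> 1" using \<delta> A by (simp add: X_def)
  show thesis
  proof (rule that[of "A * (X\<^sup>2 + X + 1)"])
    show "0 \<le> A * (X\<^sup>2 + X + 1)" using A X by simp
    fix x :: real assume x: "0 \<le> x"
    have "b * x\<^sup>2 \<le> A * x\<^sup>2" "c * x \<le> A * x" "d \<le> A"
      using x by (auto intro!: mult_right_mono simp: A_def)
    then have 1: "b * x\<^sup>2 + c * x + d \<le> A * (x\<^sup>2 + x + 1)" by (simp add: algebra_simps)
    have "A * (x\<^sup>2 + x + 1) \<le> \<delta> * x ^ 3 + A * (X\<^sup>2 + X + 1)"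
    proof (cases "x \<le> X")
      case True
      have "x\<^sup>2 + x + 1 \<le> X\<^sup>2 + X + 1" using True x by (intro add_mono power_mono) auto
      from mult_left_mono[OF this A] show ?thesis using \<delta> x by (smt (verit) mult_nonneg_nonneg zero_le_power)
    next
      case False
      have "x\<^sup>2 + x + 1 \<le> 3 * x\<^sup>2"
        using False X by (smt (verit) power2_eq_square mult_left_mono mult_cancel_left1 mult_mono)
      from mult_left_mono[OF this A] have "A * (x\<^sup>2 + x + 1) \<le> (3 * A) * x\<^sup>2" by simp
      also have "3 * A \<le> \<delta> * x" using False \<delta> by (simp add: X_def field_simps)
      then have "(3 * A) * x\<^sup>2 \<le> (\<delta> * x) * x\<^sup>2" by (rule mult_right_mono) simp
      also have "\<dots> = \<delta> * x ^ 3" by (simp add: power3_eq_cube power2_eq_square)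
      finally show ?thesis using A X by (smt (verit) mult_nonneg_nonneg zero_le_power2)
    qed
    with 1 show "a * x ^ 3 + b * x\<^sup>2 + c * x + d \<le> \<beta> * x ^ 3 + A * (X\<^sup>2 + X + 1)"
      by (simp add: \<delta>_def algebra_simps)
  qed
qed

section \<open>Moments of the kernel and third moments bounded in time\<close>

context inar
begin

definition \<mu> :: real where "\<mu> = pexp pe real"
definition \<sigma>2 :: real where "\<sigma>2 = pexp pe (\<lambda>e. (real e)\<^sup>2) - \<mu>\<^sup>2"

lemma integrable_pe:
  "integrable (measure_pmf pe) (\<lambda>e. real e)" "integrable (measure_pmf pe) (\<lambda>e. (real e)\<^sup>2)"
proof -
  have "real e \<le> real e ^ 3" "(real e)\<^sup>2 \<le> real e ^ 3" for e
    by (cases e; simp add: self_le_power power_increasing)+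
  then show "integrable (measure_pmf pe) (\<lambda>e. real e)" "integrable (measure_pmf pe) (\<lambda>e. (real e)\<^sup>2)"
    by (auto intro!: Bochner_Integration.integrable_bound[OF third_moment])
qed

text \<open>\<open>has_bochner_integral\<close> carries integrability and value together through the
  induction on \<open>x\<close>; non-negativity lets both be read off the \<open>ennreal\<close>
  identity.\<close>

lemma K_Suc_integral:
  assumes f: "\<And>y. 0 \<le> f y"
    and 1: "has_bochner_integral (measure_pmf (K x)) (\<lambda>z. f (Suc z)) (u :: real)"
    and 2: "has_bochner_integral (measure_pmf (K x)) f v"
  shows "has_bochner_integral (measure_pmf (K (Suc x))) f (\<alpha> * u + (1 - \<alpha>) * v)"
proof -
  have u: "u = pexp (K x) (\<lambda>z. f (Suc z))" "v = pexp (K x) f"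
    using 1 2 by (auto dest: has_bochner_integral_integral_eq)
  have uv: "u \<ge> 0" "v \<ge> 0" unfolding u by (auto intro!: integral_nonneg_AE f)
  have "(\<integral>\<^sup>+ y. ennreal (f y) \<partial>K (Suc x)) = ennreal \<alpha> * ennreal u + ennreal (1 - \<alpha>) * ennreal v"
    unfolding nn_integral_K_Suc u using 1 2 f
    by (subst (1 2) nn_integral_eq_integral) (auto simp: has_bochner_integral_iff)
  also have "\<dots> = ennreal (\<alpha> * u + (1 - \<alpha>) * v)"
    using uv by (simp add: ennreal_mult ennreal_plus)
  finally show ?thesis
    using uv by (subst (asm) nn_integral_eq_integrable) (auto simp: has_bochner_integral_iff f)
qed

text \<open>A third raw moment in terms of cumulants: k1^3 + 3 k1 k2 + k3. Here k1 and k2 are the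
  mean and variance of the next state, and k3 is the third cumulant of the binomial part (the second
  line) plus that of the innovation (the last line).\<close>

definition m3 :: "nat \<Rightarrow> real" where
  "m3 x = (\<alpha> * x + \<mu>) ^ 3 + 3 * (\<alpha> * x + \<mu>) * (\<alpha> * (1 - \<alpha>) * x + \<sigma>2)
     + \<alpha> * (1 - \<alpha>) * (1 - 2 * \<alpha>) * x
     + (pexp pe (\<lambda>e. real e ^ 3) - \<mu> ^ 3 - 3 * \<mu> * \<sigma>2)"

text \<open>The closed forms say that the cumulants of \<open>K x\<close> up to order three are affine in \<open>x\<close>.\<close>

lemma K_moments:
  shows K_moment1: "has_bochner_integral (measure_pmf (K x)) real (\<alpha> * x + \<mu>)"
    and K_moment2: "has_bochner_integral (measure_pmf (K x)) (\<lambda>y. (real y)\<^sup>2)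
       ((\<alpha> * x + \<mu>)\<^sup>2 + \<alpha> * (1 - \<alpha>) * x + \<sigma>2)"
    and K_moment3: "has_bochner_integral (measure_pmf (K x)) (\<lambda>y. real y ^ 3) (m3 x)"
proof (induction x)
  case 0
  {
    case 1 show ?case using integrable_pe by (simp add: K_0 has_bochner_integral_iff \<mu>_def)
  next
    case 2 show ?case using integrable_pe by (simp add: K_0 has_bochner_integral_iff \<sigma>2_def)
  next
    case 3 show ?case using third_moment by (simp add: K_0 has_bochner_integral_iff m3_def algebra_simps)
  }
next
  case (Suc x)
  note IH = Suc
  have one: "has_bochner_integral (measure_pmf (K x)) (\<lambda>_. 1 :: real) 1"
    by (simp add: has_bochner_integral_iff)
  have s1: "has_bochner_integral (measure_pmf (K x)) (\<lambda>y. real (Suc y)) (\<alpha> * x + \<mu> + 1)"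
    using has_bochner_integral_add[OF IH(1) one] by (simp add: add.commute)
  have s2: "has_bochner_integral (measure_pmf (K x)) (\<lambda>y. (real (Suc y))\<^sup>2)
     (((\<alpha> * x + \<mu>)\<^sup>2 + \<alpha> * (1 - \<alpha>) * x + \<sigma>2) + (2 * (\<alpha> * x + \<mu>) + 1))"
    using has_bochner_integral_add[OF IH(2) has_bochner_integral_add[OF
        has_bochner_integral_mult_right[OF IH(1), of 2] one]]
    by (rule has_bochner_integral_cong[THEN iffD1, rotated -1])
      (auto simp: power2_eq_square algebra_simps)
  have s3: "has_bochner_integral (measure_pmf (K x)) (\<lambda>y. real (Suc y) ^ 3)
     (m3 x + (3 * ((\<alpha> * x + \<mu>)\<^sup>2 + \<alpha> * (1 - \<alpha>) * x + \<sigma>2) + (3 * (\<alpha> * x + \<mu>) + 1)))"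
    using has_bochner_integral_add[OF IH(3) has_bochner_integral_add[OF
        has_bochner_integral_mult_right[OF IH(2), of 3] has_bochner_integral_add[OF
        has_bochner_integral_mult_right[OF IH(1), of 3] one]]]
    by (rule has_bochner_integral_cong[THEN iffD1, rotated -1])
      (auto simp: power2_eq_square power3_eq_cube algebra_simps)
  {
    case 1 show ?case
      using K_Suc_integral[OF _ s1 IH(1)] by (simp add: algebra_simps)
  next
    case 2 show ?case
      using K_Suc_integral[OF _ s2 IH(2)] by (simp add: algebra_simps power2_eq_square)
  next
    case 3 show ?case
      using K_Suc_integral[OF _ s3 IH(3)]
      by (simp add: m3_def algebra_simps power2_eq_square power3_eq_cube)
  }
qed

text \<open>The midpoint of \<alpha> and 1, a contraction rate strictly above the leading
  coefficient \<open>\<alpha> ^ 3\<close> of the third moment.\<close>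

definition \<beta> :: real where "\<beta> = (1 + \<alpha>) / 2"

lemma \<beta>: "0 \<le> \<beta>" "\<beta> < 1" using \<alpha>_pos \<alpha>_less_1 by (auto simp: \<beta>_def)

lemma Kn_third_moment:
  "\<exists>D\<ge>0. \<forall>k. (\<integral>\<^sup>+ y. ennreal (real y ^ 3) \<partial>Kn k 0) \<le> ennreal D"
proof -
  have "\<alpha> ^ 3 \<le> \<alpha>" using \<alpha>_pos \<alpha>_less_1 power_decreasing[of 1 3 \<alpha>] by simp
  then have a: "\<alpha> ^ 3 < \<beta>" using \<alpha>_less_1 by (simp add: \<beta>_def)
  obtain C where C: "0 \<le> C" "\<And>x::real. 0 \<le> x \<Longrightarrow> \<alpha> ^ 3 * x ^ 3 + (3 * \<alpha>\<^sup>2 * \<mu> + 3 * \<alpha> * (\<alpha> * (1 - \<alpha>))) * x\<^sup>2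
     + (3 * \<alpha> * \<mu>\<^sup>2 + 3 * \<alpha> * \<sigma>2 + 3 * \<mu> * (\<alpha> * (1 - \<alpha>)) + \<alpha> * (1 - \<alpha>) * (1 - 2 * \<alpha>)) * x
     + pexp pe (\<lambda>e. real e ^ 3) \<le> \<beta> * x ^ 3 + C"
    using cubic_absorb[OF a] by metis
  have drift: "(\<integral>\<^sup>+ y. ennreal (real y ^ 3) \<partial>K x) \<le> ennreal \<beta> * ennreal (real x ^ 3) + ennreal C" for x
  proof -
    have "(\<integral>\<^sup>+ y. ennreal (real y ^ 3) \<partial>K x) = ennreal (m3 x)"
      using K_moment3[of x] by (subst nn_integral_eq_integral) (auto simp: has_bochner_integral_iff)
    also have "m3 x \<le> \<beta> * real x ^ 3 + C"
      using C(2)[of "real x"] by (simp add: m3_def algebra_simps power2_eq_square power3_eq_cube)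
    finally show ?thesis using C(1) \<beta> by (simp add: ennreal_mult ennreal_plus ennreal_leI)
  qed
  \<comment> \<open>D is the fixed point of t -> \<beta> t + C, so the bound reproduces itself at
    each step of the induction.\<close>
  define D where "D = C / (1 - \<beta>)"
  have D: "\<beta> * D + C = D" "D \<ge> 0" using \<beta> C(1) by (auto simp: D_def field_simps)
  show ?thesis
  proof (intro exI[of _ D] conjI D(2) allI)
    fix k show "(\<integral>\<^sup>+ y. ennreal (real y ^ 3) \<partial>Kn k 0) \<le> ennreal D"
    proof (induction k)
      case (Suc k)
      have "(\<integral>\<^sup>+ y. ennreal (real y ^ 3) \<partial>Kn (Suc k) 0)
          \<le> (\<integral>\<^sup>+ x. ennreal \<beta> * ennreal (real x ^ 3) + ennreal C \<partial>Kn k 0)"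
        using drift by (auto intro!: nn_integral_mono)
      also have "\<dots> = ennreal \<beta> * (\<integral>\<^sup>+ x. ennreal (real x ^ 3) \<partial>Kn k 0) + ennreal C"
        by (simp add: nn_integral_add nn_integral_cmult measure_pmf.emeasure_space_1)
      also have "\<dots> \<le> ennreal \<beta> * ennreal D + ennreal C"
        by (intro add_mono mult_left_mono Suc.IH) auto
      also have "\<dots> = ennreal (\<beta> * D + C)"
        using \<beta>(1) D(2) C(1) by (simp add: ennreal_mult ennreal_plus)
      finally show ?case by (simp add: D)
    qed (simp add: D)
  qed
qed

end

section \<open>Stationary law\<close>

context inar
begin

lemma Kn_first_moment:
  "\<exists>D\<ge>0. \<forall>k. (\<integral>\<^sup>+ y. ennreal (real y) \<partial>Kn k 0) \<le> ennreal D"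
proof -
  obtain D where D: "0 \<le> D" "\<And>k. (\<integral>\<^sup>+ y. ennreal (real y ^ 3) \<partial>Kn k 0) \<le> ennreal D"
    using Kn_third_moment by blast
  have "real y \<le> real y ^ 3" for y by (cases y) (auto simp: self_le_power)
  then have "(\<integral>\<^sup>+ y. ennreal (real y) \<partial>Kn k 0) \<le> (\<integral>\<^sup>+ y. ennreal (real y ^ 3) \<partial>Kn k 0)" for k
    by (auto intro!: nn_integral_mono ennreal_leI)
  with D show ?thesis using order_trans by meson
qed

text \<open>Markov's inequality. Tightness uniform in time keeps mass from escaping when the
  stationary law is built as a limit.\<close>

lemma Kn_tail:
  "\<exists>D\<ge>0. \<forall>k N. measure_pmf.prob (Kn k 0) {Suc N..} \<le> D / Suc N"
proof -
  obtain D where D: "0 \<le> D" "\<And>k. (\<integral>\<^sup>+ y. ennreal (real y) \<partial>Kn k 0) \<le> ennreal D"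
    using Kn_first_moment by blast
  show ?thesis
  proof (intro exI[of _ D] conjI D(1) allI)
    fix k N
    have "ennreal (real (Suc N) * measure_pmf.prob (Kn k 0) {Suc N..})
        = ennreal (real (Suc N)) * emeasure (Kn k 0) {Suc N..}"
      by (simp add: ennreal_mult measure_pmf.emeasure_eq_measure)
    also have "\<dots> = (\<integral>\<^sup>+ y. ennreal (real (Suc N)) * indicator {Suc N..} y \<partial>Kn k 0)"
      by (subst nn_integral_cmult_indicator) auto
    also have "\<dots> \<le> (\<integral>\<^sup>+ y. ennreal (real y) \<partial>Kn k 0)"
      by (intro nn_integral_mono) (auto split: split_indicator simp del: of_nat_Suc intro!: ennreal_leI)
    also note D(2)[of k]
    finally have "real (Suc N) * measure_pmf.prob (Kn k 0) {Suc N..} \<le> D"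
      using D(1) by (subst (asm) ennreal_le_iff) auto
    then show "measure_pmf.prob (Kn k 0) {Suc N..} \<le> D / Suc N"
      by (simp add: field_simps)
  qed
qed

text \<open>Time k + 1 from 0 is time k from a random state of law \<open>K 0\<close>, whose mean
  distance to 0 is \<mu>. By the Lipschitz bound the increments in k are therefore at most
  geometric.\<close>

lemma Tn_convergent:
  fixes f :: "nat \<Rightarrow> real"
  assumes B: "\<And>y. norm (f y) \<le> B"
  shows "convergent (\<lambda>k. Tn k f 0)"
proof -
  have B0: "B \<ge> 0" using B[of 0] norm_ge_zero order_trans by blast
  have BT: "norm (Tn k f y) \<le> B" for k y
    by (rule norm_expectation_le[OF B])
  have step: "norm (Tn (Suc k) f 0 - Tn k f 0) \<le> (2 * B * \<mu>) * \<alpha> ^ k" for k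
  proof -
    have "Tn (Suc k) f 0 - Tn k f 0 = pexp (K 0) (\<lambda>y. Tn k f y - Tn k f 0)"
      by (subst Tn_Suc[OF B], subst Bochner_Integration.integral_diff)
        (auto intro!: integrable_pmf_bounded[where B=B] BT)
    also have "norm \<dots> \<le> pexp (K 0) (\<lambda>y. norm (Tn k f y - Tn k f 0))"
      by (rule integral_norm_bound)
    also have "\<dots> \<le> pexp (K 0) (\<lambda>y. (2 * B * \<alpha> ^ k) * real y)"
    proof (rule integral_mono)
      show "integrable (measure_pmf (K 0)) (\<lambda>y. (2 * B * \<alpha> ^ k) * real y)"
        using K_moment1[of 0] by (intro integrable_mult_right) (auto simp: has_bochner_integral_iff)
      show "integrable (measure_pmf (K 0)) (\<lambda>y. norm (Tn k f y - Tn k f 0))"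
        by (intro integrable_norm Bochner_Integration.integrable_diff)
          (auto intro!: integrable_pmf_bounded[where B=B] BT)
    qed (use Tn_lipschitz_0[OF B] in auto)
    also have "\<dots> = (2 * B * \<mu>) * \<alpha> ^ k"
      using has_bochner_integral_integral_eq[OF K_moment1[of 0]] by simp
    finally show ?thesis .
  qed
  have "summable (\<lambda>k. Tn (Suc k) f 0 - Tn k f 0)"
    by (rule summable_comparison_test'[of "\<lambda>k. (2 * B * \<mu>) * \<alpha> ^ k" 0])
      (use step \<alpha>_pos \<alpha>_less_1 in \<open>auto intro!: summable_mult summable_geometric\<close>)
  then have "convergent (\<lambda>n. \<Sum>k<n. Tn (Suc k) f 0 - Tn k f 0)"
    by (simp add: summable_iff_convergent)
  then have "convergent (\<lambda>n. (Tn n f 0 - Tn 0 f 0) + Tn 0 f 0)"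
    unfolding sum_lessThan_telescope[of "\<lambda>k. Tn k f 0"] by (intro convergent_add convergent_const)
  then show ?thesis by simp
qed

text \<open>The point masses of the laws started at 0 converge to weights \<open>q\<close>. By
  tightness \<open>q\<close> sums to 1 and the limit functional \<open>L\<close> is integration
  against it.\<close>

lemma stationary_exists:
  obtains p :: "nat pmf" where "bind_pmf p K = p"
    "\<And>f :: nat \<Rightarrow> real. \<And>B. (\<And>y. norm (f y) \<le> B) \<Longrightarrow> (\<lambda>k. Tn k f 0) \<longlonglongrightarrow> pexp p f"
proof -
  obtain D where D: "0 \<le> D" "\<And>k N. measure_pmf.prob (Kn k 0) {Suc N..} \<le> D / Suc N"
    using Kn_tail by blast
  define L where "L f = lim (\<lambda>k. Tn k f 0)" for f :: "nat \<Rightarrow> real"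
  have L: "(\<lambda>k. Tn k f 0) \<longlonglongrightarrow> L f" if "\<And>y. norm (f y) \<le> B" for f B
    using Tn_convergent[OF that] by (simp add: L_def convergent_LIMSEQ_iff)
  define q where "q y = L (indicator {y})" for y
  have q: "(\<lambda>k. pmf (Kn k 0) y) \<longlonglongrightarrow> q y" for y
    using L[of "indicator {y}" 1] by (simp add: q_def measure_pmf_single)
  have q0: "q y \<ge> 0" for y
    using q by (rule LIMSEQ_le_const) auto
  \<comment> \<open>Cutting off at N costs the tail bound, which is uniform in k and hence survives
    the limit k to infinity.\<close>
  have approx: "\<bar>(\<Sum>y<Suc N. q y * f y) - L f\<bar> \<le> B * (D / Suc N)"
    if B: "\<And>y. norm (f y) \<le> B" for f :: "nat \<Rightarrow> real" and B N
  proof -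
    have B0: "B \<ge> 0" using B[of 0] norm_ge_zero order_trans by blast
    have "(\<lambda>k. \<bar>(\<Sum>y<Suc N. pmf (Kn k 0) y * f y) - Tn k f 0\<bar>) \<longlonglongrightarrow> \<bar>(\<Sum>y<Suc N. q y * f y) - L f\<bar>"
      by (intro tendsto_intros q L[OF B])
    moreover have "\<bar>(\<Sum>y<Suc N. pmf (Kn k 0) y * f y) - Tn k f 0\<bar> \<le> B * (D / Suc N)" for k
    proof -
      have "(\<Sum>y<Suc N. pmf (Kn k 0) y * f y) = Tn k (\<lambda>y. indicator {..<Suc N} y * f y) 0"
        by (subst integral_measure_pmf[of "{..<Suc N}"])
          (auto split: split_indicator_asm intro!: sum.cong)
      then have "(\<Sum>y<Suc N. pmf (Kn k 0) y * f y) - Tn k f 0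
          = Tn k (\<lambda>y. indicator {..<Suc N} y * f y - f y) 0"
        by (subst Bochner_Integration.integral_diff)
          (auto intro!: integrable_pmf_bounded[where B=B] B simp: B0 B[simplified] split: split_indicator)
      also have "\<bar>\<dots>\<bar> \<le> Tn k (\<lambda>y. \<bar>indicator {..<Suc N} y * f y - f y\<bar>) 0"
        by (rule integral_abs_bound)
      also have "\<dots> \<le> Tn k (\<lambda>y. B * indicator {Suc N..} y) 0"
        by (intro integral_mono integrable_pmf_bounded[where B=B])
          (auto split: split_indicator simp: B0 B[simplified])
      also have "\<dots> \<le> B * (D / Suc N)"
        using mult_left_mono[OF D(2) B0] by simp
      finally show ?thesis .
    qed
    ultimately show ?thesis by (intro LIMSEQ_le_const2) auto
  qed
  have lim: "(\<lambda>N. \<Sum>y<N. q y * f y) \<longlonglongrightarrow> L f" if B: "\<And>y. norm (f y) \<le> B" for f :: "nat \<Rightarrow> real" and B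
  proof -
    have "(\<lambda>N. (\<Sum>y<Suc N. q y * f y) - L f) \<longlonglongrightarrow> 0"
    proof (rule Lim_null_comparison[OF always_eventually])
      show "\<forall>N. norm ((\<Sum>y<Suc N. q y * f y) - L f) \<le> B * (D / Suc N)"
        using approx[OF B] by auto
      have "(\<lambda>N. B * D * inverse (real (Suc N))) \<longlonglongrightarrow> B * D * 0"
        by (intro tendsto_intros LIMSEQ_inverse_real_of_nat)
      then show "(\<lambda>N. B * (D / real (Suc N))) \<longlonglongrightarrow> 0" by (simp add: divide_inverse mult.assoc)
    qed
    then show ?thesis
      by (subst (asm) LIM_zero_iff, subst (asm) filterlim_sequentially_Suc) simp
  qed
  have "L (\<lambda>_. 1) = 1" by (simp add: L_def)
  then have sums1: "q sums 1" using lim[of "\<lambda>_. 1" 1] by (simp add: sums_def)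
  define p where "p = embed_pmf q"
  have nn1: "(\<integral>\<^sup>+ y. ennreal (q y) \<partial>count_space UNIV) = 1"
    using sums1 by (simp add: nn_integral_count_space_nat suminf_ennreal_eq[OF q0 sums1])
  have p: "pmf p y = q y" for y
    unfolding p_def by (rule pmf_embed_pmf[OF q0 nn1])
  have expL: "pexp p f = L f" if B: "\<And>y. norm (f y) \<le> B" for f :: "nat \<Rightarrow> real" and B
  proof -
    have int: "integrable (count_space UNIV) (\<lambda>y. pmf p y * f y)"
      using integrable_pmf_bounded[of f B p, OF B]
      by (simp add: measure_pmf_eq_density integrable_density)
    have "pexp p f = (\<Sum>y. pmf p y * f y)"
      using int by (simp add: measure_pmf_eq_density integral_density integral_count_space_nat)
    also have "\<dots> = L f"
      using lim[OF B] by (intro sums_unique[symmetric]) (simp add: sums_def p)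
    finally show ?thesis .
  qed
  show thesis
  proof (rule that[of p])
    show "bind_pmf p K = p"
    proof (rule pmf_eqI)
      fix i :: nat
      \<comment> \<open>Averaging \<open>pmf (K x) i\<close> over the law at time k gives the law at
        time k + 1, which has the same limit \<open>q i\<close>.\<close>
      have "pmf (bind_pmf p K) i = L (\<lambda>x. pmf (K x) i)"
        unfolding pmf_bind by (rule expL[of _ 1]) (simp add: pmf_le_1)
      moreover have "(\<lambda>k. pmf (Kn (Suc k) 0) i) \<longlonglongrightarrow> q i"
        using q[of i] by (subst filterlim_sequentially_Suc)
      then have "(\<lambda>k. Tn k (\<lambda>x. pmf (K x) i) 0) \<longlonglongrightarrow> q i"
        by (simp add: pmf_bind)
      ultimately show "pmf (bind_pmf p K) i = pmf p i"
        using L[of "\<lambda>x. pmf (K x) i" 1] by (auto simp: pmf_le_1 p intro: LIMSEQ_unique)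
    qed
    show "(\<lambda>k. Tn k f 0) \<longlonglongrightarrow> pexp p f"
      if "\<And>y. norm (f y) \<le> B" for f :: "nat \<Rightarrow> real" and B
      using L[OF that] expL[OF that] by simp
  qed
qed

lemma stationary_iterate:
  "bind_pmf p K = p \<Longrightarrow> bind_pmf p (Kn k) = p"
proof (induction k)
  case (Suc k)
  have "Kn (Suc k) = (\<lambda>x. bind_pmf (Kn k x) K)" by auto
  then have "bind_pmf p (Kn (Suc k)) = bind_pmf (bind_pmf p (Kn k)) K"
    by (simp add: bind_assoc_pmf)
  then show ?case using Suc by (simp only:)
next
  case 0
  have "Kn 0 = return_pmf" by auto
  then show ?case by (simp add: bind_return_pmf')
qed

text \<open>The law from any start merges with the law from 0. Integrating over the start under
  \<open>r\<close>, which \<open>Kn k\<close> leaves invariant, identifies \<open>r\<close> with the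
  common limit.\<close>

lemma stationary_unique:
  assumes p: "bind_pmf p K = p" and r: "bind_pmf r K = r"
    and lim: "\<And>f :: nat \<Rightarrow> real. \<And>B. (\<And>y. norm (f y) \<le> B) \<Longrightarrow> (\<lambda>k. Tn k f 0) \<longlonglongrightarrow> pexp p f"
  shows "r = p"
proof (rule pmf_eqI)
  fix i :: nat
  have B: "norm (indicator {i} y :: real) \<le> 1" for y by (auto split: split_indicator)
  have pw: "(\<lambda>k. pmf (Kn k x) i) \<longlonglongrightarrow> pmf p i" for x
  proof -
    have "(\<lambda>k. Tn k (indicator {i} :: nat \<Rightarrow> real) x - Tn k (indicator {i} :: nat \<Rightarrow> real) 0) \<longlonglongrightarrow> 0"
    proof (rule Lim_null_comparison[OF always_eventually])
      show "\<forall>k. norm (Tn k (indicator {i} :: nat \<Rightarrow> real) x - Tn k (indicator {i} :: nat \<Rightarrow> real) 0) \<le> 2 * 1 * \<alpha> ^ k * x"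
        by (intro allI Tn_lipschitz_0[OF B])
      have "(\<lambda>k. 2 * 1 * \<alpha> ^ k * real x) \<longlonglongrightarrow> 2 * 1 * 0 * real x"
        using \<alpha>_less_1 by (intro tendsto_intros LIMSEQ_power_zero) auto
      then show "(\<lambda>k. 2 * 1 * \<alpha> ^ k * x) \<longlonglongrightarrow> 0" by simp
    qed
    from tendsto_add[OF this lim[of "indicator {i}" 1]] B show ?thesis by (simp add: measure_pmf_single)
  qed
  have "(\<lambda>k. pexp r (\<lambda>x. pmf (Kn k x) i)) \<longlonglongrightarrow> pexp r (\<lambda>x. pmf p i)"
    by (rule integral_dominated_convergence[where w="\<lambda>_. 1"]) (auto simp: pw pmf_le_1)
  moreover have "pexp r (\<lambda>x. pmf (Kn k x) i) = pmf r i" for k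
    using arg_cong[OF stationary_iterate[OF r, of k], of "\<lambda>p. pmf p i"] by (simp add: pmf_bind)
  ultimately show "pmf r i = pmf p i" by (simp add: LIMSEQ_const_iff)
qed

abbreviation S where "S \<equiv> inar_stationary \<alpha> pe"

lemma stationary_S: "bind_pmf S K = S"
  and Tn_tendsto: "(\<And>y. norm (f y :: real) \<le> B) \<Longrightarrow> (\<lambda>k. Tn k f 0) \<longlonglongrightarrow> pexp S f"
proof -
  obtain p where p: "bind_pmf p K = p"
    "\<And>f :: nat \<Rightarrow> real. \<And>B. (\<And>y. norm (f y) \<le> B) \<Longrightarrow> (\<lambda>k. Tn k f 0) \<longlonglongrightarrow> pexp p f"
    using stationary_exists by metis
  have "S = p"
    unfolding inar_stationary_def using p stationary_unique by (intro the_equality) blast+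
  with p show "bind_pmf S K = S"
    "(\<And>y. norm (f y :: real) \<le> B) \<Longrightarrow> (\<lambda>k. Tn k f 0) \<longlonglongrightarrow> pexp S f" by auto
qed

text \<open>Convergence is available for bounded functions only, so the moment bound passes to the
  limit by Fatou's lemma, applied to the point masses under counting measure.\<close>

lemma S_third_moment: "integrable (measure_pmf S) (\<lambda>x. real x ^ 3)"
proof -
  obtain D where D: "0 \<le> D" "\<And>k. (\<integral>\<^sup>+ y. ennreal (real y ^ 3) \<partial>Kn k 0) \<le> ennreal D"
    using Kn_third_moment by blast
  have q: "(\<lambda>k. pmf (Kn k 0) y) \<longlonglongrightarrow> pmf S y" for y
    using Tn_tendsto[of "indicator {y}" 1] by (auto simp: measure_pmf_single split: split_indicator)
  have "(\<integral>\<^sup>+ y. ennreal (real y ^ 3) \<partial>S) = (\<integral>\<^sup>+ y. ennreal (pmf S y * real y ^ 3) \<partial>count_space UNIV)"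
    by (simp add: nn_integral_measure_pmf ennreal_mult)
  also have "\<dots> = (\<integral>\<^sup>+ y. liminf (\<lambda>k. ennreal (pmf (Kn k 0) y * real y ^ 3)) \<partial>count_space UNIV)"
    by (intro nn_integral_cong lim_imp_Liminf[symmetric] tendsto_ennrealI tendsto_intros q) auto
  also have "\<dots> \<le> liminf (\<lambda>k. \<integral>\<^sup>+ y. ennreal (pmf (Kn k 0) y * real y ^ 3) \<partial>count_space UNIV)"
    by (rule nn_integral_liminf) auto
  also have "\<dots> = liminf (\<lambda>k. \<integral>\<^sup>+ y. ennreal (real y ^ 3) \<partial>Kn k 0)"
    by (simp add: nn_integral_measure_pmf ennreal_mult)
  also have "\<dots> \<le> liminf (\<lambda>_::nat. ennreal D)"
    by (intro Liminf_mono always_eventually allI D)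
  also have "\<dots> < \<infinity>" by (simp add: Liminf_const)
  finally show ?thesis by (intro integrableI_nonneg) auto
qed

text \<open>With positive probability everybody survives and a positive innovation arrives; in the
  induction the added individual survives with weight \<alpha>.\<close>

lemma K_tail_pos: "0 < emeasure (K x) {Suc x..}"
proof (induction x)
  case 0
  have "measure_pmf.prob pe {Suc 0..} = 1 - pmf pe 0"
  proof -
    have "UNIV - {0} = {Suc 0..}" by auto
    then show ?thesis
      using measure_pmf.prob_compl[of "{0}" pe] by (simp add: measure_pmf_single)
  qed
  then show ?case using innovation by (simp add: K_0 measure_pmf.emeasure_eq_measure)
next
  case (Suc x)
  have "0 < ennreal \<alpha> * emeasure (K x) {Suc x..}"
    using Suc \<alpha>_pos by (simp add: ennreal_zero_less_mult_iff)
  also have "\<dots> = ennreal \<alpha> * (\<integral>\<^sup>+ z. indicator {Suc (Suc x)..} (Suc z) \<partial>K x)"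
  proof -
    have "(\<lambda>z. indicator {Suc (Suc x)..} (Suc z) :: ennreal) = indicator {Suc x..}"
      by (auto split: split_indicator)
    then show ?thesis by simp
  qed
  also have "\<dots> \<le> (\<integral>\<^sup>+ z. indicator {Suc (Suc x)..} z \<partial>K (Suc x))"
    unfolding nn_integral_K_Suc by simp
  finally show ?case by simp
qed

text \<open>The stationary chain climbs one level per step, monotonicity making the climb from
  \<open>x\<close> a lower bound for that from every higher state. These tail masses become the
  denominators in the domination bounds.\<close>

lemma S_tail_pos: "0 < emeasure S {x..}"
proof (induction x)
  case (Suc x)
  have m: "mono (indicator {Suc x..} :: nat \<Rightarrow> ennreal)"
    by (auto simp: mono_def split: split_indicator)
  have "0 < emeasure (K x) {Suc x..} * emeasure S {x..}"
    using Suc K_tail_pos by (simp add: ennreal_zero_less_mult_iff)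
  also have "\<dots> = (\<integral>\<^sup>+ y. emeasure (K x) {Suc x..} * indicator {x..} y \<partial>S)"
    by (subst nn_integral_cmult_indicator) auto
  also have "\<dots> \<le> (\<integral>\<^sup>+ y. emeasure (K y) {Suc x..} \<partial>S)"
    using monoD[OF nn_integral_K_mono[OF m], of x]
    by (intro nn_integral_mono) (auto split: split_indicator)
  also have "\<dots> = emeasure (bind_pmf S K) {Suc x..}" by simp
  finally show ?case by (simp only: stationary_S)
qed (simp add: measure_pmf.emeasure_space_1[simplified])

text \<open>Domination by the stationary law, a consequence of monotonicity of the kernel: it bounds
  moments and tails of the chain uniformly in time.\<close>

lemma Kn_dominated:
  assumes "mono (f :: nat \<Rightarrow> ennreal)"
  shows "(\<integral>\<^sup>+ y. f y \<partial>Kn k x) * emeasure S {x..} \<le> (\<integral>\<^sup>+ y. f y \<partial>S)"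
proof -
  have "(\<integral>\<^sup>+ y. f y \<partial>Kn k x) * emeasure S {x..} = (\<integral>\<^sup>+ z. (\<integral>\<^sup>+ y. f y \<partial>Kn k x) * indicator {x..} z \<partial>S)"
    by (subst nn_integral_cmult_indicator) auto
  also have "\<dots> \<le> (\<integral>\<^sup>+ z. (\<integral>\<^sup>+ y. f y \<partial>Kn k z) \<partial>S)"
    using monoD[OF nn_integral_Kn_mono[OF assms], of x]
    by (intro nn_integral_mono) (auto split: split_indicator)
  also have "\<dots> = (\<integral>\<^sup>+ y. f y \<partial>bind_pmf S (Kn k))" by simp
  also have "\<dots> = (\<integral>\<^sup>+ y. f y \<partial>S)" by (simp only: stationary_iterate[OF stationary_S])
  finally show ?thesis .
qed

end

section \<open>Paths and additive functionals\<close>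

text \<open>The newest value comes first, hence the swapped arguments of \<open>d\<close>: the
  transition goes from \<open>x\<close> to \<open>y\<close>.\<close>

fun acc :: "(nat \<Rightarrow> nat \<Rightarrow> real) \<Rightarrow> nat list \<Rightarrow> real" where
  "acc d (y # x # h) = d x y + acc d (x # h)"
| "acc d _ = 0"

lemma acc_Cons: "h \<noteq> [] \<Longrightarrow> acc d (y # h) = d (hd h) y + acc d h"
  by (cases h) auto

lemma acc_scale: "acc (\<lambda>x y. c * d x y) h = c * acc d h"
  by (induction h rule: acc.induct[of _ d]) (auto simp: algebra_simps)

context inar
begin

text \<open>Paths are stored with the most recent value first, so \<open>hd\<close> is the current state.\<close>

primrec ext :: "nat \<Rightarrow> nat list \<Rightarrow> nat list pmf" where
  "ext 0 l = return_pmf l"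
| "ext (Suc k) l = bind_pmf (ext k l) (\<lambda>h. map_pmf (\<lambda>y. y # h) (K (hd h)))"

lemma ext_nonempty: "l \<noteq> [] \<Longrightarrow> h \<in> set_pmf (ext k l) \<Longrightarrow> h \<noteq> []"
  by (induction k arbitrary: h) auto

lemma map_hd_ext: "l \<noteq> [] \<Longrightarrow> map_pmf hd (ext k l) = Kn k (hd l)"
proof (induction k)
  case (Suc k)
  have "map_pmf hd (ext (Suc k) l) = bind_pmf (ext k l) (\<lambda>h. K (hd h))"
    by (simp add: map_bind_pmf pmf.map_comp o_def pmf.map_ident)
  also have "\<dots> = bind_pmf (map_pmf hd (ext k l)) K"
    by (simp add: bind_map_pmf)
  finally show ?case using Suc by simp
qed simp

text \<open>One weight for all estimates: at least 1, monotone, integrable under \<open>S\<close>,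
  and up to constants above the state, its square and the conditional variance of the martingale
  increments.\<close>

definition G :: "nat \<Rightarrow> real" where "G x = 1 + real x ^ 3"

lemma G_ge_1: "1 \<le> G x" by (simp add: G_def)
lemma G_ge: "real x \<le> G x"
proof (cases x)
  case (Suc n)
  then show ?thesis using self_le_power[of "real x" 3] by (simp add: G_def)
qed (simp add: G_def)
lemma G_nonneg [simp]: "0 \<le> G x" using G_ge_1[of x] by linarith

lemma integrable_S_G: "integrable (measure_pmf S) G"
  unfolding G_def[abs_def] by (intro Bochner_Integration.integrable_add S_third_moment) auto

text \<open>Dividing by the positive stationary mass above the start turns the domination into a
  bound that does not depend on \<open>k\<close>.\<close>

lemma Kn_dominated_real:
  assumes m: "mono f" and nn: "\<And>y. 0 \<le> f y" and int: "integrable (measure_pmf S) f"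
  shows "integrable (measure_pmf (Kn k x)) f"
    and "pexp (Kn k x) f \<le> pexp S f / measure_pmf.prob S {x..}"
proof -
  define p where "p = measure_pmf.prob S {x..}"
  have p: "p > 0" using S_tail_pos[of x] by (simp add: p_def measure_pmf.emeasure_eq_measure)
  have "mono (\<lambda>y. ennreal (f y))" using m by (auto simp: mono_def intro: ennreal_leI)
  from Kn_dominated[OF this, of k x]
  have *: "(\<integral>\<^sup>+ y. ennreal (f y) \<partial>Kn k x) * ennreal p \<le> ennreal (pexp S f)"
    using int nn by (simp add: nn_integral_eq_integral p_def measure_pmf.emeasure_eq_measure)
  show 1: "integrable (measure_pmf (Kn k x)) f"
  proof (rule integrableI_nonneg)
    show "(\<integral>\<^sup>+ y. ennreal (f y) \<partial>Kn k x) < \<infinity>"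
      using * p by (cases "\<integral>\<^sup>+ y. ennreal (f y) \<partial>Kn k x")
        (auto simp: ennreal_top_mult top_unique)
  qed (use nn in auto)
  have "ennreal (pexp (Kn k x) f * p) \<le> ennreal (pexp S f)"
    using * 1 nn p by (simp add: nn_integral_eq_integral ennreal_mult integral_nonneg_AE)
  then have "pexp (Kn k x) f * p \<le> pexp S f"
    using nn by (subst (asm) ennreal_le_iff) (auto intro: integral_nonneg_AE)
  then show "pexp (Kn k x) f \<le> pexp S f / measure_pmf.prob S {x..}"
    using p by (simp add: field_simps p_def)
qed

lemma mono_G: "mono G"
  by (auto simp: mono_def G_def intro: power_mono)

lemma integrable_Kn_G: "integrable (measure_pmf (Kn k x)) G"
  by (rule Kn_dominated_real(1)[OF mono_G _ integrable_S_G]) auto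

lemma Kn_G_bounded: "\<exists>C\<ge>1. \<forall>k. pexp (Kn k x) G \<le> C"
proof (intro exI conjI allI)
  show "1 \<le> max 1 (pexp S G / measure_pmf.prob S {x..})" by simp
  show "pexp (Kn k x) G \<le> max 1 (pexp S G / measure_pmf.prob S {x..})" for k
    using Kn_dominated_real(2)[OF mono_G _ integrable_S_G, of k x] by simp
qed

lemma S_G_tail: "(\<lambda>B. pexp S (\<lambda>y. G y * indicator {B<..} y)) \<longlonglongrightarrow> 0"
proof -
  have "(\<lambda>B. pexp S (\<lambda>y. G y * indicator {B<..} y)) \<longlonglongrightarrow> pexp S (\<lambda>y. 0)"
  proof (rule integral_dominated_convergence[where w=G])
    show "AE y in S. (\<lambda>B. G y * indicator {B<..} y) \<longlonglongrightarrow> 0"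
    proof (rule AE_I2)
      fix y
      have "eventually (\<lambda>B. G y * indicator {B<..} y = 0) sequentially"
        using eventually_ge_at_top[of y] by eventually_elim auto
      then show "(\<lambda>B. G y * indicator {B<..} y) \<longlonglongrightarrow> 0" by (rule tendsto_eventually)
    qed
  qed (auto simp: integrable_S_G split: split_indicator)
  then show ?thesis by simp
qed

lemma G_tail_integrable: "integrable (measure_pmf S) (\<lambda>y. G y * indicator {B<..} y)"
  by (rule Bochner_Integration.integrable_bound[OF integrable_S_G]) (auto split: split_indicator)

text \<open>The truncated weight is still monotone, so domination applies to it: uniform
  integrability in time reduces to smallness of a single tail under \<open>S\<close>, with
  \<open>p\<close> as the price for the fixed start.\<close>

lemma Kn_G_tail:
  assumes "\<epsilon> > 0"
  shows "\<exists>B. (\<forall>k. pexp (Kn k x) (\<lambda>y. G y * indicator {B<..} y) \<le> \<epsilon>) \<and>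
           pexp S (\<lambda>y. G y * indicator {B<..} y) \<le> \<epsilon>"
proof -
  define p where "p = measure_pmf.prob S {x..}"
  have p: "p > 0" "p \<le> 1"
    using S_tail_pos[of x] by (auto simp: p_def measure_pmf.emeasure_eq_measure)
  have "eventually (\<lambda>B. pexp S (\<lambda>y. G y * indicator {B<..} y) < \<epsilon> * p) sequentially"
    using S_G_tail p assms by (intro order_tendstoD) auto
  then obtain B where B: "pexp S (\<lambda>y. G y * indicator {B<..} y) < \<epsilon> * p"
    by (auto simp: eventually_sequentially)
  have m: "mono (\<lambda>y. G y * indicator {B<..} y)"
    by (auto simp: mono_def split: split_indicator intro: monoD[OF mono_G])
  have "pexp (Kn k x) (\<lambda>y. G y * indicator {B<..} y) \<le> \<epsilon>" for k
  proof -
    have "pexp (Kn k x) (\<lambda>y. G y * indicator {B<..} y)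
       \<le> pexp S (\<lambda>y. G y * indicator {B<..} y) / p"
      unfolding p_def by (rule Kn_dominated_real(2)[OF m _ G_tail_integrable]) auto
    also have "\<dots> \<le> \<epsilon>" using B p by (simp add: field_simps)
    finally show ?thesis .
  qed
  moreover have "\<epsilon> * p \<le> \<epsilon>" using p assms by (simp add: mult_left_le)
  ultimately show "\<exists>B. (\<forall>k. pexp (Kn k x) (\<lambda>y. G y * indicator {B<..} y) \<le> \<epsilon>) \<and>
           pexp S (\<lambda>y. G y * indicator {B<..} y) \<le> \<epsilon>"
    using B by (auto intro!: exI[of _ B])
qed

lemma Kn_G_tail_integrable: "integrable (measure_pmf (Kn k x)) (\<lambda>y. G y * indicator {B<..} y)"
  by (rule Bochner_Integration.integrable_bound[OF integrable_Kn_G]) (auto split: split_indicator)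

text \<open>By invariance the stationary mean is that of a chain started from a random
  \<open>y\<close>. Comparing both starts with 0 costs x + y, which the weight \<open>G\<close>
  absorbs.\<close>

lemma Tn_ergodic:
  fixes f :: "nat \<Rightarrow> 'c :: euclidean_space"
  assumes B: "\<And>y. norm (f y) \<le> B"
  shows "norm (Tn k f x - pexp S f) \<le> 2 * B * \<alpha> ^ k * (G x + pexp S G)"
proof -
  have B0: "B \<ge> 0" using B[of 0] norm_ge_zero order_trans by blast
  have BT: "norm (Tn k f y) \<le> B" for y by (rule norm_expectation_le[OF B])
  have "pexp S f = pexp S (Tn k f)"
    using integral_bind_pmf_bounded[OF B, of S "Kn k"] by (simp add: stationary_iterate[OF stationary_S])
  then have "Tn k f x - pexp S f = pexp S (\<lambda>y. Tn k f x - Tn k f y)"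
    by (subst Bochner_Integration.integral_diff) (auto intro!: integrable_pmf_bounded[where B=B] BT)
  also have "norm \<dots> \<le> pexp S (\<lambda>y. norm (Tn k f x - Tn k f y))"
    by (rule integral_norm_bound)
  also have "\<dots> \<le> pexp S (\<lambda>y. 2 * B * \<alpha> ^ k * (G x + G y))"
  proof (rule integral_mono)
    show "integrable (measure_pmf S) (\<lambda>y. norm (Tn k f x - Tn k f y))"
      by (intro integrable_norm Bochner_Integration.integrable_diff)
        (auto intro!: integrable_pmf_bounded[where B=B] BT)
    show "integrable (measure_pmf S) (\<lambda>y. 2 * B * \<alpha> ^ k * (G x + G y))"
      by (intro integrable_mult_right Bochner_Integration.integrable_add integrable_S_G) auto
    fix y
    have "norm (Tn k f x - Tn k f y) \<le> norm (Tn k f x - Tn k f 0) + norm (Tn k f y - Tn k f 0)"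
      using norm_triangle_ineq4[of "Tn k f x - Tn k f 0" "Tn k f y - Tn k f 0"] by simp
    also have "\<dots> \<le> 2 * B * \<alpha> ^ k * x + 2 * B * \<alpha> ^ k * y"
      by (intro add_mono Tn_lipschitz_0[OF B])
    also have "\<dots> \<le> 2 * B * \<alpha> ^ k * G x + 2 * B * \<alpha> ^ k * G y"
      using B0 by (intro add_mono mult_left_mono G_ge) auto
    finally show "norm (Tn k f x - Tn k f y) \<le> 2 * B * \<alpha> ^ k * (G x + G y)"
      by (simp add: algebra_simps)
  qed
  also have "\<dots> = 2 * B * \<alpha> ^ k * (G x + pexp S G)"
    using integrable_S_G by simp
  finally show ?thesis .
qed

end

text \<open>The derivative of exp at 0, with an error of order o(1/N): such an error stays
  negligible after N accumulated steps.\<close>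

lemma exp_remainder_tendsto:
  fixes z :: complex
  shows "(\<lambda>N. real N * norm (exp (z / of_nat N) - 1 - z / of_nat N)) \<longlonglongrightarrow> 0"
proof (cases "z = 0")
  case False
  have lim: "(\<lambda>N. z / of_nat N) \<longlonglongrightarrow> 0" by (rule lim_const_over_n)
  have "filterlim (\<lambda>N. z / of_nat N) (at 0) sequentially"
    using lim False eventually_gt_at_top[of 0]
    by (auto simp: filterlim_at elim!: eventually_mono)
  then have "(\<lambda>N. (exp (z / of_nat N) - 1) / (z / of_nat N)) \<longlonglongrightarrow> 1"
    by (rule filterlim_compose[OF lim_exp_minus_1])
  then have "(\<lambda>N. norm (z * ((exp (z / of_nat N) - 1) / (z / of_nat N) - 1))) \<longlonglongrightarrow> norm (z * (1 - 1))"
    by (intro tendsto_intros)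
  moreover have "eventually (\<lambda>N. norm (z * ((exp (z / of_nat N) - 1) / (z / of_nat N) - 1))
      = real N * norm (exp (z / of_nat N) - 1 - z / of_nat N)) sequentially"
    using eventually_gt_at_top[of 0]
  proof eventually_elim
    case (elim N)
    have "z * ((exp (z / of_nat N) - 1) / (z / of_nat N) - 1) = of_nat N * (exp (z / of_nat N) - 1 - z / of_nat N)"
      using False elim by (simp add: field_simps)
    then show ?case by (simp add: norm_mult)
  qed
  ultimately show ?thesis by (simp add: filterlim_cong)
qed simp

context inar
begin

text \<open>Characteristic function of an additive functional along the chain, by comparing
  successive values: conditioning \<open>m\<close> steps back replaces \<open>\<lambda>(X\<^sub>k)\<close> by its stationary mean.\<close>

context
  fixes l :: "nat list" and d :: "nat \<Rightarrow> nat \<Rightarrow> nat \<Rightarrow> real" and lam :: "nat \<Rightarrow> complex" and c :: real and s :: nat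
  assumes l: "l \<noteq> []"
    and lim: "\<And>x. (\<lambda>N. of_nat N * (pexp (K x) (\<lambda>y. cis (d N x y)) - 1)) \<longlonglongrightarrow> lam x"
    and dom: "\<And>N x. norm (of_nat N * (pexp (K x) (\<lambda>y. cis (d N x y)) - 1)) \<le> c * G x"
    and small: "\<And>N x. N > 0 \<Longrightarrow> pexp (K x) (\<lambda>y. norm (cis (d N x y) - 1)) \<le> c * G x / sqrt N"
    and start: "(\<lambda>N. acc (d N) l) \<longlonglongrightarrow> 0"
begin

text \<open>An expectation of the current state tilted by the characteristic exponential of the
  whole path. With \<open>g\<close> constantly 1 it is the characteristic function; general
  \<open>g\<close> are what conditioning on earlier times produces.\<close>

definition w :: "nat \<Rightarrow> nat \<Rightarrow> (nat \<Rightarrow> complex) \<Rightarrow> complex" where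
  "w N k g = pexp (ext k l) (\<lambda>h. cis (acc (d N) h) * g (hd h))"

text \<open>The local characteristic exponent in state \<open>x\<close> before the limit: N times
  the one-step change.\<close>

definition lamN :: "nat \<Rightarrow> nat \<Rightarrow> complex" where
  "lamN N x = of_nat N * (pexp (K x) (\<lambda>y. cis (d N x y)) - 1)"

lemma c_nonneg: "c \<ge> 0"
proof -
  have "0 \<le> c * G 0" using order_trans[OF norm_ge_zero dom[of 0 0]] .
  then show ?thesis by (simp add: G_def)
qed

lemma lamN_bounded: "norm (lamN N x) \<le> 2 * real N"
proof -
  have "norm (pexp (K x) (\<lambda>y. cis (d N x y))) \<le> 1"
    by (rule norm_expectation_le) simp
  then have "norm (pexp (K x) (\<lambda>y. cis (d N x y)) - 1) \<le> 2"
    using norm_triangle_ineq4[of "pexp (K x) (\<lambda>y. cis (d N x y))" 1] by simp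
  then show ?thesis by (simp add: lamN_def norm_mult mult_left_mono mult.commute)
qed

lemma lam_le: "norm (lam x) \<le> c * G x"
  using tendsto_norm[OF lim[of x]] dom by (intro LIMSEQ_le_const2) auto

lemma w_bounded:
  assumes "\<And>x. norm (g x) \<le> b"
  shows "norm (w N k g) \<le> pexp (Kn k (hd l)) (\<lambda>x. norm (g x))"
proof -
  have "norm (w N k g) \<le> pexp (ext k l) (\<lambda>h. norm (cis (acc (d N) h) * g (hd h)))"
    unfolding w_def by (rule integral_norm_bound)
  also have "\<dots> = pexp (map_pmf hd (ext k l)) (\<lambda>x. norm (g x))"
    by (simp add: norm_mult)
  finally show ?thesis by (simp add: map_hd_ext[OF l])
qed

lemma w_le:
  assumes "\<And>x. norm (g x) \<le> b"
  shows "norm (w N k g) \<le> b"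
  unfolding w_def by (rule norm_expectation_le) (simp add: norm_mult assms)

lemma w_integrable:
  assumes "\<And>x. norm (g x) \<le> b"
  shows "integrable (measure_pmf (ext k l)) (\<lambda>h. cis (acc (d N) h) * g (hd h))"
  by (rule integrable_pmf_bounded[where B=b]) (simp add: norm_mult assms)

lemma w_diff:
  assumes "\<And>x. norm (g x) \<le> b" "\<And>x. norm (g' x) \<le> b'"
  shows "w N k g - w N k g' = w N k (\<lambda>x. g x - g' x)"
  unfolding w_def
  by (subst Bochner_Integration.integral_diff[symmetric])
    (auto intro!: w_integrable assms simp: right_diff_distrib)

lemma w_cmult: "w N k (\<lambda>x. z) = z * w N k (\<lambda>x. 1)"
  unfolding w_def by (simp add: mult.commute[of _ z])

lemma w_diff_le:
  assumes g: "\<And>x. norm (g x) \<le> b" "\<And>x. norm (g' x) \<le> b'"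
    and f: "\<And>x. norm (g x - g' x) \<le> f x" "integrable (measure_pmf (Kn k (hd l))) f"
  shows "norm (w N k g - w N k g') \<le> pexp (Kn k (hd l)) f"
proof -
  have b: "norm (g x - g' x) \<le> b + b'" for x
    using norm_triangle_ineq4[of "g x" "g' x"] g(1)[of x] g(2)[of x] by linarith
  have "norm (w N k g - w N k g') \<le> pexp (Kn k (hd l)) (\<lambda>x. norm (g x - g' x))"
    unfolding w_diff[OF g] by (rule w_bounded[OF b])
  also have "\<dots> \<le> pexp (Kn k (hd l)) f"
    by (intro integral_mono f integrable_norm integrable_pmf_bounded[where B="b + b'"] b)
  finally show ?thesis .
qed

lemma w_Suc:
  assumes g: "\<And>x. norm (g x) \<le> b"
  shows "w N (Suc k) g = w N k (\<lambda>x. pexp (K x) (\<lambda>y. cis (d N x y) * g y))"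
proof -
  have "w N (Suc k) g = pexp (ext k l)
     (\<lambda>h. pexp (K (hd h)) (\<lambda>y. cis (acc (d N) (y # h)) * g y))"
    unfolding w_def ext.simps
    by (subst integral_bind_pmf_bounded[where B=b]) (auto simp: norm_mult g)
  also have "\<dots> = w N k (\<lambda>x. pexp (K x) (\<lambda>y. cis (d N x y) * g y))"
    unfolding w_def
  proof (intro integral_cong_AE)
    show "AE h in ext k l. pexp (K (hd h)) (\<lambda>y. cis (acc (d N) (y # h)) * g y)
       = cis (acc (d N) h) * pexp (K (hd h)) (\<lambda>y. cis (d N (hd h) y) * g y)"
    proof (rule AE_pmfI)
      fix h assume "h \<in> set_pmf (ext k l)"
      then have "h \<noteq> []" using ext_nonempty l by blast
      then have "cis (acc (d N) (y # h)) * g y = cis (acc (d N) h) * (cis (d N (hd h) y) * g y)" for y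
        by (simp add: acc_Cons cis_mult[symmetric] mult.commute mult.left_commute)
      then show "pexp (K (hd h)) (\<lambda>y. cis (acc (d N) (y # h)) * g y)
       = cis (acc (d N) h) * pexp (K (hd h)) (\<lambda>y. cis (d N (hd h) y) * g y)"
        by (simp only: integral_mult_right_zero)
    qed
  qed auto
  finally show ?thesis .
qed

text \<open>A discrete evolution equation for the characteristic function. Were
  \<open>lamN N\<close> the constant \<open>pexp S lam\<close>, each step would multiply by 1 +
  \<open>pexp S lam\<close> / N; the following lemmas justify this replacement in the limit.\<close>

lemma w_increment: "of_nat N * (w N (Suc k) (\<lambda>_. 1) - w N k (\<lambda>_. 1)) = w N k (lamN N)"
proof -
  have e: "norm (pexp (K x) (\<lambda>y. cis (d N x y) * 1)) \<le> 1" for x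
    by (rule norm_expectation_le) simp
  have "of_nat N * (w N (Suc k) (\<lambda>_. 1) - w N k (\<lambda>_. 1))
     = of_nat N * w N k (\<lambda>x. pexp (K x) (\<lambda>y. cis (d N x y) * 1) - 1)"
    by (subst w_Suc[where b=1], simp, subst w_diff[OF e, of _ 1]) auto
  also have "\<dots> = w N k (lamN N)"
    unfolding w_def lamN_def
    by (subst integral_mult_right_zero[symmetric]) (simp add: mult.left_commute)
  finally show ?thesis .
qed

context
  fixes C :: real
  assumes C: "\<And>k. pexp (Kn k (hd l)) G \<le> C"
begin

text \<open>Forgetting the newest exponential factor costs O(1/sqrt N) by \<open>small\<close>,
  uniformly in time because the mean of \<open>G\<close> is at most \<open>C\<close>.\<close>

lemma w_step:
  assumes g: "\<And>x. norm (g x) \<le> b" and N: "N > 0"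
  shows "norm (w N (Suc k) g - w N k (\<lambda>x. pexp (K x) g)) \<le> b * (c * C / sqrt N)"
proof -
  have b: "b \<ge> 0" using g[of 0] norm_ge_zero order_trans by blast
  have "norm (w N k (\<lambda>x. pexp (K x) (\<lambda>y. cis (d N x y) * g y)) -
       w N k (\<lambda>x. pexp (K x) g)) \<le> pexp (Kn k (hd l)) (\<lambda>x. b * c / sqrt N * G x)"
  proof (rule w_diff_le)
    fix x
    show "norm (pexp (K x) (\<lambda>y. cis (d N x y) * g y)) \<le> b"
      by (rule norm_expectation_le) (simp add: norm_mult g)
    show "norm (pexp (K x) g) \<le> b"
      by (rule norm_expectation_le[OF g])
    have "pexp (K x) (\<lambda>y. cis (d N x y) * g y) - pexp (K x) g
       = pexp (K x) (\<lambda>y. (cis (d N x y) - 1) * g y)"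
      by (subst Bochner_Integration.integral_diff[symmetric])
        (auto intro!: integrable_pmf_bounded[where B=b] simp: norm_mult g algebra_simps)
    also have "norm \<dots> \<le> pexp (K x) (\<lambda>y. norm ((cis (d N x y) - 1) * g y))"
      by (rule integral_norm_bound)
    also have "\<dots> \<le> pexp (K x) (\<lambda>y. norm (cis (d N x y) - 1) * b)"
    proof (rule integral_mono)
      have 2: "norm (cis (d N x y) - 1) \<le> 2" for y
        using norm_triangle_ineq4[of "cis (d N x y)" 1] by simp
      show "integrable (measure_pmf (K x)) (\<lambda>y. norm ((cis (d N x y) - 1) * g y))"
        by (rule integrable_pmf_bounded[where B="2 * b"]) (auto simp: norm_mult intro!: mult_mono 2 g)
      show "integrable (measure_pmf (K x)) (\<lambda>y. norm (cis (d N x y) - 1) * b)"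
        by (rule integrable_pmf_bounded[where B="2 * b"]) (auto simp: abs_mult b intro!: mult_mono 2)
    qed (auto simp: norm_mult g intro!: mult_left_mono)
    also have "\<dots> = b * pexp (K x) (\<lambda>y. norm (cis (d N x y) - 1))" by simp
    also have "\<dots> \<le> b * (c * G x / sqrt N)" by (intro mult_left_mono small N b)
    finally show "norm (pexp (K x) (\<lambda>y. cis (d N x y) * g y) - pexp (K x) g)
       \<le> b * c / sqrt N * G x" by simp
  qed (auto intro!: integrable_mult_right integrable_Kn_G)
  also have "\<dots> = b * c / sqrt N * pexp (Kn k (hd l)) G" by simp
  also have "\<dots> \<le> b * c / sqrt N * C" using b c_nonneg by (intro mult_left_mono C) auto
  finally show ?thesis by (simp add: w_Suc[OF g])
qed

lemma w_steps:
  assumes g: "\<And>x. norm (g x) \<le> b" and N: "N > 0"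
  shows "norm (w N (j + m) g - w N j (Tn m g)) \<le> m * (b * (c * C / sqrt N))"
proof (induction m arbitrary: j)
  case (Suc m)
  have BT: "norm (Tn m g y) \<le> b" for y by (rule norm_expectation_le[OF g])
  have "w N j (Tn (Suc m) g) = w N j (\<lambda>x. pexp (K x) (Tn m g))"
    by (subst Tn_Suc[OF g]) simp
  then have "w N (j + Suc m) g - w N j (Tn (Suc m) g) = (w N (Suc j + m) g - w N (Suc j) (Tn m g))
     + (w N (Suc j) (Tn m g) - w N j (\<lambda>x. pexp (K x) (Tn m g)))" by simp
  also have "norm \<dots> \<le> m * (b * (c * C / sqrt N)) + b * (c * C / sqrt N)"
    by (rule norm_triangle_le[OF add_mono[OF Suc.IH w_step[OF BT N]]])
  finally show ?case by (simp add: algebra_simps add_divide_distrib)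
qed simp

text \<open>The last m exponential factors are dropped, the chain is left to mix for m steps, and
  the factors are put back. For fixed m the two exchanges vanish with N, while the mixing error is
  governed by \<open>\<alpha> ^ m\<close>.\<close>

lemma w_mix:
  assumes g: "\<And>x. norm (g x) \<le> b" and N: "N > 0"
  shows "norm (w N (j + m) g - pexp S g * w N (j + m) (\<lambda>_. 1))
     \<le> 2 * m * (b * (c * C / sqrt N)) + 2 * b * \<alpha> ^ m * (C + pexp S G)"
proof -
  have b: "b \<ge> 0" using g[of 0] norm_ge_zero order_trans by blast
  have BT: "norm (Tn m g y) \<le> b" for y by (rule norm_expectation_le[OF g])
  have BS: "norm (pexp S g) \<le> b" by (rule norm_expectation_le[OF g])
  let ?r = "b * (c * C / sqrt N)"
  have 1: "norm (w N (j + m) g - w N j (Tn m g)) \<le> m * ?r"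
    by (rule w_steps[OF g N])
  have "norm (w N j (Tn m g) - w N j (\<lambda>_. pexp S g))
     \<le> pexp (Kn j (hd l)) (\<lambda>x. 2 * b * \<alpha> ^ m * (G x + pexp S G))"
    by (rule w_diff_le[OF BT BS])
      (auto intro!: Tn_ergodic g integrable_mult_right Bochner_Integration.integrable_add integrable_Kn_G)
  also have "\<dots> = 2 * b * \<alpha> ^ m * (pexp (Kn j (hd l)) G + pexp S G)"
    using integrable_Kn_G by simp
  also have "\<dots> \<le> 2 * b * \<alpha> ^ m * (C + pexp S G)"
    using b by (intro mult_left_mono add_mono C) auto
  finally have 2: "norm (w N j (Tn m g) - w N j (\<lambda>_. pexp S g))
     \<le> 2 * b * \<alpha> ^ m * (C + pexp S G)" .
  have "norm (w N (j + m) (\<lambda>_. 1) - w N j (Tn m (\<lambda>_. 1))) \<le> m * (1 * (c * C / sqrt N))"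
    by (rule w_steps[OF _ N]) simp
  then have "norm (w N (j + m) (\<lambda>_. 1) - w N j (\<lambda>_. 1)) \<le> m * (c * C / sqrt N)" by simp
  then have le: "norm (pexp S g) * norm (w N (j + m) (\<lambda>_. 1) - w N j (\<lambda>_. 1)) \<le> b * (m * (c * C / sqrt N))"
    by (intro mult_mono BS) (auto simp: b)
  have dist: "norm (z * a - z * b) = norm z * norm (b - a)" for z a b :: complex
    using norm_mult[of z "a - b"] by (simp add: right_diff_distrib norm_minus_commute[of a b])
  have 3: "norm (pexp S g * w N j (\<lambda>_. 1) - pexp S g * w N (j + m) (\<lambda>_. 1)) \<le> m * ?r"
    unfolding dist by (rule order_trans[OF le eq_refl[OF mult.left_commute]])
  have "w N (j + m) g - pexp S g * w N (j + m) (\<lambda>_. 1)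
    = (w N (j + m) g - w N j (Tn m g)) + ((w N j (Tn m g) - w N j (\<lambda>_. pexp S g))
     + (pexp S g * w N j (\<lambda>_. 1) - pexp S g * w N (j + m) (\<lambda>_. 1)))"
    by (simp add: w_cmult[of _ _ "pexp S g"])
  also have "norm \<dots> \<le> m * ?r + (2 * b * \<alpha> ^ m * (C + pexp S G) + m * ?r)"
    by (intro norm_triangle_le add_mono 1 2 3)
  finally show ?thesis by (simp add: mult_ac)
qed

lemma w_lamN_le: "norm (w N k (lamN N)) \<le> c * C"
proof -
  have "norm (w N k (lamN N)) \<le> pexp (Kn k (hd l)) (\<lambda>x. norm (lamN N x))"
    by (rule w_bounded[OF lamN_bounded])
  also have "\<dots> \<le> pexp (Kn k (hd l)) (\<lambda>x. c * G x)"
    by (rule integral_mono)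
      (auto intro!: integrable_pmf_bounded[where B="2 * real N"] integrable_mult_right integrable_Kn_G
         simp: lamN_bounded dom[folded lamN_def])
  also have "\<dots> \<le> c * C" using c_nonneg C[of k] by (simp add: mult_left_mono)
  finally show ?thesis .
qed

text \<open>Mixing needs a bounded function, so \<open>lam\<close> is cut off at a level
  \<open>B\<close>; the tails are small uniformly in time by \<open>Kn_G_tail\<close>. The number m
  of mixing steps is fixed before N grows. The shares \<epsilon>/4 and \<epsilon>/8 add up to
  \<epsilon>.\<close>

lemma w_drift:
  assumes e: "\<epsilon> > 0"
  shows "\<exists>m N0. \<forall>N\<ge>N0. \<forall>j. norm (w N (j + m) (lamN N) - pexp S lam * w N (j + m) (\<lambda>_. 1)) \<le> \<epsilon>"
proof -
  define \<kappa> where "\<kappa> = pexp S lam"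
  \<comment> \<open>The summand 1 guards against c = 0.\<close>
  define e' where "e' = \<epsilon> / (4 * (c + 1))"
  have e': "e' > 0" using e c_nonneg by (simp add: e'_def)
  have ce': "c * e' \<le> \<epsilon> / 4"
    using e c_nonneg by (simp add: e'_def field_simps)
  obtain B where B: "\<And>k. pexp (Kn k (hd l)) (\<lambda>y. G y * indicator {B<..} y) \<le> e'"
    "pexp S (\<lambda>y. G y * indicator {B<..} y) \<le> e'"
    using Kn_G_tail[OF e', of "hd l"] by blast
  define g where "g x = lam x * indicator {..B} x" for x
  define b where "b = c * G B"
  have b: "b \<ge> 0" using c_nonneg by (simp add: b_def)
  have g: "norm (g x) \<le> b" for x
    using lam_le[of x] mult_left_mono[OF monoD[OF mono_G, of x B] c_nonneg]
    by (auto simp: g_def b_def c_nonneg split: split_indicator)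
  have int_lam: "integrable (measure_pmf S) lam"
    by (rule Bochner_Integration.integrable_bound[OF integrable_mult_right[OF integrable_S_G, of c]])
      (use lam_le c_nonneg in \<open>auto simp: abs_mult\<close>)
  have int_g: "integrable (measure_pmf S) g" by (rule integrable_pmf_bounded[OF g])
  have "\<kappa> - pexp S g = pexp S (\<lambda>x. lam x - g x)"
    unfolding \<kappa>_def using int_lam int_g by simp
  also have "norm \<dots> \<le> pexp S (\<lambda>x. norm (lam x - g x))"
    by (rule integral_norm_bound)
  also have "\<dots> \<le> pexp S (\<lambda>x. c * (G x * indicator {B<..} x))"
    by (intro integral_mono integrable_norm Bochner_Integration.integrable_diff int_lam int_g
        integrable_mult_right G_tail_integrable)
      (use lam_le in \<open>auto simp: g_def split: split_indicator\<close>)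
  also have "\<dots> \<le> \<epsilon> / 4" using mult_left_mono[OF B(2) c_nonneg] ce' by simp
  finally have S_near: "norm (\<kappa> - pexp S g) \<le> \<epsilon> / 4" .
  define A where "A = 2 * b * (C + pexp S G)"
  have "(\<lambda>m. A * \<alpha> ^ m) \<longlonglongrightarrow> A * 0"
    using \<alpha>_pos \<alpha>_less_1 by (intro tendsto_intros LIMSEQ_power_zero) auto
  then have "eventually (\<lambda>m. A * \<alpha> ^ m < \<epsilon> / 8) sequentially"
    using e by (intro order_tendstoD) auto
  then obtain m where m: "A * \<alpha> ^ m < \<epsilon> / 8" by (auto simp: eventually_sequentially)
  have "(\<lambda>N. 2 * m * (b * (c * C * (1 / sqrt (real N))))) \<longlonglongrightarrow> 2 * m * (b * (c * C * 0))"
    by (intro tendsto_intros) real_asymp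
  then have ev1: "eventually (\<lambda>N. 2 * m * (b * (c * C * (1 / sqrt (real N)))) < \<epsilon> / 8) sequentially"
    using e by (intro order_tendstoD) auto
  have "eventually (\<lambda>N. norm (lamN N x - lam x) < \<epsilon> / 4) sequentially" for x
  proof -
    have "(\<lambda>N. lamN N x) \<longlonglongrightarrow> lam x" using lim[of x] by (simp add: lamN_def)
    then show ?thesis
      using e tendstoD[of "\<lambda>N. lamN N x" "lam x" sequentially "\<epsilon> / 4"] by (simp add: dist_norm)
  qed
  \<comment> \<open>Only finitely many states lie below the cut-off, so pointwise convergence is
    uniform there.\<close>
  then have ev2: "eventually (\<lambda>N. \<forall>x\<in>{..B}. norm (lamN N x - lam x) < \<epsilon> / 4) sequentially"
    by (intro eventually_ball_finite) auto
  have "eventually (\<lambda>N. \<forall>j. norm (w N (j + m) (lamN N) - \<kappa> * w N (j + m) (\<lambda>_. 1)) \<le> \<epsilon>) sequentially"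
    using ev1 ev2 eventually_gt_at_top[of 0]
  proof eventually_elim
    case (elim N)
    show ?case
    proof
      fix j
      define k where "k = j + m"
      have e2: "norm (lamN N x - lam x) \<le> \<epsilon> / 4" if "x \<le> B" for x
        using elim that by (auto intro: less_imp_le)
      have "norm (w N k (lamN N) - w N k g)
         \<le> pexp (Kn k (hd l)) (\<lambda>x. c * (G x * indicator {B<..} x) + \<epsilon> / 4)"
      proof (rule w_diff_le[OF lamN_bounded g])
        show "integrable (measure_pmf (Kn k (hd l))) (\<lambda>x. c * (G x * indicator {B<..} x) + \<epsilon> / 4)"
          by (intro Bochner_Integration.integrable_add integrable_mult_right Kn_G_tail_integrable) auto
        fix x
        show "norm (lamN N x - g x) \<le> c * (G x * indicator {B<..} x) + \<epsilon> / 4"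
        proof (cases "x \<le> B")
          case True then show ?thesis using e2[of x] by (simp add: g_def)
        next
          case False then show ?thesis using dom[folded lamN_def, of N x] e by (simp add: g_def)
        qed
      qed
      also have "\<dots> = c * pexp (Kn k (hd l)) (\<lambda>x. G x * indicator {B<..} x) + \<epsilon> / 4"
      proof -
        have "integrable (measure_pmf (Kn k (hd l))) (\<lambda>x. c * (G x * indicator {B<..} x))"
          by (intro integrable_mult_right Kn_G_tail_integrable)
        then show ?thesis by simp
      qed
      also have "\<dots> \<le> \<epsilon> / 4 + \<epsilon> / 4" by (intro add_mono order_trans[OF mult_left_mono[OF B(1) c_nonneg] ce']) auto
      finally have 1: "norm (w N k (lamN N) - w N k g) \<le> \<epsilon> / 4 + \<epsilon> / 4" .
      have 2: "norm (w N k g - pexp S g * w N k (\<lambda>_. 1)) \<le> \<epsilon> / 8 + \<epsilon> / 8"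
        unfolding k_def
      proof -
        have "2 * real m * (b * (c * C / sqrt (real N))) \<le> \<epsilon> / 8" using elim by simp
        moreover have "2 * b * \<alpha> ^ m * (C + pexp S G) \<le> \<epsilon> / 8"
          using m by (simp add: A_def algebra_simps)
        ultimately show "norm (w N (j + m) g - pexp S g * w N (j + m) (\<lambda>_. 1)) \<le> \<epsilon> / 8 + \<epsilon> / 8"
          using w_mix[of g b N j m, OF g] elim(3) unfolding of_nat_mult of_nat_numeral by linarith
      qed
      have "norm (w N k (\<lambda>_. 1)) \<le> 1" by (rule w_le) simp
      then have "norm (pexp S g - \<kappa>) * norm (w N k (\<lambda>_. 1)) \<le> \<epsilon> / 4 * 1"
        using S_near by (intro mult_mono) (auto simp: norm_minus_commute e less_imp_le)
      then have 3: "norm (pexp S g * w N k (\<lambda>_. 1) - \<kappa> * w N k (\<lambda>_. 1)) \<le> \<epsilon> / 4"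
        by (simp add: left_diff_distrib flip: norm_mult)
      have "w N k (lamN N) - \<kappa> * w N k (\<lambda>_. 1) = (w N k (lamN N) - w N k g)
         + ((w N k g - pexp S g * w N k (\<lambda>_. 1))
         + (pexp S g * w N k (\<lambda>_. 1) - \<kappa> * w N k (\<lambda>_. 1)))" by simp
      also have "norm \<dots> \<le> (\<epsilon> / 4 + \<epsilon> / 4) + ((\<epsilon> / 8 + \<epsilon> / 8) + \<epsilon> / 4)"
        by (intro norm_triangle_le add_mono 1 2 3)
      finally show "norm (w N (j + m) (lamN N) - \<kappa> * w N (j + m) (\<lambda>_. 1)) \<le> \<epsilon>"
        by (simp add: k_def)
    qed
  qed
  then show ?thesis unfolding \<kappa>_def eventually_sequentially by blast
qed

end

text \<open>Discounting the characteristic function at time k by exp(k \<kappa> / N) yields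
  \<open>u\<close>, and its increments sum to something negligible by \<open>w_drift\<close>. The
  path grows by n steps while the scaling is N = n + s, because the initial segment counts towards
  the sample size.\<close>

lemma char_additive_functional:
  "(\<lambda>n. pexp (ext n l) (\<lambda>h. cis (acc (d (n + s)) h)))
     \<longlonglongrightarrow> exp (pexp S lam)"
proof -
  define \<kappa> where "\<kappa> = pexp S lam"
  obtain C where C1: "C \<ge> 1" and C: "\<And>k. pexp (Kn k (hd l)) G \<le> C"
    using Kn_G_bounded by blast
  define \<psi> where "\<psi> N k = w N k (\<lambda>_. 1)" for N k
  define u where "u N k = \<psi> N k * exp (- (of_nat k * (\<kappa> / of_nat N)))" for N k
  define r where "r N = real N * norm (exp (\<kappa> / of_nat N) - 1 - \<kappa> / of_nat N)" for N
  have r: "r \<longlonglongrightarrow> 0" unfolding r_def by (rule exp_remainder_tendsto)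
  have \<psi>1: "norm (\<psi> N k) \<le> 1" for N k unfolding \<psi>_def by (rule w_le) simp
  have step: "norm (u N (Suc k) - u N k)
      \<le> exp (norm \<kappa>) * (norm (w N k (lamN N) - \<kappa> * \<psi> N k) + r N) / N" if k: "k < N" for N k
  proof -
    have N: "N > 0" using k by simp
    let ?z = "\<kappa> / of_nat N"
    have "\<psi> N (Suc k) - exp ?z * \<psi> N k
       = (w N k (lamN N) - \<kappa> * \<psi> N k) / of_nat N - (exp ?z - 1 - ?z) * \<psi> N k"
      using w_increment[of N k] N unfolding \<psi>_def by (simp add: field_simps)
    also have "norm \<dots> \<le> norm (w N k (lamN N) - \<kappa> * \<psi> N k) / N + r N / N * 1"
      using N \<psi>1[of N k]
      by (intro order_trans[OF norm_triangle_ineq4] add_mono)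
        (auto simp: norm_divide norm_mult r_def intro!: mult_left_le)
    finally have 1: "norm (\<psi> N (Suc k) - exp ?z * \<psi> N k) \<le> (norm (w N k (lamN N) - \<kappa> * \<psi> N k) + r N) / N"
      by (simp add: add_divide_distrib)
    have eq: "u N (Suc k) - u N k = exp (- (of_nat (Suc k) * ?z)) * (\<psi> N (Suc k) - exp ?z * \<psi> N k)"
    proof -
      have "exp (- (of_nat (Suc k) * z)) * exp z = exp (- (of_nat k * z))" for z :: complex
        by (simp add: exp_add[symmetric] distrib_right)
      from this[of ?z] have "u N (Suc k) - u N k = \<psi> N (Suc k) * exp (- (of_nat (Suc k) * ?z))
          - \<psi> N k * (exp (- (of_nat (Suc k) * ?z)) * exp ?z)"
        by (simp only: u_def)
      moreover have "p * a - q * (a * b) = a * (p - b * q)" for a b p q :: complex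
        by (simp add: algebra_simps)
      ultimately show ?thesis by (simp only:)
    qed
    have le: "norm (exp (- (of_nat (Suc k) * ?z))) \<le> exp (norm \<kappa>)"
    proof -
      have "norm (- (of_nat (Suc k) * ?z)) \<le> norm \<kappa>"
      proof -
        have "norm (- (of_nat (Suc k) * ?z)) = real (Suc k) / real N * norm \<kappa>"
          by (simp add: norm_mult norm_divide del: of_nat_Suc)
        also have "\<dots> \<le> 1 * norm \<kappa>" using k by (intro mult_right_mono) auto
        finally show ?thesis by simp
      qed
      then show ?thesis using norm_exp[of "- (of_nat (Suc k) * ?z)"] by (meson exp_le_cancel_iff order_trans)
    qed
    have "norm (u N (Suc k) - u N k) \<le> exp (norm \<kappa>) * ((norm (w N k (lamN N) - \<kappa> * \<psi> N k) + r N) / N)"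
      unfolding eq norm_mult by (intro mult_mono le 1) auto
    then show ?thesis by simp
  qed
  have u_lim: "(\<lambda>n. u (n + s) n - u (n + s) 0) \<longlonglongrightarrow> 0"
  proof (rule LIMSEQ_I)
    fix e :: real assume e: "e > 0"
    define \<epsilon> where "\<epsilon> = e / (4 * exp (norm \<kappa>))"
    have \<epsilon>: "\<epsilon> > 0" using e by (simp add: \<epsilon>_def)
    obtain m N0 where mN: "\<And>N j. N \<ge> N0 \<Longrightarrow> norm (w N (j + m) (lamN N) - \<kappa> * \<psi> N (j + m)) \<le> \<epsilon>"
      unfolding \<psi>_def \<kappa>_def using w_drift[OF C \<epsilon>] by blast
    define D where "D = c * C + norm \<kappa>"
    have D: "norm (w N k (lamN N) - \<kappa> * \<psi> N k) \<le> D" for N k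
      unfolding D_def using \<psi>1[of N k] w_lamN_le[OF C, of N k]
      by (intro order_trans[OF norm_triangle_ineq4] add_mono) (auto simp: norm_mult intro: mult_left_le)
    have D0: "D \<ge> 0" using norm_ge_zero[of \<kappa>] c_nonneg C1 by (auto simp: D_def)
    have "(\<lambda>N. m * D * (1 / real N) + r N) \<longlonglongrightarrow> m * D * 0 + 0"
      by (intro tendsto_intros r)
    then have "eventually (\<lambda>N. m * D * (1 / real N) + r N < \<epsilon>) sequentially"
      using \<epsilon> by (intro order_tendstoD) auto
    then obtain N1 where N1: "\<And>N. N \<ge> N1 \<Longrightarrow> m * D * (1 / real N) + r N < \<epsilon>"
      by (auto simp: eventually_sequentially)
    show "\<exists>no. \<forall>n\<ge>no. norm (u (n + s) n - u (n + s) 0 - 0) < e"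
    proof (intro exI allI impI)
      fix n assume n: "n \<ge> max 1 (max N0 N1)"
      define N where "N = n + s"
      have N: "N \<ge> N0" "N \<ge> N1" "N > 0" "n \<le> N" using n by (auto simp: N_def)
      have "norm (u N n - u N 0) = norm (\<Sum>k<n. u N (Suc k) - u N k)"
        by (simp add: sum_lessThan_telescope[of "u N"])
      also have "\<dots> \<le> (\<Sum>k<n. exp (norm \<kappa>) * (norm (w N k (lamN N) - \<kappa> * \<psi> N k) + r N) / N)"
        using N(4) by (intro sum_norm_le step) auto
      \<comment> \<open>Times before m leave no room to step back m steps. They are bounded crudely
        by D, and their total m D / N vanishes.\<close>
      also have "\<dots> \<le> (\<Sum>k<n. exp (norm \<kappa>) * ((if k < m then D else 0) + \<epsilon> + r N) / N)"
      proof (intro sum_mono divide_right_mono mult_left_mono add_mono)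
        fix k
        show "norm (w N k (lamN N) - \<kappa> * \<psi> N k) \<le> (if k < m then D else 0) + \<epsilon>"
          using D[of N k] \<epsilon> mN[OF N(1), of "k - m"] by auto
      qed auto
      also have "\<dots> \<le> exp (norm \<kappa>) / N * ((\<Sum>k<n. if k < m then D else 0) + n * (\<epsilon> + r N))"
        by (simp add: sum_divide_distrib[symmetric] sum_distrib_left[symmetric] sum.distrib algebra_simps add_divide_distrib)
      also have "\<dots> \<le> exp (norm \<kappa>) / N * (m * D + N * (\<epsilon> + r N))"
      proof (intro mult_left_mono add_mono mult_right_mono)
        have "(\<Sum>k<n. if k < m then D else 0) = (\<Sum>k\<in>{..<n} \<inter> {k. k < m}. D)"
          by (subst sum.inter_restrict) auto
        also have "\<dots> = card ({..<n} \<inter> {k. k < m}) * D" by simp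
        also have "\<dots> \<le> m * D"
          using D0 card_mono[of "{..<m}" "{..<n} \<inter> {k. k < m}"] by (intro mult_right_mono) auto
        finally show "(\<Sum>k<n. if k < m then D else 0) \<le> m * D" .
      qed (use N \<epsilon> in \<open>auto simp: r_def\<close>)
      also have "\<dots> = exp (norm \<kappa>) * (\<epsilon> + (m * D * (1 / real N) + r N))"
        using N by (simp add: field_simps)
      also have "\<dots> < exp (norm \<kappa>) * (\<epsilon> + \<epsilon>)" using N1[OF N(2)] by simp
      also have "\<dots> \<le> e" using e by (simp add: \<epsilon>_def)
      finally show "norm (u (n + s) n - u (n + s) 0 - 0) < e" by (simp add: N_def)
    qed
  qed
  have fs: "filterlim (\<lambda>n. n + s) sequentially sequentially"
    by (rule filterlim_add_const_nat_at_top)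
  have "(\<lambda>N. cis (acc (d N) l)) \<longlonglongrightarrow> cis 0"
    unfolding cis_conv_exp by (intro tendsto_intros start)
  then have "(\<lambda>n. cis (acc (d (n + s)) l)) \<longlonglongrightarrow> 1"
    using filterlim_compose[OF _ fs, of "\<lambda>N. cis (acc (d N) l)"] by simp
  then have "(\<lambda>n. u (n + s) 0) \<longlonglongrightarrow> 1"
    by (simp add: u_def \<psi>_def w_def)
  from tendsto_add[OF u_lim this] have "(\<lambda>n. u (n + s) n) \<longlonglongrightarrow> 1" by simp
  \<comment> \<open>The discount accumulated over n steps has exponent n \<kappa> / (n + s), which
    tends to \<kappa>.\<close>
  moreover have "(\<lambda>n. exp (of_real (real n / real (n + s)) * \<kappa>)) \<longlonglongrightarrow> exp (of_real 1 * \<kappa>)"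
    by (intro tendsto_intros) real_asymp
  ultimately have "(\<lambda>n. u (n + s) n * exp (of_real (real n / real (n + s)) * \<kappa>)) \<longlonglongrightarrow> 1 * exp (of_real 1 * \<kappa>)"
    by (rule tendsto_mult)
  moreover have "u N n * exp (of_real (real n / real N) * \<kappa>) = \<psi> N n" for N n
    by (simp add: u_def exp_minus field_simps)
  ultimately have "(\<lambda>n. \<psi> (n + s) n) \<longlonglongrightarrow> exp \<kappa>"
    by (simp only: mult_1 of_real_1)
  then show ?thesis by (simp add: \<psi>_def w_def \<kappa>_def)
qed

end
end

section \<open>Central limit theorem and law of large numbers\<close>

lemma norm_cis_diff_le: "norm (cis u - 1) \<le> \<bar>u\<bar>"
  using iexp_approx1[of u 0] by (simp add: cis_conv_exp)

context inar
begin

definition mart :: "nat \<Rightarrow> nat \<Rightarrow> real" where "mart x y = real x * (real y - \<alpha> * real x - \<mu>)"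

definition cond_var :: "nat \<Rightarrow> real" where "cond_var x = (real x)\<^sup>2 * (\<alpha> * (1 - \<alpha>) * real x + \<sigma>2)"

lemma \<mu>_nonneg: "0 \<le> \<mu>" unfolding \<mu>_def by (rule integral_nonneg_AE) simp

lemma \<sigma>2_nonneg: "0 \<le> \<sigma>2"
  using measure_pmf.variance_eq[OF integrable_pe] measure_pmf.variance_positive[of pe real]
  by (simp add: \<sigma>2_def \<mu>_def)

lemma power_le_cube: "k \<le> 3 \<Longrightarrow> 1 \<le> k \<Longrightarrow> real x ^ k \<le> real x ^ 3"
  by (cases "x = 0") (auto simp: power_0_left intro!: power_increasing)

lemma S_second_moment: "integrable (measure_pmf S) (\<lambda>x. real x ^ 2)"
  by (rule Bochner_Integration.integrable_bound[OF S_third_moment])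
    (use power_le_cube[of 2] in auto)

lemma cond_var_le: "cond_var x \<le> (\<alpha> * (1 - \<alpha>) + \<sigma>2) * G x"
proof -
  have "cond_var x = \<alpha> * (1 - \<alpha>) * real x ^ 3 + \<sigma>2 * real x ^ 2"
    by (simp add: cond_var_def power2_eq_square power3_eq_cube algebra_simps)
  also have "\<dots> \<le> \<alpha> * (1 - \<alpha>) * real x ^ 3 + \<sigma>2 * real x ^ 3"
    using \<sigma>2_nonneg by (intro add_left_mono mult_left_mono power_le_cube) auto
  also have "\<dots> = (\<alpha> * (1 - \<alpha>) + \<sigma>2) * real x ^ 3" by (simp add: algebra_simps)
  also have "\<dots> \<le> (\<alpha> * (1 - \<alpha>) + \<sigma>2) * G x"
    using \<sigma>2_nonneg by (intro mult_left_mono) (auto simp: G_def)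
  finally show ?thesis .
qed

lemma cond_var_nonneg: "0 \<le> cond_var x"
  using \<sigma>2_nonneg by (simp add: cond_var_def)

lemma mart_integrable: "integrable (measure_pmf (K x)) (mart x)"
  and mart_sq_integrable: "integrable (measure_pmf (K x)) (\<lambda>y. (mart x y)\<^sup>2)"
  and mart_mean: "pexp (K x) (mart x) = 0"
  and mart_var: "pexp (K x) (\<lambda>y. (mart x y)\<^sup>2) = cond_var x"
proof -
  let ?m = "\<alpha> * real x + \<mu>"
  have one: "has_bochner_integral (measure_pmf (K x)) (\<lambda>_. a) a" for a :: real
    by (simp add: has_bochner_integral_iff)
  have 1: "has_bochner_integral (measure_pmf (K x)) (mart x) (real x * (?m - ?m))"
    using has_bochner_integral_mult_right[OF has_bochner_integral_diff[OF K_moment1[of x] one[of ?m]], of "real x"]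
    by (rule has_bochner_integral_cong[THEN iffD1, rotated -1]) (auto simp: mart_def algebra_simps)
  have 2: "has_bochner_integral (measure_pmf (K x)) (\<lambda>y. (mart x y)\<^sup>2)
     ((real x)\<^sup>2 * ((?m\<^sup>2 + \<alpha> * (1 - \<alpha>) * x + \<sigma>2) - 2 * ?m * ?m + ?m\<^sup>2))"
    using has_bochner_integral_mult_right[OF has_bochner_integral_add[OF
      has_bochner_integral_diff[OF K_moment2[of x] has_bochner_integral_mult_right[OF K_moment1[of x], of "2 * ?m"]] one[of "?m\<^sup>2"]], of "(real x)\<^sup>2"]
    by (rule has_bochner_integral_cong[THEN iffD1, rotated -1])
      (auto simp: mart_def power2_eq_square algebra_simps)
  show "integrable (measure_pmf (K x)) (mart x)" "integrable (measure_pmf (K x)) (\<lambda>y. (mart x y)\<^sup>2)"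
    "pexp (K x) (mart x) = 0"
    using 1 2 by (auto simp: has_bochner_integral_iff)
  have "pexp (K x) (\<lambda>y. (mart x y)\<^sup>2)
     = (real x)\<^sup>2 * ((?m\<^sup>2 + \<alpha> * (1 - \<alpha>) * x + \<sigma>2) - 2 * ?m * ?m + ?m\<^sup>2)"
    using 2 by (auto simp: has_bochner_integral_iff)
  then show "pexp (K x) (\<lambda>y. (mart x y)\<^sup>2) = cond_var x"
    by (simp add: cond_var_def power2_eq_square algebra_simps)
qed

text \<open>The minimum in the remainder matters: the cubic branch vanishes as \<open>u\<close>
  tends to 0, while the quadratic one is bounded through \<open>cond_var\<close>. A cubic bound
  alone would bring in powers of the state beyond the third.\<close>

lemma mart_char_bound:
  "norm (pexp (K x) (\<lambda>y. cis (u * mart x y)) - complex_of_real (1 - u\<^sup>2 * cond_var x / 2))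
     \<le> u\<^sup>2 / 6 * pexp (K x) (\<lambda>y. min (6 * (mart x y)\<^sup>2) (\<bar>u\<bar> * \<bar>mart x y\<bar> ^ 3))"
proof -
  have "char (distr (measure_pmf (K x)) borel (mart x)) u = pexp (K x) (\<lambda>y. cis (u * mart x y))"
    unfolding char_def by (subst integral_distr) (auto simp: cis_conv_exp)
  moreover have "measure_pmf.variance (K x) (mart x) = cond_var x"
    by (simp add: mart_mean mart_var)
  ultimately show ?thesis
    using prob_space.char_approx3'[OF prob_space_measure_pmf, where X="mart x" and t=u, OF _ mart_integrable mart_sq_integrable mart_mean _ refl, of "cond_var x"] by simp
qed

text \<open>Meant for the domination hypothesis. In the factor 3/2, the 1 comes from the quadratic
  branch of the remainder and the 1/2 from the second order term.\<close>

lemma mart_char_bound_2: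
  "norm (pexp (K x) (\<lambda>y. cis (u * mart x y)) - 1) \<le> 3 / 2 * u\<^sup>2 * cond_var x"
proof -
  have "pexp (K x) (\<lambda>y. min (6 * (mart x y)\<^sup>2) (\<bar>u\<bar> * \<bar>mart x y\<bar> ^ 3))
     \<le> pexp (K x) (\<lambda>y. 6 * (mart x y)\<^sup>2)"
    by (intro integral_mono integrable_mult_right mart_sq_integrable
        Bochner_Integration.integrable_bound[OF integrable_mult_right[OF mart_sq_integrable[of x], of 6]]) auto
  also have "\<dots> = 6 * cond_var x" by (simp add: mart_var)
  finally have "u\<^sup>2 / 6 * pexp (K x) (\<lambda>y. min (6 * (mart x y)\<^sup>2) (\<bar>u\<bar> * \<bar>mart x y\<bar> ^ 3))
     \<le> u\<^sup>2 / 6 * (6 * cond_var x)" by (intro mult_left_mono) auto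
  then have 1: "norm (pexp (K x) (\<lambda>y. cis (u * mart x y)) - complex_of_real (1 - u\<^sup>2 * cond_var x / 2)) \<le> u\<^sup>2 * cond_var x"
    using mart_char_bound[of x u] by simp
  have "pexp (K x) (\<lambda>y. cis (u * mart x y)) - 1
     = (pexp (K x) (\<lambda>y. cis (u * mart x y)) - complex_of_real (1 - u\<^sup>2 * cond_var x / 2)) - complex_of_real (u\<^sup>2 * cond_var x / 2)"
    by simp
  also have "norm \<dots> \<le> u\<^sup>2 * cond_var x + u\<^sup>2 * cond_var x / 2"
  proof (rule order_trans[OF norm_triangle_ineq4 add_mono[OF 1]])
    show "norm (complex_of_real (u\<^sup>2 * cond_var x / 2)) \<le> u\<^sup>2 * cond_var x / 2"
      unfolding norm_of_real using cond_var_nonneg[of x] by simp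
  qed
  finally show ?thesis by (simp add: mult_ac)
qed

abbreviation m where "m k \<equiv> stat_moment \<alpha> pe k"

theorem martingale_clt:
  assumes l: "l \<noteq> []"
  shows "(\<lambda>n. pexp (ext n l) (\<lambda>h. cis (t * (acc mart h / sqrt (real (n + s))))))
     \<longlonglongrightarrow> exp (complex_of_real (- (t\<^sup>2 / 2 * (\<alpha> * (1 - \<alpha>) * m 3 + \<sigma>2 * m 2))))"
proof -
  define d where "d N x y = t / sqrt (real N) * mart x y" for N x y
  define lam where "lam x = complex_of_real (- (t\<^sup>2 * cond_var x / 2))" for x
  \<comment> \<open>The first summand serves the domination of N times the one-step change, the
    second the O(1/sqrt N) bound on a single factor.\<close>
  define c where "c = 3 / 2 * t\<^sup>2 * (\<alpha> * (1 - \<alpha>) + \<sigma>2) + 2 * \<bar>t\<bar> * (\<alpha> + \<mu>)"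
  have usq: "real N * (t / sqrt (real N))\<^sup>2 = (if N = 0 then 0 else t\<^sup>2)" for N
    by (simp add: power_divide)
  have acc_d: "acc (d N) h = t / sqrt (real N) * acc mart h" for N h
    unfolding d_def by (rule acc_scale)
  have "(\<lambda>n. pexp (ext n l) (\<lambda>h. cis (acc (d (n + s)) h))) \<longlonglongrightarrow> exp (pexp S lam)"
  proof (rule char_additive_functional[OF l])
    fix x
    let ?r = "\<lambda>u. pexp (K x) (\<lambda>y. min (6 * (mart x y)\<^sup>2) (\<bar>u\<bar> * \<bar>mart x y\<bar> ^ 3))"
    \<comment> \<open>Dominated convergence: the quadratic branch is the majorant, the cubic branch
      gives the pointwise limit 0.\<close>
    have "(\<lambda>N. ?r (t / sqrt (real N))) \<longlonglongrightarrow> pexp (K x) (\<lambda>y. 0)"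
    proof (rule integral_dominated_convergence[where w="\<lambda>y. 6 * (mart x y)\<^sup>2"])
      show "integrable (measure_pmf (K x)) (\<lambda>y. 6 * (mart x y)\<^sup>2)"
        by (intro integrable_mult_right mart_sq_integrable)
      show "AE y in K x. (\<lambda>N. min (6 * (mart x y)\<^sup>2) (\<bar>t / sqrt (real N)\<bar> * \<bar>mart x y\<bar> ^ 3)) \<longlonglongrightarrow> 0"
      proof (rule AE_I2)
        fix y
        have "(\<lambda>N. \<bar>t * (1 / sqrt (real N))\<bar>) \<longlonglongrightarrow> \<bar>t * 0\<bar>"
          by (intro tendsto_intros) real_asymp
        then have "(\<lambda>N. \<bar>t / sqrt (real N)\<bar>) \<longlonglongrightarrow> 0" by simp
        then have "(\<lambda>N. min (6 * (mart x y)\<^sup>2) (\<bar>t / sqrt (real N)\<bar> * \<bar>mart x y\<bar> ^ 3)) \<longlonglongrightarrow> min (6 * (mart x y)\<^sup>2) (0 * \<bar>mart x y\<bar> ^ 3)"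
          by (intro tendsto_intros)
        then show "(\<lambda>N. min (6 * (mart x y)\<^sup>2) (\<bar>t / sqrt (real N)\<bar> * \<bar>mart x y\<bar> ^ 3)) \<longlonglongrightarrow> 0"
          by simp
      qed
    qed auto
    then have "(\<lambda>N. t\<^sup>2 / 6 * ?r (t / sqrt (real N))) \<longlonglongrightarrow> t\<^sup>2 / 6 * 0"
      by (intro tendsto_intros) simp
    then have r0: "(\<lambda>N. t\<^sup>2 / 6 * ?r (t / sqrt (real N))) \<longlonglongrightarrow> 0" by simp
    have "eventually (\<lambda>N. norm (of_nat N * (pexp (K x) (\<lambda>y. cis (d N x y)) - 1) - lam x)
        \<le> t\<^sup>2 / 6 * ?r (t / sqrt (real N))) sequentially"
      using eventually_gt_at_top[of 0]
    proof eventually_elim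
      case (elim N)
      let ?u = "t / sqrt (real N)"
      have Nu: "real N * ?u\<^sup>2 = t\<^sup>2" using usq[of N] elim by simp
      have "of_nat N * (pexp (K x) (\<lambda>y. cis (d N x y)) - 1) - lam x
        = of_nat N * (pexp (K x) (\<lambda>y. cis (?u * mart x y)) - 1) + complex_of_real (real N * ?u\<^sup>2 * cond_var x / 2)"
        unfolding Nu lam_def d_def by simp
      also have "\<dots> = of_nat N * (pexp (K x) (\<lambda>y. cis (?u * mart x y)) - complex_of_real (1 - ?u\<^sup>2 * cond_var x / 2))"
        by (simp add: algebra_simps)
      also have "norm \<dots> \<le> real N * (?u\<^sup>2 / 6 * ?r ?u)"
        unfolding norm_mult norm_of_nat by (intro mult_left_mono mart_char_bound) auto
      also have "\<dots> = (real N * ?u\<^sup>2) / 6 * ?r ?u" by simp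
      also have "\<dots> = t\<^sup>2 / 6 * ?r ?u" unfolding Nu ..
      finally show ?case .
    qed
    from Lim_null_comparison[OF this r0]
    show "(\<lambda>N. of_nat N * (pexp (K x) (\<lambda>y. cis (d N x y)) - 1)) \<longlonglongrightarrow> lam x"
      by (rule LIM_zero_cancel)
  next
    fix N x
    have "norm (of_nat N * (pexp (K x) (\<lambda>y. cis (d N x y)) - 1))
       \<le> real N * (3 / 2 * (t / sqrt (real N))\<^sup>2 * cond_var x)"
      unfolding norm_mult norm_of_nat d_def by (intro mult_left_mono mart_char_bound_2) auto
    also have "\<dots> = 3 / 2 * (real N * (t / sqrt (real N))\<^sup>2) * cond_var x" by simp
    also have "\<dots> \<le> 3 / 2 * t\<^sup>2 * cond_var x"
      unfolding usq using cond_var_nonneg by simp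
    also have "\<dots> \<le> 3 / 2 * t\<^sup>2 * ((\<alpha> * (1 - \<alpha>) + \<sigma>2) * G x)"
      by (intro mult_left_mono cond_var_le) auto
    also have "\<dots> \<le> c * G x"
    proof -
      have "3 / 2 * t\<^sup>2 * (\<alpha> * (1 - \<alpha>) + \<sigma>2) \<le> c" using \<mu>_nonneg by (simp add: c_def)
      from mult_right_mono[OF this G_nonneg[of x]] show ?thesis by (simp only: mult.assoc)
    qed
    finally show "norm (of_nat N * (pexp (K x) (\<lambda>y. cis (d N x y)) - 1)) \<le> c * G x" .
  next
    fix N :: nat and x assume N: "N > 0"
    let ?u = "t / sqrt (real N)"
    have hb: "has_bochner_integral (measure_pmf (K x)) (\<lambda>y. \<bar>?u\<bar> * (real x * (real y + (\<alpha> * real x + \<mu>))))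
       (\<bar>?u\<bar> * (real x * ((\<alpha> * real x + \<mu>) + (\<alpha> * real x + \<mu>))))"
      by (intro has_bochner_integral_mult_right has_bochner_integral_add K_moment1)
        (auto simp: has_bochner_integral_iff)
    have "pexp (K x) (\<lambda>y. norm (cis (d N x y) - 1))
       \<le> pexp (K x) (\<lambda>y. \<bar>?u\<bar> * (real x * (real y + (\<alpha> * real x + \<mu>))))"
    proof (rule integral_mono)
      show "integrable (measure_pmf (K x)) (\<lambda>y. norm (cis (d N x y) - 1))"
        by (rule integrable_pmf_bounded[where B=2])
          (use norm_triangle_ineq4[of "cis _" 1] in auto)
      show "integrable (measure_pmf (K x)) (\<lambda>y. \<bar>?u\<bar> * (real x * (real y + (\<alpha> * real x + \<mu>))))"
        using hb by (simp add: has_bochner_integral_iff)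
      fix y
      have "norm (cis (d N x y) - 1) \<le> \<bar>?u\<bar> * \<bar>mart x y\<bar>"
        using norm_cis_diff_le[of "d N x y"] by (simp only: d_def abs_mult)
      also have "\<dots> \<le> \<bar>?u\<bar> * (real x * (real y + (\<alpha> * real x + \<mu>)))"
      proof (rule mult_left_mono)
        have "\<bar>real y - \<alpha> * real x - \<mu>\<bar> \<le> real y + (\<alpha> * real x + \<mu>)"
          using \<mu>_nonneg mult_nonneg_nonneg[of \<alpha> "real x"] \<alpha>_pos by (simp add: abs_le_iff)
        from mult_left_mono[OF this, of "real x"]
        show "\<bar>mart x y\<bar> \<le> real x * (real y + (\<alpha> * real x + \<mu>))"
          by (simp add: mart_def abs_mult)
      qed simp
      finally show "norm (cis (d N x y) - 1) \<le> \<bar>?u\<bar> * (real x * (real y + (\<alpha> * real x + \<mu>)))" .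
    qed
    also have "\<dots> = \<bar>?u\<bar> * (real x * ((\<alpha> * real x + \<mu>) + (\<alpha> * real x + \<mu>)))"
      using hb by (simp add: has_bochner_integral_iff)
    also have "\<dots> = \<bar>?u\<bar> * (2 * (\<alpha> * real x ^ 2 + \<mu> * real x ^ 1))"
      by (simp add: power2_eq_square algebra_simps)
    also have "\<dots> \<le> \<bar>?u\<bar> * (2 * (\<alpha> * real x ^ 3 + \<mu> * real x ^ 3))"
      using \<mu>_nonneg by (intro mult_left_mono add_mono power_le_cube) auto
    also have "\<dots> \<le> \<bar>?u\<bar> * (2 * ((\<alpha> + \<mu>) * G x))"
      using \<mu>_nonneg \<alpha>_pos by (intro mult_left_mono) (auto simp: G_def algebra_simps)
    also have "\<dots> = (2 * \<bar>t\<bar> * (\<alpha> + \<mu>)) * G x / sqrt N" by (simp add: abs_mult)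
    also have "\<dots> \<le> c * G x / sqrt N"
      using \<sigma>2_nonneg by (intro divide_right_mono mult_right_mono) (auto simp: c_def)
    finally show "pexp (K x) (\<lambda>y. norm (cis (d N x y) - 1)) \<le> c * G x / sqrt N" .
  next
    have "(\<lambda>N. t * (1 / sqrt (real N)) * acc mart l) \<longlonglongrightarrow> t * 0 * acc mart l"
      by (intro tendsto_intros) real_asymp
    then show "(\<lambda>N. acc (d N) l) \<longlonglongrightarrow> 0" by (simp add: acc_d)
  qed
  moreover have "pexp S lam = complex_of_real (- (t\<^sup>2 / 2 * (\<alpha> * (1 - \<alpha>) * m 3 + \<sigma>2 * m 2)))"
  proof -
    have "pexp S (\<lambda>x. - (t\<^sup>2 * cond_var x / 2)) = - (t\<^sup>2 / 2 * pexp S cond_var)"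
      by simp
    also have "pexp S cond_var = pexp S (\<lambda>x. \<alpha> * (1 - \<alpha>) * real x ^ 3 + \<sigma>2 * real x ^ 2)"
      by (rule arg_cong[where f="pexp S"])
        (auto simp: cond_var_def power2_eq_square power3_eq_cube algebra_simps)
    also have "\<dots> = \<alpha> * (1 - \<alpha>) * m 3 + \<sigma>2 * m 2"
      unfolding stat_moment_def using S_third_moment S_second_moment by simp
    finally show ?thesis unfolding lam_def by (subst integral_complex_of_real) (simp only:)
  qed
  ultimately show ?thesis by (simp add: acc_d)
qed

text \<open>The square belongs to the state that is left, as the least squares design at time k is
  the value at time k - 1.\<close>

definition sq :: "nat \<Rightarrow> nat \<Rightarrow> real" where "sq x y = (real x)\<^sup>2"

text \<open>The limit is the characteristic function of the constant \<open>m 2\<close>. The same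
  estimate as for the central limit theorem applies, with scaling 1/N; given the state the increment
  is deterministic, so its one-step factor is exactly exp(lam / N).\<close>

theorem square_lln:
  assumes l: "l \<noteq> []"
  shows "(\<lambda>n. pexp (ext n l) (\<lambda>h. cis (t * (acc sq h / real (n + s)))))
     \<longlonglongrightarrow> exp (\<i> * complex_of_real (t * m 2))"
proof -
  define d where "d N x y = t / real N * sq x y" for N x y
  define lam where "lam x = \<i> * complex_of_real (t * (real x)\<^sup>2)" for x :: nat
  have acc_d: "acc (d N) h = t / real N * acc sq h" for N h
    unfolding d_def by (rule acc_scale)
  have sqG: "(real x)\<^sup>2 \<le> G x" for x
    using power_le_cube[of 2 x] by (simp add: G_def)
  have "(\<lambda>n. pexp (ext n l) (\<lambda>h. cis (acc (d (n + s)) h))) \<longlonglongrightarrow> exp (pexp S lam)"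
  proof (rule char_additive_functional[OF l, where c="\<bar>t\<bar>"])
    fix x
    have "(\<lambda>N. of_nat N * (pexp (K x) (\<lambda>y. cis (d N x y)) - 1) - lam x) \<longlonglongrightarrow> 0"
    proof (rule Lim_null_comparison[OF _ exp_remainder_tendsto[of "lam x"]])
      show "eventually (\<lambda>N. norm (of_nat N * (pexp (K x) (\<lambda>y. cis (d N x y)) - 1) - lam x)
         \<le> real N * norm (exp (lam x / of_nat N) - 1 - lam x / of_nat N)) sequentially"
        using eventually_gt_at_top[of 0]
      proof eventually_elim
        case (elim N)
        have "cis (d N x y) = exp (lam x / of_nat N)" for y
          by (simp add: cis_conv_exp d_def lam_def sq_def)
        then have "of_nat N * (pexp (K x) (\<lambda>y. cis (d N x y)) - 1) - lam x
          = of_nat N * (exp (lam x / of_nat N) - 1 - lam x / of_nat N)"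
          using elim by (simp add: right_diff_distrib)
        then show ?case by (simp add: norm_mult)
      qed
    qed
    then show "(\<lambda>N. of_nat N * (pexp (K x) (\<lambda>y. cis (d N x y)) - 1)) \<longlonglongrightarrow> lam x"
      by (rule LIM_zero_cancel)
  next
    fix N x
    have "norm (of_nat N * (pexp (K x) (\<lambda>y. cis (d N x y)) - 1)) \<le> real N * \<bar>t / real N * (real x)\<^sup>2\<bar>"
    proof -
      have "norm (of_nat N * (pexp (K x) (\<lambda>y. cis (d N x y)) - 1)) = real N * norm (cis (t / real N * (real x)\<^sup>2) - 1)"
        by (simp add: norm_mult d_def sq_def)
      also have "\<dots> \<le> real N * \<bar>t / real N * (real x)\<^sup>2\<bar>"
        by (intro mult_left_mono norm_cis_diff_le) simp
      finally show ?thesis .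
    qed
    also have "\<dots> \<le> \<bar>t\<bar> * (real x)\<^sup>2" by (simp add: abs_mult)
    also have "\<dots> \<le> \<bar>t\<bar> * G x" by (intro mult_left_mono sqG) auto
    finally show "norm (of_nat N * (pexp (K x) (\<lambda>y. cis (d N x y)) - 1)) \<le> \<bar>t\<bar> * G x" .
  next
    fix N :: nat and x assume N: "N > 0"
    have "pexp (K x) (\<lambda>y. norm (cis (d N x y) - 1)) \<le> \<bar>t / real N * (real x)\<^sup>2\<bar>"
      using norm_cis_diff_le[of "t / real N * (real x)\<^sup>2"] by (simp add: d_def sq_def)
    also have "\<dots> = \<bar>t\<bar> * (real x)\<^sup>2 / real N" by (simp add: abs_mult)
    also have "\<dots> \<le> \<bar>t\<bar> * G x / sqrt N"
    proof (intro frac_le mult_left_mono sqG)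
      have "1 \<le> real N" using N by simp
      then have "sqrt (real N) * 1 \<le> sqrt (real N) * sqrt (real N)" by (intro mult_left_mono) auto
      then show "sqrt (real N) \<le> real N" by simp
    qed (use N in auto)
    finally show "pexp (K x) (\<lambda>y. norm (cis (d N x y) - 1)) \<le> \<bar>t\<bar> * G x / sqrt N" .
  next
    have "(\<lambda>N. t * (1 / real N) * acc sq l) \<longlonglongrightarrow> t * 0 * acc sq l"
      by (intro tendsto_intros lim_1_over_n)
    then show "(\<lambda>N. acc (d N) l) \<longlonglongrightarrow> 0" by (simp add: acc_d)
  qed
  moreover have "pexp S lam = \<i> * complex_of_real (t * m 2)"
    unfolding lam_def stat_moment_def by (subst integral_mult_right_zero, subst integral_complex_of_real) simp
  ultimately show ?thesis by (simp add: acc_d)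
qed

lemma m2_pos: "0 < m 2"
proof -
  have "0 < measure_pmf.prob S {1..}"
    using S_tail_pos[of 1] by (simp add: measure_pmf.emeasure_eq_measure)
  also have "\<dots> = pexp S (indicator {1..})" by simp
  also have "\<dots> \<le> pexp S (\<lambda>x. real x ^ 2)"
    by (intro integral_mono S_second_moment integrable_pmf_bounded[where B=1]) (auto split: split_indicator)
  finally show ?thesis by (simp add: stat_moment_def)
qed

end

section \<open>Weak convergence\<close>

lemma weak_limit_from_char:
  fixes P :: "nat \<Rightarrow> 'b pmf" and Z :: "nat \<Rightarrow> 'b \<Rightarrow> real" and F :: "real \<Rightarrow> real"
  assumes \<nu>: "real_distribution \<nu>"
    and char: "\<And>t. (\<lambda>n. pexp (P n) (\<lambda>h. cis (t * Z n h))) \<longlonglongrightarrow> char \<nu> t"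
    and F: "continuous_on UNIV F" "\<And>x. norm (F x) \<le> B"
  shows "(\<lambda>n. pexp (P n) (\<lambda>h. F (Z n h))) \<longlonglongrightarrow> integral\<^sup>L \<nu> F"
proof -
  let ?M = "\<lambda>n. distr (measure_pmf (P n)) borel (Z n)"
  have rd: "real_distribution (?M n)" for n
    by (intro prob_space.real_distribution_distr prob_space_measure_pmf) simp
  have "weak_conv_m ?M \<nu>"
  proof (rule levy_continuity[OF rd \<nu>])
    fix t
    have "char (?M n) t = pexp (P n) (\<lambda>h. cis (t * Z n h))" for n
      unfolding char_def by (subst integral_distr) (auto simp: cis_conv_exp)
    then show "(\<lambda>n. char (?M n) t) \<longlonglongrightarrow> char \<nu> t" using char by simp
  qed
  then have "(\<lambda>n. integral\<^sup>L (?M n) F) \<longlonglongrightarrow> integral\<^sup>L \<nu> F"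
    using F rd \<nu> by (intro weak_conv_imp_integral_bdd_continuous_conv[where B=B])
      (auto simp: continuous_on_eq_continuous_at)
  then show ?thesis
    by (subst (asm) integral_distr) (auto intro: borel_measurable_continuous_onI F)
qed

lemma prob_tendsto_0_from_char:
  fixes P :: "nat \<Rightarrow> 'b pmf" and U :: "nat \<Rightarrow> 'b \<Rightarrow> real"
  assumes char: "\<And>t. (\<lambda>n. pexp (P n) (\<lambda>h. cis (t * U n h))) \<longlonglongrightarrow> exp (\<i> * complex_of_real (t * u))"
    and \<delta>: "\<delta> > 0"
  shows "(\<lambda>n. measure_pmf.prob (P n) {h. \<bar>U n h - u\<bar> > \<delta>}) \<longlonglongrightarrow> 0"
proof -
  have rd: "real_distribution (return borel u)"
    by (auto simp: real_distribution_def real_distribution_axioms_def prob_space_return)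
  \<comment> \<open>A bounded continuous function that vanishes at \<open>u\<close> and majorizes
    the indicator of a deviation beyond \<delta>.\<close>
  define F where "F x = min 1 (\<bar>x - u\<bar> / \<delta>)" for x
  have "(\<lambda>n. pexp (P n) (\<lambda>h. F (U n h))) \<longlonglongrightarrow> integral\<^sup>L (return borel u) F"
  proof (rule weak_limit_from_char[OF rd, where B=1])
    have "char (return borel u) t = exp (\<i> * complex_of_real (t * u))" for t
      unfolding char_def by (subst integral_return) auto
    then show "(\<lambda>n. pexp (P n) (\<lambda>h. cis (t * U n h))) \<longlonglongrightarrow> char (return borel u) t" for t
      using char by simp
    show "continuous_on UNIV F" unfolding F_def by (intro continuous_intros) (use \<delta> in auto)
  qed (use \<delta> in \<open>auto simp: F_def\<close>)
  moreover have "integral\<^sup>L (return borel u) F = 0"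
    by (subst integral_return) (auto simp: F_def[abs_def])
  moreover have "measure_pmf.prob (P n) {h. \<bar>U n h - u\<bar> > \<delta>} \<le> pexp (P n) (\<lambda>h. F (U n h))" for n
  proof -
    have "measure_pmf.prob (P n) {h. \<bar>U n h - u\<bar> > \<delta>} = pexp (P n) (indicator {h. \<bar>U n h - u\<bar> > \<delta>})" by simp
    also have "\<dots> \<le> pexp (P n) (\<lambda>h. F (U n h))"
      by (intro integral_mono integrable_pmf_bounded[where B=1])
        (use \<delta> in \<open>auto simp: F_def split: split_indicator\<close>)
    finally show ?thesis .
  qed
  ultimately show ?thesis
    by (intro tendsto_sandwich[of "\<lambda>_. 0" "\<lambda>n. measure_pmf.prob (P n) {h. \<bar>U n h - u\<bar> > \<delta>}" sequentially
      "\<lambda>n. pexp (P n) (\<lambda>h. F (U n h))" 0]) auto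
qed

text \<open>The link between \<open>W\<close>, \<open>Z\<close> and \<open>U\<close> is
  deterministic: it holds on each path with \<open>Z\<close> bounded and \<open>U\<close> near its
  limit. Probability enters only through tightness of \<open>Z\<close> and the concentration of
  \<open>U\<close>.\<close>

lemma slutsky:
  fixes P :: "nat \<Rightarrow> 'b pmf" and Z U :: "nat \<Rightarrow> 'b \<Rightarrow> real" and W :: "nat \<Rightarrow> 'b \<Rightarrow> 'c :: euclidean_space"
    and F :: "'c \<Rightarrow> real"
  assumes \<nu>: "real_distribution \<nu>"
    and char: "\<And>t. (\<lambda>n. pexp (P n) (\<lambda>h. cis (t * Z n h))) \<longlonglongrightarrow> char \<nu> t"
    and U: "\<And>\<delta>. \<delta> > 0 \<Longrightarrow> (\<lambda>n. measure_pmf.prob (P n) {h. \<bar>U n h - u\<bar> > \<delta>}) \<longlonglongrightarrow> 0"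
    and near: "\<And>R \<epsilon>. R > 0 \<Longrightarrow> \<epsilon> > 0 \<Longrightarrow> \<exists>\<delta>>0. \<exists>n0. \<forall>n\<ge>n0. \<forall>h\<in>set_pmf (P n).
        \<bar>Z n h\<bar> \<le> R \<longrightarrow> \<bar>U n h - u\<bar> \<le> \<delta> \<longrightarrow> norm (W n h - Z n h *\<^sub>R e) \<le> \<epsilon>"
    and F: "continuous_on UNIV F" "\<And>x. norm (F x) \<le> B"
  shows "(\<lambda>n. pexp (P n) (\<lambda>h. F (W n h))) \<longlonglongrightarrow> (\<integral>z. F (z *\<^sub>R e) \<partial>\<nu>)"
proof -
  interpret \<nu>: real_distribution \<nu> by (rule \<nu>)
  have B0: "B \<ge> 0" using F(2) norm_ge_zero order_trans by blast
  note wl = weak_limit_from_char[OF \<nu> char]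
  have main: "(\<lambda>n. pexp (P n) (\<lambda>h. F (Z n h *\<^sub>R e))) \<longlonglongrightarrow> (\<integral>z. F (z *\<^sub>R e) \<partial>\<nu>)"
    by (rule wl[where B=B]) (auto intro!: continuous_on_compose2[OF F(1)] continuous_intros F(2) simp: F(2)[simplified])
  have diff: "(\<lambda>n. pexp (P n) (\<lambda>h. F (W n h)) - pexp (P n) (\<lambda>h. F (Z n h *\<^sub>R e))) \<longlonglongrightarrow> 0"
  proof (rule LIMSEQ_I)
    fix r :: real assume r: "r > 0"
    \<comment> \<open>Chosen so that the total error \<eta> (1 + 4 B) is r / 2.\<close>
    define \<eta> where "\<eta> = r / (2 * (1 + 4 * B))"
    have \<eta>: "\<eta> > 0" using r B0 by (simp add: \<eta>_def)
    \<comment> \<open>A continuous stand-in for the indicator of large \<open>Z\<close>: 0 up to k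
      and 1 from k + 1 on, which is why R is k + 1 below.\<close>
    define \<phi> where "\<phi> k z = min 1 (max 0 (\<bar>z\<bar> - real k))" for k and z :: real
    have "(\<lambda>k. \<integral>z. \<phi> k z \<partial>\<nu>) \<longlonglongrightarrow> (\<integral>z. 0 \<partial>\<nu>)"
    proof (rule integral_dominated_convergence[where w="\<lambda>_. 1"])
      show "AE z in \<nu>. (\<lambda>k. \<phi> k z) \<longlonglongrightarrow> 0"
      proof (rule AE_I2)
        fix z
        have "eventually (\<lambda>k. \<phi> k z = 0) sequentially"
          using eventually_ge_at_top[of "nat \<lceil>\<bar>z\<bar>\<rceil>"] 
        proof eventually_elim
          case (elim k)
          then have "\<bar>z\<bar> \<le> real k" by linarith
          then show ?case by (simp add: \<phi>_def)
        qed
        then show "(\<lambda>k. \<phi> k z) \<longlonglongrightarrow> 0" by (rule tendsto_eventually)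
      qed
    qed (auto simp: \<phi>_def[abs_def])
    then have "(\<lambda>k. \<integral>z. \<phi> k z \<partial>\<nu>) \<longlonglongrightarrow> 0" by simp
    from order_tendstoD(2)[OF this \<eta>] obtain k where k: "(\<integral>z. \<phi> k z \<partial>\<nu>) < \<eta>"
      by (auto simp: eventually_sequentially)
    define R where "R = real k + 1"
    have R: "R > 0" by (simp add: R_def)
    have "(\<lambda>n. pexp (P n) (\<lambda>h. \<phi> k (Z n h))) \<longlonglongrightarrow> (\<integral>z. \<phi> k z \<partial>\<nu>)"
      by (rule wl[where B=1]) (auto simp: \<phi>_def[abs_def] intro!: continuous_intros)
    from order_tendstoD(2)[OF this k]
    have ev1: "eventually (\<lambda>n. pexp (P n) (\<lambda>h. \<phi> k (Z n h)) < \<eta>) sequentially" .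
    \<comment> \<open>The margin 1 keeps \<open>W\<close> in the ball as well, since it is within
      \<epsilon> \<le> 1 of the multiple of \<open>e\<close>.\<close>
    define C where "C = cball (0 :: 'c) (R * norm e + 1)"
    have "uniformly_continuous_on C F"
      unfolding C_def by (intro compact_uniformly_continuous continuous_on_subset[OF F(1)]) auto
    then obtain \<epsilon>0 where \<epsilon>0: "\<epsilon>0 > 0" "\<And>x y. x \<in> C \<Longrightarrow> y \<in> C \<Longrightarrow> dist y x < \<epsilon>0 \<Longrightarrow> dist (F y) (F x) < \<eta>"
      unfolding uniformly_continuous_on_def using \<eta> by meson
    define \<epsilon> where "\<epsilon> = min 1 (\<epsilon>0 / 2)"
    have \<epsilon>: "\<epsilon> > 0" using \<epsilon>0 by (simp add: \<epsilon>_def)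
    obtain \<delta> n0 where \<delta>: "\<delta> > 0" and n0: "\<And>n h. n \<ge> n0 \<Longrightarrow> h \<in> set_pmf (P n) \<Longrightarrow> \<bar>Z n h\<bar> \<le> R \<Longrightarrow>
       \<bar>U n h - u\<bar> \<le> \<delta> \<Longrightarrow> norm (W n h - Z n h *\<^sub>R e) \<le> \<epsilon>"
      using near[OF R \<epsilon>] by blast
    have ev2: "eventually (\<lambda>n. measure_pmf.prob (P n) {h. \<bar>U n h - u\<bar> > \<delta>} < \<eta>) sequentially"
      by (rule order_tendstoD(2)[OF U[OF \<delta>] \<eta>])
    have "eventually (\<lambda>n. norm (pexp (P n) (\<lambda>h. F (W n h)) - pexp (P n) (\<lambda>h. F (Z n h *\<^sub>R e)) - 0) < r) sequentially"
      using ev1 ev2 eventually_ge_at_top[of n0]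
    proof eventually_elim
      case (elim n)
      let ?b = "\<lambda>h. \<eta> + 2 * B * (\<phi> k (Z n h) + indicator {h. \<bar>U n h - u\<bar> > \<delta>} h)"
      have int\<phi>: "integrable (measure_pmf (P n)) (\<lambda>h. \<phi> k (Z n h))"
        by (rule integrable_pmf_bounded[where B=1]) (auto simp: \<phi>_def)
      have intI: "integrable (measure_pmf (P n)) (indicator {h. \<bar>U n h - u\<bar> > \<delta>} :: 'b \<Rightarrow> real)"
        by (rule integrable_pmf_bounded[where B=1]) (auto split: split_indicator)
      have intF: "integrable (measure_pmf (P n)) (\<lambda>h. F (f h))" for f
        by (rule integrable_pmf_bounded[OF F(2)])
      have pw: "\<bar>F (W n h) - F (Z n h *\<^sub>R e)\<bar> \<le> ?b h" if h: "h \<in> set_pmf (P n)" for h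
      proof (cases "\<bar>Z n h\<bar> \<le> R \<and> \<bar>U n h - u\<bar> \<le> \<delta>")
        case True
        then have w: "norm (W n h - Z n h *\<^sub>R e) \<le> \<epsilon>" using n0[OF elim(3) h] by blast
        have z: "norm (Z n h *\<^sub>R e) \<le> R * norm e" using True by (simp add: mult_right_mono)
        have "norm (W n h) \<le> R * norm e + 1"
          using norm_triangle_ineq[of "W n h - Z n h *\<^sub>R e" "Z n h *\<^sub>R e"] w z by (simp add: \<epsilon>_def)
        then have "dist (F (W n h)) (F (Z n h *\<^sub>R e)) < \<eta>"
          using w z \<epsilon>0(1) by (intro \<epsilon>0(2)) (auto simp: C_def dist_norm \<epsilon>_def norm_minus_commute)
        moreover have "0 \<le> 2 * B * (\<phi> k (Z n h) + indicator {h. \<bar>U n h - u\<bar> > \<delta>} h)"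
          using B0 by (auto simp: \<phi>_def)
        ultimately show ?thesis by (simp add: dist_real_def)
      next
        case False
        then have "1 \<le> \<phi> k (Z n h) + indicator {h. \<bar>U n h - u\<bar> > \<delta>} h"
          by (auto simp: \<phi>_def R_def split: split_indicator)
        from mult_left_mono[OF this, of "2 * B"] B0 \<eta>
        have "2 * B \<le> ?b h" by simp
        moreover have "\<bar>F (W n h) - F (Z n h *\<^sub>R e)\<bar> \<le> 2 * B"
          using F(2)[of "W n h"] F(2)[of "Z n h *\<^sub>R e"] by simp
        ultimately show ?thesis by linarith
      qed
      have "\<bar>pexp (P n) (\<lambda>h. F (W n h)) - pexp (P n) (\<lambda>h. F (Z n h *\<^sub>R e))\<bar>
         = \<bar>pexp (P n) (\<lambda>h. F (W n h) - F (Z n h *\<^sub>R e))\<bar>"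
        using intF by simp
      also have "\<dots> \<le> pexp (P n) (\<lambda>h. \<bar>F (W n h) - F (Z n h *\<^sub>R e)\<bar>)"
        by (rule integral_abs_bound)
      also have "\<dots> \<le> pexp (P n) ?b"
        by (intro integral_mono_AE AE_pmfI pw integrable_abs Bochner_Integration.integrable_diff
            Bochner_Integration.integrable_add integrable_mult_right intF int\<phi> intI) auto
      also have "\<dots> = \<eta> + 2 * B * (pexp (P n) (\<lambda>h. \<phi> k (Z n h)) + measure_pmf.prob (P n) {h. \<bar>U n h - u\<bar> > \<delta>})"
        using int\<phi> intI by simp
      also have "\<dots> \<le> \<eta> + 2 * B * (\<eta> + \<eta>)"
        using elim B0 by (intro add_mono mult_left_mono) auto
      also have "\<dots> = \<eta> * (1 + 4 * B)" by (simp add: algebra_simps)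
      also have "\<dots> = r / 2"
      proof -
        have "r / (2 * x) * x = r / 2" if "x > 0" for x using that by simp
        from this[of "1 + 4 * B"] B0 show ?thesis unfolding \<eta>_def by simp
      qed
      finally show ?case using r by simp
    qed
    then show "\<exists>no. \<forall>n\<ge>no. norm (pexp (P n) (\<lambda>h. F (W n h)) - pexp (P n) (\<lambda>h. F (Z n h *\<^sub>R e)) - 0) < r"
      by (simp add: eventually_sequentially)
  qed
  from tendsto_add[OF diff main] show ?thesis by simp
qed

text \<open>Writing the law as that of sqrt v times a standard normal variable treats the point mass
  at v = 0 on the same footing as the densities.\<close>

lemma
  assumes v: "0 \<le> v"
  shows real_distribution_normal_law: "real_distribution (normal_law v)"
    and char_normal_law: "char (normal_law v) t = exp (complex_of_real (- (t\<^sup>2 * v / 2)))"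
proof -
  let ?N = "density lborel std_normal_density"
  interpret std: prob_space ?N by (rule prob_space_normal_density) simp
  have scale: "normal_law v = distr ?N borel (\<lambda>x. sqrt v * x)"
  proof (cases "v = 0")
    case True
    have "distr ?N borel (\<lambda>x. sqrt v * x) = return borel 0"
      using True std.distr_const[of 0 borel] by simp
    also have "\<dots> = return lborel 0" by (simp add: return_def)
    finally show ?thesis using True by (simp add: normal_law_def)
  next
    case False
    have "distributed ?N lborel (\<lambda>x. x) (\<lambda>x. ennreal (std_normal_density x))"
      by (auto simp: distributed_def distr_id2)
    from std.normal_density_affine[OF this, of "sqrt v" 0] False v
    have "distributed ?N lborel (\<lambda>x. sqrt v * x) (\<lambda>x. ennreal (normal_density 0 (sqrt v) x))" by simp
    then have "distr ?N lborel (\<lambda>x. sqrt v * x) = density lborel (\<lambda>x. ennreal (normal_density 0 (sqrt v) x))"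
      by (simp add: distributed_def)
    moreover have "distr ?N lborel (\<lambda>x. sqrt v * x) = distr ?N borel (\<lambda>x. sqrt v * x)"
      by (rule distr_cong) auto
    ultimately show ?thesis using False by (simp add: normal_law_def)
  qed
  show "real_distribution (normal_law v)"
    unfolding scale by (rule std.real_distribution_distr) simp
  have "char (normal_law v) t = char ?N (t * sqrt v)"
    unfolding scale char_def by (subst integral_distr) (auto simp: mult.assoc)
  also have "\<dots> = exp (complex_of_real (- (t\<^sup>2 * v / 2)))"
  proof -
    have "(t * sqrt v)\<^sup>2 = t\<^sup>2 * v" using v by (simp add: power_mult_distrib)
    then show ?thesis
      by (simp only: char_std_normal_distribution exp_of_real minus_divide_left)
  qed
  finally show "char (normal_law v) t = exp (complex_of_real (- (t\<^sup>2 * v / 2)))" .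
qed

lemma distr_normal_law:
  assumes v: "0 \<le> v"
  shows "distr (normal_law v) borel (\<lambda>z. c * z) = normal_law (c\<^sup>2 * v)"
proof (rule Levy_uniqueness)
  interpret real_distribution "normal_law v" by (rule real_distribution_normal_law[OF v])
  show "real_distribution (distr (normal_law v) borel (\<lambda>z. c * z))"
    by (rule real_distribution_distr) simp
  show "real_distribution (normal_law (c\<^sup>2 * v))"
    using v by (intro real_distribution_normal_law) simp
  show "char (distr (normal_law v) borel (\<lambda>z. c * z)) = char (normal_law (c\<^sup>2 * v))"
  proof
    fix t
    have "char (distr (normal_law v) borel (\<lambda>z. c * z)) t = char (normal_law v) (t * c)"
      unfolding char_def by (subst integral_distr) (auto simp: mult.assoc)
    then show "char (distr (normal_law v) borel (\<lambda>z. c * z)) t = char (normal_law (c\<^sup>2 * v)) t"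
      using v by (simp add: char_normal_law power_mult_distrib mult.assoc)
  qed
qed

text \<open>The limit law lives on a line and has no density in the plane, but every linear
  functional of it is a multiple of one centred normal variable.\<close>

lemma gaussian2_rank_one:
  assumes v: "0 \<le> v"
  shows "gaussian2 (v * a\<^sup>2) (v * a * b) (v * b\<^sup>2) (distr (normal_law v) borel (\<lambda>z. z *\<^sub>R (a, b)))"
proof -
  interpret real_distribution "normal_law v" by (rule real_distribution_normal_law[OF v])
  have meas: "(\<lambda>z. z *\<^sub>R (a, b)) \<in> borel_measurable (normal_law v)" by measurable
  have "distr (distr (normal_law v) borel (\<lambda>z. z *\<^sub>R (a, b))) borel (\<lambda>(x, y). s * x + t * y)
      = distr (normal_law v) borel (\<lambda>z. (s * a + t * b) * z)" for s t
    by (subst distr_distr)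
      (auto simp: o_def borel_prod[symmetric] algebra_simps intro!: arg_cong[where f="distr (normal_law v) borel"])
  also have "\<dots> s t = normal_law (s\<^sup>2 * (v * a\<^sup>2) + 2 * s * t * (v * a * b) + t\<^sup>2 * (v * b\<^sup>2))" for s t
    unfolding distr_normal_law[OF v]
    by (rule arg_cong[where f=normal_law]) (simp add: power2_eq_square algebra_simps)
  finally show ?thesis
    using prob_space_distr[OF meas] by (auto simp: gaussian2_def)
qed

section \<open>Reduction of the least squares criterion\<close>

text \<open>After the outlier sizes have been eliminated, the criterion is a quadratic in \<open>a\<close> plus the
  bounded rational function \<open>(c - d a) / (1 + a\<^sup>2)\<close>.\<close>

definition reduced :: "real \<Rightarrow> real \<Rightarrow> real \<Rightarrow> real \<Rightarrow> real \<Rightarrow> real" where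
  "reduced A B c d a = A * a\<^sup>2 - 2 * B * a + (c - d * a) / (1 + a\<^sup>2)"

lemma one_plus_sq_pos: "0 < 1 + (a :: real)\<^sup>2" "1 + (a :: real)\<^sup>2 \<noteq> 0"
  by (smt (verit) zero_le_power2)+

text \<open>\<open>rat1\<close> and \<open>rat2\<close> are the first two derivatives of the bounded
  rational term, in closed forms from which explicit bounds can be read off.\<close>

definition rat1 :: "real \<Rightarrow> real \<Rightarrow> real \<Rightarrow> real" where
  "rat1 c d a = (- d * (1 + a\<^sup>2) - (c - d * a) * (2 * a)) / (1 + a\<^sup>2)\<^sup>2"

definition rat2 :: "real \<Rightarrow> real \<Rightarrow> real \<Rightarrow> real" where
  "rat2 c d a = (c * (6 * a\<^sup>2 - 2) - d * (2 * a ^ 3 - 6 * a)) / (1 + a\<^sup>2) ^ 3"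

lemma rat_deriv: "((\<lambda>a. (c - d * a) / (1 + a\<^sup>2)) has_real_derivative rat1 c d a) (at a)"
  unfolding rat1_def using one_plus_sq_pos[of a]
  by (auto intro!: derivative_eq_intros simp: power2_eq_square)

lemma rat1_deriv: "(rat1 c d has_real_derivative rat2 c d a) (at a)"
proof -
  let ?q = "1 + a\<^sup>2"
  have q: "?q \<noteq> 0" by (rule one_plus_sq_pos)
  have "(rat1 c d has_real_derivative
     (((- d * (2 * a)) - ((- d) * (2 * a) + (c - d * a) * 2)) * ?q\<^sup>2
       - (- d * ?q - (c - d * a) * (2 * a)) * (2 * ?q * (2 * a))) / (?q\<^sup>2 * ?q\<^sup>2)) (at a)"
    unfolding rat1_def[abs_def] using q
    by (auto intro!: derivative_eq_intros simp: algebra_simps)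
  moreover have "(((- d * (2 * a)) - ((- d) * (2 * a) + (c - d * a) * 2)) * ?q\<^sup>2
       - (- d * ?q - (c - d * a) * (2 * a)) * (2 * ?q * (2 * a))) / (?q\<^sup>2 * ?q\<^sup>2)
     = (?q * (((- d * (2 * a)) - ((- d) * (2 * a) + (c - d * a) * 2)) * ?q
       - (- d * ?q - (c - d * a) * (2 * a)) * (2 * (2 * a)))) / (?q * ?q ^ 3)"
    by (rule arg_cong2[where f="(/)"]) (simp_all add: power2_eq_square power3_eq_cube algebra_simps)
  also have "\<dots> = (((- d * (2 * a)) - ((- d) * (2 * a) + (c - d * a) * 2)) * ?q
       - (- d * ?q - (c - d * a) * (2 * a)) * (2 * (2 * a))) / ?q ^ 3"
    using q by (rule mult_divide_mult_cancel_left)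
  also have "\<dots> = rat2 c d a"
    unfolding rat2_def
    by (rule arg_cong2[where f="(/)"]) (simp_all add: power2_eq_square power3_eq_cube algebra_simps)
  ultimately show ?thesis by simp
qed

lemma abs_le_one_plus_sq: "\<bar>a\<bar> \<le> 1 + (a :: real)\<^sup>2"
proof -
  have "0 \<le> (\<bar>a\<bar> - 1)\<^sup>2" by simp
  then have "2 * \<bar>a\<bar> \<le> 1 + a\<^sup>2" by (simp add: power2_eq_square algebra_simps)
  then show ?thesis by linarith
qed

lemma rat1_bound: "\<bar>rat1 c d a\<bar> \<le> 3 * (\<bar>c\<bar> + \<bar>d\<bar>)"
proof -
  let ?q = "1 + a\<^sup>2"
  have q: "?q \<ge> 1" by simp
  have q2: "?q \<le> ?q\<^sup>2" using q by (simp add: self_le_power)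
  have "\<bar>- d * ?q - (c - d * a) * (2 * a)\<bar> \<le> \<bar>d\<bar> * ?q + 2 * \<bar>c\<bar> * \<bar>a\<bar> + 2 * \<bar>d\<bar> * a\<^sup>2"
  proof -
    have "- d * ?q - (c - d * a) * (2 * a) = - (d * ?q) - 2 * c * a + 2 * d * a\<^sup>2"
      by (simp add: algebra_simps power2_eq_square)
    also have "\<bar>\<dots>\<bar> \<le> \<bar>d * ?q\<bar> + \<bar>2 * c * a\<bar> + \<bar>2 * d * a\<^sup>2\<bar>" by linarith
    finally show ?thesis by (simp add: abs_mult)
  qed
  also have "\<dots> \<le> \<bar>d\<bar> * ?q\<^sup>2 + 2 * \<bar>c\<bar> * ?q\<^sup>2 + 2 * \<bar>d\<bar> * ?q\<^sup>2"
  proof (intro add_mono mult_left_mono)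
    show "\<bar>a\<bar> \<le> ?q\<^sup>2" using abs_le_one_plus_sq[of a] q2 by linarith
    show "a\<^sup>2 \<le> ?q\<^sup>2" using q2 by linarith
  qed (use q2 in auto)
  also have "\<dots> \<le> 3 * (\<bar>c\<bar> + \<bar>d\<bar>) * ?q\<^sup>2" by (simp add: algebra_simps)
  finally show ?thesis
    unfolding rat1_def abs_divide using q by (simp add: divide_le_eq)
qed

text \<open>Every power of \<open>a\<close> in the numerator is at most the denominator, so the
  coefficients can be added up: 6 + 2 for \<open>c\<close> and 2 + 6 for \<open>d\<close>.\<close>

lemma rat2_bound: "\<bar>rat2 c d a\<bar> \<le> 8 * (\<bar>c\<bar> + \<bar>d\<bar>)"
proof -
  let ?q = "1 + a\<^sup>2"
  have q: "?q \<ge> 1" by simp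
  have q2: "?q \<le> ?q ^ 3" using q by (intro self_le_power) auto
  have q12: "?q\<^sup>2 \<le> ?q ^ 3" using q by (intro power_increasing) auto
  have a: "\<bar>a\<bar> \<le> ?q ^ 3" "a\<^sup>2 \<le> ?q ^ 3"
    using abs_le_one_plus_sq[of a] q2 by linarith+
  have "\<bar>a\<bar> * a\<^sup>2 \<le> ?q * ?q" using abs_le_one_plus_sq[of a] by (intro mult_mono) auto
  then have a3: "\<bar>a ^ 3\<bar> \<le> ?q ^ 3" using q12
    by (simp add: power2_eq_square power3_eq_cube abs_mult)
  have "\<bar>c * (6 * a\<^sup>2 - 2) - d * (2 * a ^ 3 - 6 * a)\<bar> \<le> \<bar>c\<bar> * \<bar>6 * a\<^sup>2 - 2\<bar> + \<bar>d\<bar> * \<bar>2 * a ^ 3 - 6 * a\<bar>"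
    by (intro order_trans[OF abs_triangle_ineq4]) (simp add: abs_mult)
  also have "\<dots> \<le> \<bar>c\<bar> * (8 * ?q ^ 3) + \<bar>d\<bar> * (8 * ?q ^ 3)"
  proof (intro add_mono mult_left_mono)
    show "\<bar>6 * a\<^sup>2 - 2\<bar> \<le> 8 * ?q ^ 3" using a q q2 zero_le_power2[of a] by linarith
    show "\<bar>2 * a ^ 3 - 6 * a\<bar> \<le> 8 * ?q ^ 3" using a a3 by linarith
  qed auto
  also have "\<dots> = 8 * (\<bar>c\<bar> + \<bar>d\<bar>) * ?q ^ 3" by (simp add: algebra_simps)
  finally have *: "\<bar>c * (6 * a\<^sup>2 - 2) - d * (2 * a ^ 3 - 6 * a)\<bar> \<le> 8 * (\<bar>c\<bar> + \<bar>d\<bar>) * ?q ^ 3" .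
  have p: "0 < ?q ^ 3" by (intro zero_less_power one_plus_sq_pos)
  show ?thesis
    unfolding rat2_def abs_divide abs_of_pos[OF p] pos_divide_le_eq[OF p] by (rule *)
qed

text \<open>The threshold on \<open>A\<close> makes the second derivative
  \<open>2 * A + rat2 c d a\<close> positive, so the critical point is the strict minimum. The
  derivative is 2 A (a - B/A) plus a bounded term, which confines its zero to a neighbourhood of
  B/A.\<close>

lemma reduced_minimizer:
  assumes A: "A > 4 * (\<bar>c\<bar> + \<bar>d\<bar>)"
  obtains a where "\<And>x. x \<noteq> a \<Longrightarrow> reduced A B c d a < reduced A B c d x"
    "\<bar>a - B / A\<bar> \<le> 2 * (\<bar>c\<bar> + \<bar>d\<bar>) / A"
proof -
  define f' where "f' a = 2 * A * a - 2 * B + rat1 c d a" for a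
  have A0: "A > 0" using A by (smt (verit) abs_ge_zero)
  have d1: "(reduced A B c d has_real_derivative f' a) (at a)" for a
  proof -
    have "((\<lambda>a. A * a\<^sup>2 - 2 * B * a) has_real_derivative 2 * A * a - 2 * B) (at a)"
      by (auto intro!: derivative_eq_intros)
    from DERIV_add[OF this rat_deriv[of c d a]] show ?thesis
      by (simp add: reduced_def[abs_def] f'_def)
  qed
  have d2: "(f' has_real_derivative 2 * A + rat2 c d a) (at a)" for a
    unfolding f'_def[abs_def] by (auto intro!: derivative_eq_intros rat1_deriv)
  have mono: "f' x < f' y" if "x < y" for x y
  proof (rule DERIV_pos_imp_increasing[OF that])
    fix z
    have "2 * A + rat2 c d z > 0" using rat2_bound[of c d z] A by linarith
    with d2[of z] show "\<exists>w. (f' has_real_derivative w) (at z) \<and> 0 < w" by blast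
  qed
  \<comment> \<open>At distance D from B/A the linear part 2 A D of the derivative equals the bound
    on \<open>rat1\<close>, so the sign there is known.\<close>
  define D where "D = 3 * (\<bar>c\<bar> + \<bar>d\<bar>) / (2 * A)"
  have D0: "D \<ge> 0" using A0 by (simp add: D_def)
  have DA: "2 * A * D = 3 * (\<bar>c\<bar> + \<bar>d\<bar>)" using A0 by (simp add: D_def)
  have "f' (B / A - D) \<le> 0" "0 \<le> f' (B / A + D)"
    using rat1_bound[of c d "B / A - D"] rat1_bound[of c d "B / A + D"] DA A0
    by (auto simp: f'_def algebra_simps abs_le_iff)
  moreover have "\<forall>x. B / A - D \<le> x \<and> x \<le> B / A + D \<longrightarrow> isCont f' x"
    using d2 DERIV_isCont by blast
  ultimately obtain a where a: "B / A - D \<le> a" "a \<le> B / A + D" "f' a = 0"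
    using IVT[of f' "B / A - D" 0 "B / A + D"] D0 by auto
  show thesis
  proof (rule that[of a])
    have "\<bar>a - B / A\<bar> \<le> D" using a by (simp add: abs_le_iff)
    also have "D \<le> 2 * (\<bar>c\<bar> + \<bar>d\<bar>) / A"
      using A0 by (simp add: D_def divide_simps)
    finally show "\<bar>a - B / A\<bar> \<le> 2 * (\<bar>c\<bar> + \<bar>d\<bar>) / A" .
    fix x assume "x \<noteq> a"
    then consider "x < a" | "a < x" by linarith
    then show "reduced A B c d a < reduced A B c d x"
    proof cases
      case 1
      then obtain z where z: "x < z" "z < a" "reduced A B c d a - reduced A B c d x = (a - x) * f' z"
        using MVT2[of x a "reduced A B c d" f'] d1 by auto
      have "f' z < 0" using mono[OF z(2)] a by simp
      then have "(a - x) * f' z < 0" using 1 by (intro mult_pos_neg) auto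
      then show ?thesis using z by linarith
    next
      case 2
      then obtain z where z: "a < z" "z < x" "reduced A B c d x - reduced A B c d a = (x - a) * f' z"
        using MVT2[of a x "reduced A B c d" f'] d1 by auto
      have "f' z > 0" using mono[OF z(1)] a by simp
      then have "(x - a) * f' z > 0" using 2 by (intro mult_pos_pos) auto
      then show ?thesis using z by linarith
    qed
  qed
qed

text \<open>The best outlier size for a given coefficient \<open>a\<close>, where \<open>q\<close>,
  \<open>y\<close>, \<open>p\<close> are observed just before, at and just after the outlier. At a =
  \<alpha> it is the centring L_i of the theorem.\<close>

definition theta_of :: "real \<Rightarrow> real \<Rightarrow> real \<Rightarrow> real \<Rightarrow> real \<Rightarrow> real" where
  "theta_of \<mu> q y p a = y - a / (1 + a\<^sup>2) * (q + p) - (1 - a) / (1 + a\<^sup>2) * \<mu>"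

text \<open>Completing the square in \<open>t\<close> leaves \<open>(p - \<mu> - a * \<mu> - q *
  a\<^sup>2)\<^sup>2 / (1 + a\<^sup>2)\<close>, free of \<open>y\<close>. Polynomial division splits
  this into a quadratic in \<open>a\<close>, which joins the main criterion, and a bounded
  fraction.\<close>

lemma outlier_block:
  fixes a t q y p \<mu> :: real
  shows "(y - a * q - \<mu> - t)\<^sup>2 + (p - a * y - \<mu> + a * t)\<^sup>2
    = (1 + a\<^sup>2) * (t - theta_of \<mu> q y p a)\<^sup>2 + (q\<^sup>2 * a\<^sup>2 + 2 * q * \<mu> * a
       + (((p + q - \<mu>)\<^sup>2 - \<mu>\<^sup>2) - (2 * \<mu> * (p + q - \<mu>)) * a) / (1 + a\<^sup>2)) + (q\<^sup>2 + \<mu>\<^sup>2 - 2 * q * (p + q - \<mu>))"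
proof -
  let ?s = "1 + a\<^sup>2"
  have s: "?s \<noteq> 0" by (rule one_plus_sq_pos)
  define w where "w = y * ?s - a * (q + p) - (1 - a) * \<mu>"
  have th: "theta_of \<mu> q y p a = w / ?s"
    using s by (simp add: theta_of_def w_def diff_divide_distrib left_diff_distrib)
  have 1: "?s * (t - theta_of \<mu> q y p a)\<^sup>2 = (?s * t - w)\<^sup>2 / ?s"
  proof -
    have "t - w / ?s = (?s * t - w) / ?s" using s by (simp add: diff_divide_distrib)
    then have "?s * (t - w / ?s)\<^sup>2 = ?s * ((?s * t - w)\<^sup>2 / (?s * ?s))"
      by (simp add: power_divide power2_eq_square)
    then show ?thesis using s by (simp add: th)
  qed
  have "(y - a * q - \<mu> - t)\<^sup>2 + (p - a * y - \<mu> + a * t)\<^sup>2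
     = (?s * ((y - a * q - \<mu> - t)\<^sup>2 + (p - a * y - \<mu> + a * t)\<^sup>2)) / ?s"
    using s by simp
  also have "?s * ((y - a * q - \<mu> - t)\<^sup>2 + (p - a * y - \<mu> + a * t)\<^sup>2)
     = (?s * t - w)\<^sup>2 + ?s * (q\<^sup>2 * a\<^sup>2 + 2 * q * \<mu> * a) + (((p + q - \<mu>)\<^sup>2 - \<mu>\<^sup>2) - (2 * \<mu> * (p + q - \<mu>)) * a)
       + ?s * (q\<^sup>2 + \<mu>\<^sup>2 - 2 * q * (p + q - \<mu>))"
    unfolding w_def by (simp add: power2_eq_square algebra_simps)
  also have "\<dots> / ?s = (?s * t - w)\<^sup>2 / ?s + (q\<^sup>2 * a\<^sup>2 + 2 * q * \<mu> * a)
     + (((p + q - \<mu>)\<^sup>2 - \<mu>\<^sup>2) - (2 * \<mu> * (p + q - \<mu>)) * a) / ?s + (q\<^sup>2 + \<mu>\<^sup>2 - 2 * q * (p + q - \<mu>))"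
    using s by (simp add: add_divide_distrib)
  finally show ?thesis unfolding 1 by simp
qed

definition free_idx :: "nat \<Rightarrow> nat \<Rightarrow> nat \<Rightarrow> nat set" where
  "free_idx s1 s2 n = {1..n} - {s1, s1 + 1, s2, s2 + 1}"

lemma Qn_decomposition:
  fixes y :: "nat \<Rightarrow> real" and \<mu> :: real and s1 s2 n :: nat
  defines "q1 \<equiv> y (s1 - 1)" and "q2 \<equiv> y (s2 - 1)" and "p1 \<equiv> y (s1 + 1)" and "p2 \<equiv> y (s2 + 1)"
  shows "\<exists>C. \<forall>a t1 t2. Qn \<mu> s1 s2 n y (a, t1, t2) =
     (1 + a\<^sup>2) * (t1 - theta_of \<mu> q1 (y s1) p1 a)\<^sup>2 + (1 + a\<^sup>2) * (t2 - theta_of \<mu> q2 (y s2) p2 a)\<^sup>2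
     + reduced ((\<Sum>k\<in>free_idx s1 s2 n. (y (k - 1))\<^sup>2) + q1\<^sup>2 + q2\<^sup>2)
         ((\<Sum>k\<in>free_idx s1 s2 n. y (k - 1) * (y k - \<mu>)) - \<mu> * q1 - \<mu> * q2)
         (((p1 + q1 - \<mu>)\<^sup>2 - \<mu>\<^sup>2) + ((p2 + q2 - \<mu>)\<^sup>2 - \<mu>\<^sup>2))
         (2 * \<mu> * (p1 + q1 - \<mu>) + 2 * \<mu> * (p2 + q2 - \<mu>)) a + C"
proof (intro exI allI)
  fix a t1 t2
  let ?I = "free_idx s1 s2 n"
  have "(\<Sum>k\<in>?I. (y k - a * y (k - 1) - \<mu>)\<^sup>2)
    = (\<Sum>k\<in>?I. (y k - \<mu>)\<^sup>2 + (- 2 * a * (y (k - 1) * (y k - \<mu>)) + a\<^sup>2 * (y (k - 1))\<^sup>2))"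
    by (intro sum.cong) (auto simp: power2_eq_square algebra_simps)
  also have "\<dots> = (\<Sum>k\<in>?I. (y k - \<mu>)\<^sup>2) + (- 2 * a * (\<Sum>k\<in>?I. y (k - 1) * (y k - \<mu>)) + a\<^sup>2 * (\<Sum>k\<in>?I. (y (k - 1))\<^sup>2))"
    by (simp only: sum.distrib sum_distrib_left)
  finally show "Qn \<mu> s1 s2 n y (a, t1, t2) =
     (1 + a\<^sup>2) * (t1 - theta_of \<mu> q1 (y s1) p1 a)\<^sup>2 + (1 + a\<^sup>2) * (t2 - theta_of \<mu> q2 (y s2) p2 a)\<^sup>2
     + reduced ((\<Sum>k\<in>?I. (y (k - 1))\<^sup>2) + q1\<^sup>2 + q2\<^sup>2)
         ((\<Sum>k\<in>?I. y (k - 1) * (y k - \<mu>)) - \<mu> * q1 - \<mu> * q2)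
         (((p1 + q1 - \<mu>)\<^sup>2 - \<mu>\<^sup>2) + ((p2 + q2 - \<mu>)\<^sup>2 - \<mu>\<^sup>2))
         (2 * \<mu> * (p1 + q1 - \<mu>) + 2 * \<mu> * (p2 + q2 - \<mu>)) a
     + ((\<Sum>k\<in>?I. (y k - \<mu>)\<^sup>2) + (q1\<^sup>2 + \<mu>\<^sup>2 - 2 * q1 * (p1 + q1 - \<mu>)) + (q2\<^sup>2 + \<mu>\<^sup>2 - 2 * q2 * (p2 + q2 - \<mu>)))"
    unfolding Qn_def free_idx_def[symmetric] prod.case
      outlier_block[where y="y s1", folded q1_def p1_def]
      outlier_block[where y="y s2" and p="y (s2 + 1)" and q="y (s2 - 1)"]
      outlier_block[where y="y s1" and p="y (s1 + 1)" and q="y (s1 - 1)"]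
      q1_def q2_def p1_def p2_def reduced_def
    by (simp add: diff_divide_distrib add_divide_distrib algebra_simps)
qed

text \<open>For each \<open>a\<close> the two squares vanish exactly at the values of
  \<open>theta_of\<close>, so minimisation reduces to \<open>reduced\<close>. Above the threshold
  for \<open>A\<close> the minimiser is unique and the default value of \<open>cls_est\<close> does
  not occur.\<close>

lemma cls_est_eq:
  fixes y :: "nat \<Rightarrow> real" and \<mu> :: real and s1 s2 n :: nat
  defines "q1 \<equiv> y (s1 - 1)" and "q2 \<equiv> y (s2 - 1)" and "p1 \<equiv> y (s1 + 1)" and "p2 \<equiv> y (s2 + 1)"
  defines "A \<equiv> (\<Sum>k\<in>free_idx s1 s2 n. (y (k - 1))\<^sup>2) + q1\<^sup>2 + q2\<^sup>2"
    and "B \<equiv> (\<Sum>k\<in>free_idx s1 s2 n. y (k - 1) * (y k - \<mu>)) - \<mu> * q1 - \<mu> * q2"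
    and "c \<equiv> ((p1 + q1 - \<mu>)\<^sup>2 - \<mu>\<^sup>2) + ((p2 + q2 - \<mu>)\<^sup>2 - \<mu>\<^sup>2)"
    and "d \<equiv> 2 * \<mu> * (p1 + q1 - \<mu>) + 2 * \<mu> * (p2 + q2 - \<mu>)"
  assumes A: "A > 4 * (\<bar>c\<bar> + \<bar>d\<bar>)"
  shows "\<exists>a. cls_est \<mu> s1 s2 n y = (a, theta_of \<mu> q1 (y s1) p1 a, theta_of \<mu> q2 (y s2) p2 a)
     \<and> \<bar>a - B / A\<bar> \<le> 2 * (\<bar>c\<bar> + \<bar>d\<bar>) / A"
proof -
  obtain a where a: "\<And>x. x \<noteq> a \<Longrightarrow> reduced A B c d a < reduced A B c d x"
    "\<bar>a - B / A\<bar> \<le> 2 * (\<bar>c\<bar> + \<bar>d\<bar>) / A"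
    using reduced_minimizer[OF A, of B] by blast
  obtain C where C: "\<And>x t1 t2. Qn \<mu> s1 s2 n y (x, t1, t2) =
     (1 + x\<^sup>2) * (t1 - theta_of \<mu> q1 (y s1) p1 x)\<^sup>2 + (1 + x\<^sup>2) * (t2 - theta_of \<mu> q2 (y s2) p2 x)\<^sup>2
     + reduced A B c d x + C"
    using Qn_decomposition[of \<mu> s1 s2 n y] unfolding q1_def q2_def p1_def p2_def A_def B_def c_def d_def by blast
  define p where "p = (a, theta_of \<mu> q1 (y s1) p1 a, theta_of \<mu> q2 (y s2) p2 a)"
  have Qp: "Qn \<mu> s1 s2 n y p = reduced A B c d a + C" by (simp add: p_def C)
  have less: "Qn \<mu> s1 s2 n y p < Qn \<mu> s1 s2 n y r" if "r \<noteq> p" for r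
  proof -
    obtain x t1 t2 where r: "r = (x, t1, t2)" by (cases r)
    have sq: "0 \<le> (1 + x\<^sup>2) * u\<^sup>2" for u :: real by simp
    show ?thesis
    proof (cases "x = a")
      case False
      then show ?thesis
        using a(1)[OF False] sq[of "t1 - theta_of \<mu> q1 (y s1) p1 x"] sq[of "t2 - theta_of \<mu> q2 (y s2) p2 x"]
        unfolding r Qp C by linarith
    next
      case True
      then have "t1 - theta_of \<mu> q1 (y s1) p1 x \<noteq> 0 \<or> t2 - theta_of \<mu> q2 (y s2) p2 x \<noteq> 0"
        using that by (auto simp: r p_def)
      moreover have "0 < (1 + x\<^sup>2) * u\<^sup>2" if "u \<noteq> 0" for u :: real
        using that one_plus_sq_pos[of x] by (intro mult_pos_pos) auto
      ultimately have "0 < (1 + x\<^sup>2) * (t1 - theta_of \<mu> q1 (y s1) p1 x)\<^sup>2 + (1 + x\<^sup>2) * (t2 - theta_of \<mu> q2 (y s2) p2 x)\<^sup>2"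
        using sq by (metis add_nonneg_pos add_pos_nonneg)
      then show ?thesis unfolding r Qp C using True by simp
    qed
  qed
  have min: "\<forall>r. Qn \<mu> s1 s2 n y p \<le> Qn \<mu> s1 s2 n y r"
    using less by (metis less_imp_le order_refl)
  have uniq: "r = p" if "\<forall>r'. Qn \<mu> s1 s2 n y r \<le> Qn \<mu> s1 s2 n y r'" for r
    using less[of r] that by (metis not_less)
  have "cls_est \<mu> s1 s2 n y = p"
  proof -
    let ?P = "\<lambda>p. \<forall>r. Qn \<mu> s1 s2 n y p \<le> Qn \<mu> s1 s2 n y r"
    have "\<exists>!p. ?P p" by (rule ex1I[of ?P p, OF min uniq])
    moreover have "(THE p. ?P p) = p" by (rule the_equality[of ?P p, OF min uniq])
    ultimately show ?thesis unfolding cls_est_def by (simp only: if_True)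
  qed
  then show ?thesis using a(2) unfolding p_def by blast
qed

text \<open>The deterministic part of the limit for \<alpha>. In the application \<open>u0\<close>
  is \<open>m 2\<close>, \<open>Z\<close> the normalised martingale and \<open>u\<close> the
  normalised sum of squares; \<open>CA\<close> and \<open>CB\<close> collect contributions of the
  fixed segment and are negligible after scaling.\<close>

lemma near_alpha:
  fixes \<alpha> u0 CA CB c d :: real
  assumes u0: "u0 > 0" and R: "R > 0" and \<epsilon>: "\<epsilon> > 0"
  shows "\<exists>\<delta>>0. \<exists>n0. \<forall>N\<ge>n0. \<forall>Z u A B. \<bar>Z\<bar> \<le> R \<longrightarrow> \<bar>u - u0\<bar> \<le> \<delta> \<longrightarrow> A = real N * u + CA \<longrightarrow>
     B = \<alpha> * A + Z * sqrt (real N) * u0 + CB \<longrightarrow> A > 4 * (\<bar>c\<bar> + \<bar>d\<bar>) \<and>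
     (\<forall>a. \<bar>a - B / A\<bar> \<le> 2 * (\<bar>c\<bar> + \<bar>d\<bar>) / A \<longrightarrow> \<bar>sqrt (real N) * (a - \<alpha>) - Z\<bar> \<le> \<epsilon>)"
proof -
  define D where "D = 2 * (\<bar>c\<bar> + \<bar>d\<bar>)"
  \<comment> \<open>The first bound keeps \<open>u\<close> above u0 / 2; the second makes the error
    4 R \<delta> / u0 of replacing \<open>u\<close> by \<open>u0\<close> at most
    \<epsilon>/2.\<close>
  define \<delta> where "\<delta> = min (u0 / 2) (\<epsilon> * u0 / (8 * R))"
  have D: "D \<ge> 0" by (simp add: D_def)
  have \<delta>: "\<delta> > 0" using u0 R \<epsilon> by (simp add: \<delta>_def)
  have \<delta>R: "4 * R * \<delta> / u0 \<le> \<epsilon> / 2"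
  proof -
    have "\<delta> \<le> \<epsilon> * u0 / (8 * R)" by (simp add: \<delta>_def)
    then show ?thesis using u0 R by (simp add: field_simps)
  qed
  let ?K = "(4 * D + 4 * \<bar>CB\<bar>) / u0"
  have "(\<lambda>N. ?K * (1 / sqrt (real N)) + 4 * R * \<bar>CA\<bar> / u0 * (1 / real N)) \<longlonglongrightarrow> ?K * 0 + 4 * R * \<bar>CA\<bar> / u0 * 0"
  proof (intro tendsto_intros lim_1_over_n)
    show "(\<lambda>N. 1 / sqrt (real N)) \<longlonglongrightarrow> 0" by real_asymp
  qed
  then have ev1: "eventually (\<lambda>N. ?K * (1 / sqrt (real N)) + 4 * R * \<bar>CA\<bar> / u0 * (1 / real N) < \<epsilon> / 2) sequentially"
    using \<epsilon> by (intro order_tendstoD) auto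
  have "filterlim (\<lambda>N. u0 / 4 * real N) at_top sequentially"
    using u0 by real_asymp
  then have ev2: "eventually (\<lambda>N. u0 / 4 * real N > max \<bar>CA\<bar> (2 * D)) sequentially"
    by (simp add: filterlim_at_top_dense)
  from ev1 ev2 eventually_gt_at_top[of 0]
  have "eventually (\<lambda>N. N > 0 \<and> ?K * (1 / sqrt (real N)) + 4 * R * \<bar>CA\<bar> / u0 * (1 / real N) < \<epsilon> / 2 \<and>
     u0 / 4 * real N > max \<bar>CA\<bar> (2 * D)) sequentially"
    by eventually_elim blast
  then obtain n0 where n0: "\<And>N. N \<ge> n0 \<Longrightarrow> N > 0 \<and> ?K * (1 / sqrt (real N)) + 4 * R * \<bar>CA\<bar> / u0 * (1 / real N) < \<epsilon> / 2 \<and>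
     u0 / 4 * real N > max \<bar>CA\<bar> (2 * D)"
    by (auto simp: eventually_sequentially)
  show ?thesis
  proof (intro exI[of _ \<delta>] conjI \<delta> exI[of _ n0] allI impI)
    fix N Z u A B
    assume N: "n0 \<le> N" and Z: "\<bar>Z\<bar> \<le> R" and u: "\<bar>u - u0\<bar> \<le> \<delta>" and A: "A = real N * u + CA"
      and B: "B = \<alpha> * A + Z * sqrt (real N) * u0 + CB"
    note n = n0[OF N]
    have N0: "real N > 0" using n by simp
    have "\<bar>u - u0\<bar> \<le> u0 / 2" using u by (simp add: \<delta>_def)
    then have "u0 / 2 \<le> u" by linarith
    from mult_left_mono[OF this, of "real N"] have "real N * (u0 / 2) \<le> real N * u" by simp
    moreover have NC: "\<bar>CA\<bar> \<le> real N * u0 / 4" "2 * D < real N * u0 / 4" using n by (auto simp: mult.commute)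
    \<comment> \<open>Half of N u0 comes from \<open>u\<close>, and a quarter of it pays for
      \<open>CA\<close>.\<close>
    ultimately have A4: "A \<ge> real N * u0 / 4" unfolding A by linarith
    have Nu: "real N * u0 / 4 > 0" using N0 u0 by simp
    have A0: "A > 0" using A4 Nu by linarith
    show "A > 4 * (\<bar>c\<bar> + \<bar>d\<bar>)" using A4 NC(2) by (simp add: D_def)
    fix a assume a: "\<bar>a - B / A\<bar> \<le> 2 * (\<bar>c\<bar> + \<bar>d\<bar>) / A"
    let ?s = "sqrt (real N)"
    have ss: "?s * ?s = real N" by simp
    have s0: "?s > 0" using N0 by simp
    have over: "x / A \<le> 4 * x / (real N * u0)" if "x \<ge> 0" for x
    proof -
      have "x / A \<le> x / (real N * u0 / 4)" using that A4 Nu by (intro divide_left_mono) auto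
      then show ?thesis by (simp add: mult.commute)
    qed
    have sdiv: "?s * (x / (real N * u0)) = x / u0 * (1 / ?s)" for x
    proof -
      have "r * (x / (r * r * u0)) = x / u0 * (1 / r)" if "r > 0" for r
        using that u0 by (simp add: field_simps)
      from this[OF s0] show ?thesis unfolding ss .
    qed
    \<comment> \<open>An exact identity: the leading term cancels, leaving the deviation of
      \<open>A\<close> from N u0 and the constant \<open>CB\<close>.\<close>
    have BA: "?s * (B / A - \<alpha>) - Z = Z * (real N * (u0 - u) - CA) / A + ?s * CB / A"
    proof -
      have "?s * (B / A - \<alpha>) - Z = (?s * (B - \<alpha> * A) - Z * A) / A"
        using A0 by (simp add: field_simps)
      also have "?s * (B - \<alpha> * A) - Z * A = Z * ((?s * ?s) * u0 - A) + ?s * CB"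
        by (simp add: B algebra_simps)
      also have "\<dots> = Z * (real N * (u0 - u) - CA) + ?s * CB"
        unfolding ss A by (simp add: algebra_simps)
      finally show ?thesis by (simp add: add_divide_distrib)
    qed
    have t1: "\<bar>?s * (a - B / A)\<bar> \<le> 4 * D / u0 * (1 / ?s)"
    proof -
      have "\<bar>?s * (a - B / A)\<bar> = ?s * \<bar>a - B / A\<bar>" by (simp add: abs_mult)
      also have "\<dots> \<le> ?s * (D / A)" using a s0 unfolding D_def by (intro mult_left_mono) auto
      also have "\<dots> \<le> ?s * (4 * D / (real N * u0))"
        using s0 by (intro mult_left_mono over D) auto
      also have "\<dots> = 4 * D / u0 * (1 / ?s)"
        by (rule sdiv)
      finally show ?thesis .
    qed
    have t2: "\<bar>?s * CB / A\<bar> \<le> 4 * \<bar>CB\<bar> / u0 * (1 / ?s)"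
    proof -
      have "\<bar>?s * CB / A\<bar> = ?s * (\<bar>CB\<bar> / A)" using A0 s0 by (simp add: abs_mult)
      also have "\<dots> \<le> ?s * (4 * \<bar>CB\<bar> / (real N * u0))"
        using s0 by (intro mult_left_mono over) auto
      also have "\<dots> = 4 * \<bar>CB\<bar> / u0 * (1 / ?s)"
        by (rule sdiv)
      finally show ?thesis .
    qed
    have t3: "\<bar>Z * (real N * (u0 - u) - CA) / A\<bar> \<le> 4 * R * \<delta> / u0 + 4 * R * \<bar>CA\<bar> / u0 * (1 / real N)"
    proof -
      have "\<bar>real N * (u0 - u) - CA\<bar> \<le> real N * \<bar>u - u0\<bar> + \<bar>CA\<bar>"
        using N0 by (intro order_trans[OF abs_triangle_ineq4]) (simp add: abs_mult abs_minus_commute)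
      also have "\<dots> \<le> real N * \<delta> + \<bar>CA\<bar>" using u by (intro add_mono mult_left_mono) auto
      finally have "\<bar>Z\<bar> * \<bar>real N * (u0 - u) - CA\<bar> \<le> R * (real N * \<delta> + \<bar>CA\<bar>)"
        using Z R by (intro mult_mono) auto
      then have "\<bar>Z * (real N * (u0 - u) - CA) / A\<bar> \<le> R * (real N * \<delta> + \<bar>CA\<bar>) / A"
        using A0 by (simp add: abs_mult divide_right_mono)
      also have "\<dots> \<le> 4 * (R * (real N * \<delta> + \<bar>CA\<bar>)) / (real N * u0)"
        using R \<delta> by (intro over) auto
      also have "\<dots> = 4 * R * \<delta> / u0 + 4 * R * \<bar>CA\<bar> / u0 * (1 / real N)"
        using N0 u0 by (simp add: field_simps)
      finally show ?thesis .
    qed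
    have "?s * (a - \<alpha>) - Z = ?s * (a - B / A) + (?s * (B / A - \<alpha>) - Z)" by (simp add: algebra_simps)
    also have "\<dots> = ?s * (a - B / A) + (Z * (real N * (u0 - u) - CA) / A + ?s * CB / A)" unfolding BA ..
    finally have eq: "?s * (a - \<alpha>) - Z = ?s * (a - B / A) + (Z * (real N * (u0 - u) - CA) / A + ?s * CB / A)" .
    have "\<bar>w\<bar> \<le> r1 + (r3 + r2)" if "w = x + (z + y)" "\<bar>x\<bar> \<le> r1" "\<bar>y\<bar> \<le> r2" "\<bar>z\<bar> \<le> r3" for w x y z r1 r2 r3 :: real
      using that by linarith
    from this[OF eq t1 t2 t3] have "\<bar>?s * (a - \<alpha>) - Z\<bar> \<le> 4 * D / u0 * (1 / ?s) + ((4 * R * \<delta> / u0 + 4 * R * \<bar>CA\<bar> / u0 * (1 / real N)) + 4 * \<bar>CB\<bar> / u0 * (1 / ?s))" .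
    also have "\<dots> = 4 * R * \<delta> / u0 + (?K * (1 / ?s) + 4 * R * \<bar>CA\<bar> / u0 * (1 / real N))"
      by (simp add: add_divide_distrib algebra_simps)
    also have "\<dots> \<le> \<epsilon> / 2 + \<epsilon> / 2" using \<delta>R n by (intro add_mono) auto
    finally show "\<bar>?s * (a - \<alpha>) - Z\<bar> \<le> \<epsilon>" by simp
  qed
qed

text \<open>The delta method without probability: the derivative approximation is uniform over
  scaled deviations bounded by R, because the unscaled ones are at most R / sqrt N.\<close>

lemma near_theta:
  fixes \<tau> :: "real \<Rightarrow> real"
  assumes \<tau>: "(\<tau> has_real_derivative e) (at \<alpha>)" and R: "R > 0" and \<epsilon>: "\<epsilon> > 0"
  shows "\<exists>n0. \<forall>N\<ge>n0. \<forall>a. \<bar>sqrt (real N) * (a - \<alpha>)\<bar> \<le> R \<longrightarrow>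
     \<bar>sqrt (real N) * (\<tau> a - \<tau> \<alpha>) - e * (sqrt (real N) * (a - \<alpha>))\<bar> \<le> \<epsilon>"
proof -
  have "(\<tau> has_derivative (\<lambda>h. e * h)) (at \<alpha>)" using \<tau> by (simp add: has_field_derivative_def)
  then have "\<forall>r>0. \<exists>\<delta>>0. \<forall>y. norm (y - \<alpha>) < \<delta> \<longrightarrow> norm (\<tau> y - \<tau> \<alpha> - e * (y - \<alpha>)) \<le> r * norm (y - \<alpha>)"
    by (simp add: has_derivative_at_alt)
  then obtain \<delta> where \<delta>: "\<delta> > 0" "\<And>y. \<bar>y - \<alpha>\<bar> < \<delta> \<Longrightarrow> \<bar>\<tau> y - \<tau> \<alpha> - e * (y - \<alpha>)\<bar> \<le> \<epsilon> / R * \<bar>y - \<alpha>\<bar>"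
    using R \<epsilon> by (metis divide_pos_pos real_norm_def)
  have "(\<lambda>N. R * (1 / sqrt (real N))) \<longlonglongrightarrow> R * 0"
    by (intro tendsto_intros) real_asymp
  then have "eventually (\<lambda>N. R * (1 / sqrt (real N)) < \<delta>) sequentially"
    using \<delta> by (intro order_tendstoD) auto
  with eventually_gt_at_top[of 0]
  have "eventually (\<lambda>N. N > 0 \<and> R * (1 / sqrt (real N)) < \<delta>) sequentially" by eventually_elim blast
  then obtain n0 where n0: "\<And>N. N \<ge> n0 \<Longrightarrow> N > 0 \<and> R * (1 / sqrt (real N)) < \<delta>"
    by (auto simp: eventually_sequentially)
  show ?thesis
  proof (intro exI[of _ n0] allI impI)
    fix N a assume N: "n0 \<le> N" and a: "\<bar>sqrt (real N) * (a - \<alpha>)\<bar> \<le> R"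
    let ?s = "sqrt (real N)"
    have s: "?s > 0" using n0[OF N] by simp
    have abs_s: "\<bar>?s * (a - \<alpha>)\<bar> = ?s * \<bar>a - \<alpha>\<bar>" by (simp add: abs_mult)
    have "\<bar>a - \<alpha>\<bar> \<le> R * (1 / ?s)"
      using a s unfolding abs_s by (simp add: pos_le_divide_eq mult.commute)
    then have "\<bar>\<tau> a - \<tau> \<alpha> - e * (a - \<alpha>)\<bar> \<le> \<epsilon> / R * \<bar>a - \<alpha>\<bar>"
      using n0[OF N] by (intro \<delta>(2)) linarith
    then have "?s * \<bar>\<tau> a - \<tau> \<alpha> - e * (a - \<alpha>)\<bar> \<le> ?s * (\<epsilon> / R * \<bar>a - \<alpha>\<bar>)"
      using s by (intro mult_left_mono) auto
    also have "\<dots> = \<epsilon> / R * \<bar>?s * (a - \<alpha>)\<bar>" using s by (simp add: abs_mult)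
    also have "\<dots> \<le> \<epsilon> / R * R" using R \<epsilon> by (intro mult_left_mono a) auto
    finally have "?s * \<bar>\<tau> a - \<tau> \<alpha> - e * (a - \<alpha>)\<bar> \<le> \<epsilon>" using R by simp
    moreover have "?s * (\<tau> a - \<tau> \<alpha>) - e * (?s * (a - \<alpha>)) = ?s * (\<tau> a - \<tau> \<alpha> - e * (a - \<alpha>))"
      by (simp add: algebra_simps)
    ultimately show "\<bar>?s * (\<tau> a - \<tau> \<alpha>) - e * (?s * (a - \<alpha>))\<bar> \<le> \<epsilon>" using s by (simp add: abs_mult)
  qed
qed

text \<open>The source of the entries of the limiting direction in the theorem: they are these
  derivatives at \<alpha>, the factors by which an error in \<alpha> moves the outlier
  estimates.\<close>

lemma theta_of_deriv:
  "(theta_of \<mu> q y p has_real_derivative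
     ((a\<^sup>2 - 1) * (q + p) + (1 + 2 * a - a\<^sup>2) * \<mu>) / (1 + a\<^sup>2)\<^sup>2) (at a)"
proof -
  let ?s = "1 + a\<^sup>2"
  have s: "?s \<noteq> 0" by (rule one_plus_sq_pos)
  have d1: "((\<lambda>a. a / (1 + a\<^sup>2)) has_real_derivative (1 * ?s - a * (2 * a)) / (?s * ?s)) (at a)"
    using s by (auto intro!: derivative_eq_intros)
  have d2: "((\<lambda>a. (1 - a) / (1 + a\<^sup>2)) has_real_derivative (- 1 * ?s - (1 - a) * (2 * a)) / (?s * ?s)) (at a)"
    using s by (auto intro!: derivative_eq_intros)
  have "(theta_of \<mu> q y p has_real_derivative
     0 - (1 * ?s - a * (2 * a)) / (?s * ?s) * (q + p) - (- 1 * ?s - (1 - a) * (2 * a)) / (?s * ?s) * \<mu>) (at a)"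
    unfolding theta_of_def[abs_def]
    by (intro DERIV_diff DERIV_const DERIV_cmult_right d1 d2)
  moreover have "0 - (1 * ?s - a * (2 * a)) / (?s * ?s) * (q + p) - (- 1 * ?s - (1 - a) * (2 * a)) / (?s * ?s) * \<mu>
    = (- ((1 * ?s - a * (2 * a)) * (q + p)) - (- 1 * ?s - (1 - a) * (2 * a)) * \<mu>) / (?s * ?s)"
  proof -
    have "0 - u / w * x - v / w * m = (- (u * x) - v * m) / w" for u v w x m :: real
      by (simp add: diff_divide_distrib)
    then show ?thesis .
  qed
  also have "\<dots> = ((a\<^sup>2 - 1) * (q + p) + (1 + 2 * a - a\<^sup>2) * \<mu>) / ?s\<^sup>2"
    by (rule arg_cong2[where f="(/)"]) (simp_all add: power2_eq_square algebra_simps)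
  ultimately show ?thesis by simp
qed

section \<open>Limit law from a fixed initial segment\<close>

lemma nth_rev_append: "k < length l \<Longrightarrow> rev (g @ l) ! k = rev l ! k"
  by (simp add: nth_append)

lemma acc_eq_sum:
  "h \<noteq> [] \<Longrightarrow> acc d h = (\<Sum>k\<in>{1..length h - 1}. d (rev h ! (k - 1)) (rev h ! k))"
proof (induction d h rule: acc.induct)
  case (1 d y x t)
  let ?h = "x # t"
  have l: "length (y # ?h) - 1 = Suc (length t)" by simp
  have "(\<Sum>k\<in>{1..length (y # ?h) - 1}. d (rev (y # ?h) ! (k - 1)) (rev (y # ?h) ! k))
    = d (rev (y # ?h) ! length t) (rev (y # ?h) ! Suc (length t))
      + (\<Sum>k\<in>{1..length t}. d (rev (y # ?h) ! (k - 1)) (rev (y # ?h) ! k))"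
    unfolding l by (simp add: sum.cl_ivl_Suc)
  also have "(\<Sum>k\<in>{1..length t}. d (rev (y # ?h) ! (k - 1)) (rev (y # ?h) ! k))
     = (\<Sum>k\<in>{1..length t}. d (rev ?h ! (k - 1)) (rev ?h ! k))"
    by (intro sum.cong refl arg_cong2[where f=d] nth_rev_append[where g="[y]", simplified append_Cons append_Nil]) auto
  also have "d (rev (y # ?h) ! length t) (rev (y # ?h) ! Suc (length t)) = d x y"
    by (simp add: nth_append)
  finally show ?case using 1 by simp
qed auto

text \<open>Outside \<open>J\<close> neither \<open>y k\<close> nor \<open>y (k - 1)\<close> is
  contaminated, so the free sums are sums of the chain over all times minus those over
  \<open>J\<close>. The corrections involve the chain up to \<open>s2 + 1\<close> only and become
  constants once that segment is fixed.\<close>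

lemma design_sums:
  fixes x y :: "nat \<Rightarrow> real" and \<mu> \<alpha> :: real and s1 s2 n :: nat
  defines "J \<equiv> {s1, s1 + 1, s2, s2 + 1}"
  defines "A \<equiv> (\<Sum>k\<in>free_idx s1 s2 n. (y (k - 1))\<^sup>2) + (y (s1 - 1))\<^sup>2 + (y (s2 - 1))\<^sup>2"
  assumes yx: "\<forall>k. k \<noteq> s1 \<and> k \<noteq> s2 \<longrightarrow> y k = x k"
    and s: "1 \<le> s1" "s1 < s2 - 1" and n: "s2 + 1 \<le> n"
  shows "A = (\<Sum>k\<in>{1..n}. (x (k - 1))\<^sup>2) + ((x (s1 - 1))\<^sup>2 + (x (s2 - 1))\<^sup>2 - (\<Sum>k\<in>J. (x (k - 1))\<^sup>2))"
    and "(\<Sum>k\<in>free_idx s1 s2 n. y (k - 1) * (y k - \<mu>)) - \<mu> * y (s1 - 1) - \<mu> * y (s2 - 1)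
      = \<alpha> * A + (\<Sum>k\<in>{1..n}. x (k - 1) * (x k - \<alpha> * x (k - 1) - \<mu>))
        + (- (\<Sum>k\<in>J. x (k - 1) * (x k - \<alpha> * x (k - 1) - \<mu>))
           - (\<mu> + \<alpha> * x (s1 - 1)) * x (s1 - 1) - (\<mu> + \<alpha> * x (s2 - 1)) * x (s2 - 1))"
proof -
  have y: "y k = x k" if "k \<noteq> s1" "k \<noteq> s2" for k using yx that by blast
  have free: "free_idx s1 s2 n = {1..n} - J" by (simp add: free_idx_def J_def)
  have J: "J \<subseteq> {1..n}" using s n by (auto simp: J_def)
  have split: "(\<Sum>k\<in>free_idx s1 s2 n. f k) = (\<Sum>k\<in>{1..n}. f k) - (\<Sum>k\<in>J. f k)" for f :: "nat \<Rightarrow> real"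
    unfolding free by (rule sum_diff) (use J in auto)
  have q: "y (s1 - 1) = x (s1 - 1)" "y (s2 - 1) = x (s2 - 1)"
    using s by (auto intro!: y)
  have yx: "y k = x k \<and> y (k - 1) = x (k - 1)" if "k \<in> free_idx s1 s2 n" for k
    using that by (auto simp: free_idx_def intro!: y)
  have A1: "A = (\<Sum>k\<in>free_idx s1 s2 n. (x (k - 1))\<^sup>2) + (x (s1 - 1))\<^sup>2 + (x (s2 - 1))\<^sup>2"
    unfolding A_def q using yx by (intro arg_cong2[where f="(+)"] sum.cong refl) auto
  show "A = (\<Sum>k\<in>{1..n}. (x (k - 1))\<^sup>2) + ((x (s1 - 1))\<^sup>2 + (x (s2 - 1))\<^sup>2 - (\<Sum>k\<in>J. (x (k - 1))\<^sup>2))"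
    unfolding A1 split by simp
  have "(\<Sum>k\<in>free_idx s1 s2 n. y (k - 1) * (y k - \<mu>))
     = (\<Sum>k\<in>free_idx s1 s2 n. \<alpha> * (x (k - 1))\<^sup>2 + x (k - 1) * (x k - \<alpha> * x (k - 1) - \<mu>))"
    using yx by (intro sum.cong refl) (auto simp: power2_eq_square algebra_simps)
  also have "\<dots> = \<alpha> * (\<Sum>k\<in>free_idx s1 s2 n. (x (k - 1))\<^sup>2)
     + (\<Sum>k\<in>free_idx s1 s2 n. x (k - 1) * (x k - \<alpha> * x (k - 1) - \<mu>))"
    by (simp only: sum.distrib sum_distrib_left)
  also have "(\<Sum>k\<in>free_idx s1 s2 n. x (k - 1) * (x k - \<alpha> * x (k - 1) - \<mu>))
     = (\<Sum>k\<in>{1..n}. x (k - 1) * (x k - \<alpha> * x (k - 1) - \<mu>)) - (\<Sum>k\<in>J. x (k - 1) * (x k - \<alpha> * x (k - 1) - \<mu>))"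
    by (rule split)
  finally show "(\<Sum>k\<in>free_idx s1 s2 n. y (k - 1) * (y k - \<mu>)) - \<mu> * y (s1 - 1) - \<mu> * y (s2 - 1)
      = \<alpha> * A + (\<Sum>k\<in>{1..n}. x (k - 1) * (x k - \<alpha> * x (k - 1) - \<mu>))
        + (- (\<Sum>k\<in>J. x (k - 1) * (x k - \<alpha> * x (k - 1) - \<mu>))
           - (\<mu> + \<alpha> * x (s1 - 1)) * x (s1 - 1) - (\<mu> + \<alpha> * x (s2 - 1)) * x (s2 - 1))"
    unfolding A1 q by (simp add: distrib_left distrib_right power2_eq_square)
qed

definition path_Y :: "nat \<Rightarrow> nat \<Rightarrow> nat \<Rightarrow> nat \<Rightarrow> nat list \<Rightarrow> nat \<Rightarrow> real" where
  "path_Y s1 s2 \<theta>1 \<theta>2 h k = real (rev h ! k + (if k = s1 then \<theta>1 else 0) + (if k = s2 then \<theta>2 else 0))"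

text \<open>All three errors in one vector, so that a single limit along one direction serves both
  claims of the theorem.\<close>

definition scaled_error :: "real \<Rightarrow> real \<Rightarrow> nat \<Rightarrow> nat \<Rightarrow> nat \<Rightarrow> (nat \<Rightarrow> real) \<Rightarrow> real \<times> real \<times> real" where
  "scaled_error \<mu> \<alpha> s1 s2 n y =
    (sqrt (real n) * (fst (cls_est \<mu> s1 s2 n y) - \<alpha>),
     sqrt (real n) * (fst (snd (cls_est \<mu> s1 s2 n y)) - theta_of \<mu> (y (s1 - 1)) (y s1) (y (s1 + 1)) \<alpha>),
     sqrt (real n) * (snd (snd (cls_est \<mu> s1 s2 n y)) - theta_of \<mu> (y (s2 - 1)) (y s2) (y (s2 + 1)) \<alpha>))"

definition slope :: "real \<Rightarrow> real \<Rightarrow> real \<Rightarrow> real \<Rightarrow> real" where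
  "slope \<mu> \<alpha> q p = ((\<alpha>\<^sup>2 - 1) * (q + p) + (1 + 2 * \<alpha> - \<alpha>\<^sup>2) * \<mu>) / (1 + \<alpha>\<^sup>2)\<^sup>2"

lemma norm_triple_le: "norm (a :: real, b :: real, c :: real) \<le> \<bar>a\<bar> + (\<bar>b\<bar> + \<bar>c\<bar>)"
  using norm_Pair_le[of a "(b, c)"] norm_Pair_le[of b c] by simp

context inar
begin

lemma ext_suffix: "h \<in> set_pmf (ext n l) \<Longrightarrow> \<exists>g. h = g @ l \<and> length g = n"
proof (induction n arbitrary: h)
  case (Suc n)
  then obtain h' y where h: "h' \<in> set_pmf (ext n l)" "h = y # h'" by auto
  then obtain g where "h' = g @ l" "length g = n" using Suc.IH by blast
  then show ?case using h by (intro exI[of _ "y # g"]) simp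
qed simp

lemma limit_variance_nonneg: "0 \<le> sigma2_ae \<alpha> pe \<sigma>2"
proof -
  have "0 \<le> m 3" unfolding stat_moment_def by (intro integral_nonneg_AE) simp
  then show ?thesis
    using m2_pos \<sigma>2_nonneg \<alpha>_pos \<alpha>_less_1 by (simp add: sigma2_ae_def)
qed

text \<open>\<open>l\<close> lists the states at times 0 to \<open>s2 + 1\<close>, hence its length
  \<open>s2 + 2\<close>. It determines every correction constant, the centrings and the two slopes;
  only the martingale and the sum of squares remain random, and \<open>slutsky\<close> combines
  them.\<close>

theorem conditional_limit:
  fixes F :: "real \<times> real \<times> real \<Rightarrow> real" and s1 s2 \<theta>1 \<theta>2 :: nat and l :: "nat list"
  defines "e \<equiv> (1, slope \<mu> \<alpha> (rev l ! (s1 - 1)) (rev l ! (s1 + 1)), slope \<mu> \<alpha> (rev l ! (s2 - 1)) (rev l ! (s2 + 1)))"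
  assumes s: "1 \<le> s1" "s1 < s2 - 1" and l: "length l = s2 + 2"
    and F: "continuous_on UNIV F" "\<And>x. norm (F x) \<le> B"
  shows "(\<lambda>n. pexp (ext n l) (\<lambda>h. F (scaled_error \<mu> \<alpha> s1 s2 (n + (s2 + 1)) (path_Y s1 s2 \<theta>1 \<theta>2 h))))
    \<longlonglongrightarrow> (\<integral>z. F (z *\<^sub>R e) \<partial>normal_law (sigma2_ae \<alpha> pe \<sigma>2))"
proof -
  let ?s = "s2 + 1"
  have lne: "l \<noteq> []" using l by auto
  note v0 = limit_variance_nonneg
  \<comment> \<open>Division by \<open>m 2\<close> turns the martingale variance into
    \<open>sigma2_ae\<close>, whose denominator is the square of \<open>m 2\<close>.\<close>
  define Z where "Z n h = acc mart h / sqrt (real (n + ?s)) / m 2" for n h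
  define U where "U n h = acc sq h / real (n + ?s)" for n h
  define W where "W n h = scaled_error \<mu> \<alpha> s1 s2 (n + ?s) (path_Y s1 s2 \<theta>1 \<theta>2 h)" for n h
  have "(\<lambda>n. pexp (ext n l) (\<lambda>h. F (W n h))) \<longlonglongrightarrow> (\<integral>z. F (z *\<^sub>R e) \<partial>normal_law (sigma2_ae \<alpha> pe \<sigma>2))"
  proof (rule slutsky[OF real_distribution_normal_law[OF v0] _ _ _ F, where Z=Z and U=U and u="m 2"])
    fix t
    have "(\<lambda>n. pexp (ext n l) (\<lambda>h. cis (t / m 2 * (acc mart h / sqrt (real (n + ?s))))))
      \<longlonglongrightarrow> exp (complex_of_real (- ((t / m 2)\<^sup>2 / 2 * (\<alpha> * (1 - \<alpha>) * m 3 + \<sigma>2 * m 2))))"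
      by (rule martingale_clt[OF lne])
    moreover have "(t / m 2)\<^sup>2 / 2 * (\<alpha> * (1 - \<alpha>) * m 3 + \<sigma>2 * m 2) = t\<^sup>2 * sigma2_ae \<alpha> pe \<sigma>2 / 2"
      using m2_pos by (simp add: sigma2_ae_def power_divide)
    moreover have "t / m 2 * (acc mart h / sqrt (real (n + ?s))) = t * Z n h" for n h
      by (simp add: Z_def)
    ultimately show "(\<lambda>n. pexp (ext n l) (\<lambda>h. cis (t * Z n h))) \<longlonglongrightarrow> char (normal_law (sigma2_ae \<alpha> pe \<sigma>2)) t"
      by (simp only: char_normal_law[OF v0])
  next
    fix \<delta> :: real assume "\<delta> > 0"
    then show "(\<lambda>n. measure_pmf.prob (ext n l) {h. \<bar>U n h - m 2\<bar> > \<delta>}) \<longlonglongrightarrow> 0"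
      unfolding U_def by (rule prob_tendsto_0_from_char[OF square_lln[OF lne]])
  next
    fix R \<epsilon> :: real assume R: "R > 0" and \<epsilon>: "\<epsilon> > 0"
    define x where "x k = real (rev l ! k)" for k
    define yl where "yl = path_Y s1 s2 \<theta>1 \<theta>2 l"
    define J where "J = {s1, s1 + 1, s2, s2 + 1}"
    define CA where "CA = (x (s1 - 1))\<^sup>2 + (x (s2 - 1))\<^sup>2 - (\<Sum>k\<in>J. (x (k - 1))\<^sup>2)"
    define CB where "CB = - (\<Sum>k\<in>J. x (k - 1) * (x k - \<alpha> * x (k - 1) - \<mu>))
           - (\<mu> + \<alpha> * x (s1 - 1)) * x (s1 - 1) - (\<mu> + \<alpha> * x (s2 - 1)) * x (s2 - 1)"
    define c where "c = ((yl (s1 + 1) + yl (s1 - 1) - \<mu>)\<^sup>2 - \<mu>\<^sup>2) + ((yl (s2 + 1) + yl (s2 - 1) - \<mu>)\<^sup>2 - \<mu>\<^sup>2)"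
    define d where "d = 2 * \<mu> * (yl (s1 + 1) + yl (s1 - 1) - \<mu>) + 2 * \<mu> * (yl (s2 + 1) + yl (s2 - 1) - \<mu>)"
    define \<tau>1 where "\<tau>1 = theta_of \<mu> (yl (s1 - 1)) (yl s1) (yl (s1 + 1))"
    define \<tau>2 where "\<tau>2 = theta_of \<mu> (yl (s2 - 1)) (yl s2) (yl (s2 + 1))"
    define e1 where "e1 = slope \<mu> \<alpha> (rev l ! (s1 - 1)) (rev l ! (s1 + 1))"
    define e2 where "e2 = slope \<mu> \<alpha> (rev l ! (s2 - 1)) (rev l ! (s2 + 1))"
    have yx: "path_Y s1 s2 \<theta>1 \<theta>2 h k = real (rev h ! k)" if "k \<noteq> s1" "k \<noteq> s2" for h k
      using that by (simp add: path_Y_def)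
    have ylx: "yl (s1 - 1) = rev l ! (s1 - 1)" "yl (s1 + 1) = rev l ! (s1 + 1)"
      "yl (s2 - 1) = rev l ! (s2 - 1)" "yl (s2 + 1) = rev l ! (s2 + 1)"
      using s unfolding yl_def by (auto intro!: yx)
    have d1: "(\<tau>1 has_real_derivative e1) (at \<alpha>)" and d2: "(\<tau>2 has_real_derivative e2) (at \<alpha>)"
      unfolding \<tau>1_def \<tau>2_def e1_def e2_def slope_def ylx by (rule theta_of_deriv)+
    \<comment> \<open>The bound 1 keeps the scaled error of \<alpha> below R + 1, as the use of
      \<open>near_theta\<close> requires. The other bound keeps the error passed on along all three
      coordinates below \<epsilon>/2; the two delta method remainders use \<epsilon>/4 each.\<close>
    define \<epsilon>1 where "\<epsilon>1 = min 1 (\<epsilon> / (2 * (1 + \<bar>e1\<bar> + \<bar>e2\<bar>)))"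
    have \<epsilon>1: "\<epsilon>1 > 0" using \<epsilon> by (simp add: \<epsilon>1_def)
    have \<epsilon>1e: "\<epsilon>1 * (1 + \<bar>e1\<bar> + \<bar>e2\<bar>) \<le> \<epsilon> / 2"
    proof -
      have "\<epsilon>1 \<le> \<epsilon> / (2 * (1 + \<bar>e1\<bar> + \<bar>e2\<bar>))" by (simp add: \<epsilon>1_def)
      then have "\<epsilon>1 * (2 * (1 + \<bar>e1\<bar> + \<bar>e2\<bar>)) \<le> \<epsilon>"
        by (subst (asm) pos_le_divide_eq) auto
      then show ?thesis by (simp add: algebra_simps)
    qed
    have R1: "R + 1 > 0" and \<epsilon>4: "\<epsilon> / 4 > 0" using R \<epsilon> by auto
    obtain \<delta> n0 where \<delta>: "\<delta> > 0" and n0: "\<forall>N\<ge>n0. \<forall>Z u A B. \<bar>Z\<bar> \<le> R \<longrightarrow> \<bar>u - m 2\<bar> \<le> \<delta> \<longrightarrow>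
       A = real N * u + CA \<longrightarrow> B = \<alpha> * A + Z * sqrt (real N) * m 2 + CB \<longrightarrow> A > 4 * (\<bar>c\<bar> + \<bar>d\<bar>) \<and>
       (\<forall>a. \<bar>a - B / A\<bar> \<le> 2 * (\<bar>c\<bar> + \<bar>d\<bar>) / A \<longrightarrow> \<bar>sqrt (real N) * (a - \<alpha>) - Z\<bar> \<le> \<epsilon>1)"
      using near_alpha[OF m2_pos R \<epsilon>1, of CA \<alpha> CB c d] by (elim exE conjE) (rule that)
    obtain n1 where n1: "\<And>N a. N \<ge> n1 \<Longrightarrow> \<bar>sqrt (real N) * (a - \<alpha>)\<bar> \<le> R + 1 \<Longrightarrow>
       \<bar>sqrt (real N) * (\<tau>1 a - \<tau>1 \<alpha>) - e1 * (sqrt (real N) * (a - \<alpha>))\<bar> \<le> \<epsilon> / 4"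
      using near_theta[OF d1 R1 \<epsilon>4] by blast
    obtain n2 where n2: "\<And>N a. N \<ge> n2 \<Longrightarrow> \<bar>sqrt (real N) * (a - \<alpha>)\<bar> \<le> R + 1 \<Longrightarrow>
       \<bar>sqrt (real N) * (\<tau>2 a - \<tau>2 \<alpha>) - e2 * (sqrt (real N) * (a - \<alpha>))\<bar> \<le> \<epsilon> / 4"
      using near_theta[OF d2 R1 \<epsilon>4] by blast
    show "\<exists>\<delta>>0. \<exists>n0. \<forall>n\<ge>n0. \<forall>h\<in>set_pmf (ext n l). \<bar>Z n h\<bar> \<le> R \<longrightarrow> \<bar>U n h - m 2\<bar> \<le> \<delta> \<longrightarrow> norm (W n h - Z n h *\<^sub>R e) \<le> \<epsilon>"
    proof (intro exI[of _ \<delta>] conjI \<delta> exI[of _ "max 1 (max n0 (max n1 n2))"] allI ballI impI)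
      fix n h assume n: "max 1 (max n0 (max n1 n2)) \<le> n" and h: "h \<in> set_pmf (ext n l)"
        and Zh: "\<bar>Z n h\<bar> \<le> R" and Uh: "\<bar>U n h - m 2\<bar> \<le> \<delta>"
      define N where "N = n + ?s"
      have N: "N \<ge> n0" "N \<ge> n1" "N \<ge> n2" "N \<ge> s2 + 1" "real N > 0" using n by (auto simp: N_def)
      obtain g where g: "h = g @ l" "length g = n" using ext_suffix[OF h] by blast
      have hne: "h \<noteq> []" and lh: "length h - 1 = N" using g l by (auto simp: N_def)
      define y where "y = path_Y s1 s2 \<theta>1 \<theta>2 h"
      define xh where "xh k = real (rev h ! k)" for k
      have xhx: "xh k = x k" if "k \<le> s2 + 1" for k
        using that nth_rev_append[of k l g] l by (simp add: xh_def x_def g)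
      have yyl: "y k = yl k" if "k \<le> s2 + 1" for k
        using that nth_rev_append[of k l g] l by (simp add: y_def yl_def path_Y_def g)
      have yl_all: "y (s1 - 1) = yl (s1 - 1)" "y s1 = yl s1" "y (s1 + 1) = yl (s1 + 1)"
        "y (s2 - 1) = yl (s2 - 1)" "y s2 = yl s2" "y (s2 + 1) = yl (s2 + 1)"
        using s by (auto intro!: yyl)
      define A where "A = (\<Sum>k\<in>free_idx s1 s2 N. (y (k - 1))\<^sup>2) + (y (s1 - 1))\<^sup>2 + (y (s2 - 1))\<^sup>2"
      define B where "B = (\<Sum>k\<in>free_idx s1 s2 N. y (k - 1) * (y k - \<mu>)) - \<mu> * y (s1 - 1) - \<mu> * y (s2 - 1)"
      have yxh: "\<forall>k. k \<noteq> s1 \<and> k \<noteq> s2 \<longrightarrow> y k = xh k"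
        unfolding y_def xh_def using yx by blast
      note sums1 = design_sums(1)[where x=xh and y=y and n=N, OF yxh s N(4), folded J_def]
      note sums2 = design_sums(2)[where x=xh and y=y and n=N and \<mu>=\<mu> and \<alpha>=\<alpha>, OF yxh s N(4), folded J_def]
      have J: "k \<le> s2 + 1" if "k \<in> J" for k using that s by (auto simp: J_def)
      have Jx: "(\<Sum>k\<in>J. f (xh (k - 1)) (xh k)) = (\<Sum>k\<in>J. f (x (k - 1)) (x k))" for f :: "real \<Rightarrow> real \<Rightarrow> real"
        using J by (intro sum.cong refl arg_cong2[where f=f] xhx) force+
      have xs: "xh (s1 - 1) = x (s1 - 1)" "xh (s2 - 1) = x (s2 - 1)" using s by (auto intro!: xhx)
      have accsq: "acc sq h = (\<Sum>k\<in>{1..N}. (xh (k - 1))\<^sup>2)"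
        unfolding acc_eq_sum[OF hne] lh by (simp add: sq_def xh_def)
      have accm: "acc mart h = (\<Sum>k\<in>{1..N}. xh (k - 1) * (xh k - \<alpha> * xh (k - 1) - \<mu>))"
        unfolding acc_eq_sum[OF hne] lh by (simp add: mart_def xh_def)
      have A: "A = real N * U n h + CA"
      proof -
        have "A = acc sq h + CA"
          unfolding A_def sums1 accsq CA_def xs Jx[of "\<lambda>a b. a\<^sup>2"] ..
        moreover have "U n h = acc sq h / real N" by (simp only: U_def N_def)
        ultimately show ?thesis using N(5) by simp
      qed
      have B: "B = \<alpha> * A + Z n h * sqrt (real N) * m 2 + CB"
      proof -
        have "B = \<alpha> * A + acc mart h + CB"
          unfolding B_def sums2 accm CB_def xs Jx[of "\<lambda>a b. a * (b - \<alpha> * a - \<mu>)"] A_def ..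
        moreover have "Z n h = acc mart h / sqrt (real N) / m 2" by (simp only: Z_def N_def)
        ultimately show ?thesis using N(5) m2_pos by simp
      qed
      have nA: "A > 4 * (\<bar>c\<bar> + \<bar>d\<bar>)"
        and near: "\<bar>a - B / A\<bar> \<le> 2 * (\<bar>c\<bar> + \<bar>d\<bar>) / A \<Longrightarrow> \<bar>sqrt (real N) * (a - \<alpha>) - Z n h\<bar> \<le> \<epsilon>1" for a
        using n0[THEN spec, THEN mp, OF N(1), THEN spec, THEN spec, THEN spec, THEN spec,
            THEN mp, OF Zh, THEN mp, OF Uh, THEN mp, OF A, THEN mp, OF B] by blast+
      obtain a where a: "cls_est \<mu> s1 s2 N y = (a, \<tau>1 a, \<tau>2 a)" "\<bar>a - B / A\<bar> \<le> 2 * (\<bar>c\<bar> + \<bar>d\<bar>) / A"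
        using cls_est_eq[where \<mu>=\<mu> and y=y and ?s1.0=s1 and ?s2.0=s2 and n=N] nA
        unfolding A_def[symmetric] B_def[symmetric] unfolding yl_all c_def[symmetric] d_def[symmetric] \<tau>1_def[symmetric] \<tau>2_def[symmetric] by blast
      let ?r = "sqrt (real N)"
      have W1: "\<bar>?r * (a - \<alpha>) - Z n h\<bar> \<le> \<epsilon>1" by (rule near[OF a(2)])
      have "\<epsilon>1 \<le> 1" by (simp add: \<epsilon>1_def)
      then have "\<bar>?r * (a - \<alpha>)\<bar> \<le> R + 1" using W1 Zh by linarith
      note T = n1[OF N(2) this] n2[OF N(3) this]
      have T1: "\<bar>?r * (\<tau>1 a - \<tau>1 \<alpha>) - Z n h * e1\<bar> \<le> \<epsilon> / 4 + \<bar>e1\<bar> * \<epsilon>1"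
      proof -
        have "?r * (\<tau>1 a - \<tau>1 \<alpha>) - Z n h * e1 = (?r * (\<tau>1 a - \<tau>1 \<alpha>) - e1 * (?r * (a - \<alpha>))) + e1 * (?r * (a - \<alpha>) - Z n h)"
          by (simp add: algebra_simps)
        also have "\<bar>\<dots>\<bar> \<le> \<epsilon> / 4 + \<bar>e1\<bar> * \<epsilon>1"
          by (intro order_trans[OF abs_triangle_ineq] add_mono T(1)) (unfold abs_mult, intro mult_left_mono W1, simp)
        finally show ?thesis .
      qed
      have T2: "\<bar>?r * (\<tau>2 a - \<tau>2 \<alpha>) - Z n h * e2\<bar> \<le> \<epsilon> / 4 + \<bar>e2\<bar> * \<epsilon>1"
      proof -
        have "?r * (\<tau>2 a - \<tau>2 \<alpha>) - Z n h * e2 = (?r * (\<tau>2 a - \<tau>2 \<alpha>) - e2 * (?r * (a - \<alpha>))) + e2 * (?r * (a - \<alpha>) - Z n h)"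
          by (simp add: algebra_simps)
        also have "\<bar>\<dots>\<bar> \<le> \<epsilon> / 4 + \<bar>e2\<bar> * \<epsilon>1"
          by (intro order_trans[OF abs_triangle_ineq] add_mono T(2)) (unfold abs_mult, intro mult_left_mono W1, simp)
        finally show ?thesis .
      qed
      have "W n h - Z n h *\<^sub>R e = (?r * (a - \<alpha>) - Z n h, ?r * (\<tau>1 a - \<tau>1 \<alpha>) - Z n h * e1, ?r * (\<tau>2 a - \<tau>2 \<alpha>) - Z n h * e2)"
        unfolding W_def N_def[symmetric] y_def[symmetric] scaled_error_def a(1) yl_all
          \<tau>1_def[symmetric] \<tau>2_def[symmetric] e_def e1_def[symmetric] e2_def[symmetric] by simp
      also have "norm \<dots> \<le> \<bar>?r * (a - \<alpha>) - Z n h\<bar> + (\<bar>?r * (\<tau>1 a - \<tau>1 \<alpha>) - Z n h * e1\<bar> + \<bar>?r * (\<tau>2 a - \<tau>2 \<alpha>) - Z n h * e2\<bar>)"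
        by (rule norm_triple_le)
      also have "\<dots> \<le> \<epsilon>1 + ((\<epsilon> / 4 + \<bar>e1\<bar> * \<epsilon>1) + (\<epsilon> / 4 + \<bar>e2\<bar> * \<epsilon>1))"
        by (intro add_mono W1 T1 T2)
      also have "\<dots> = \<epsilon>1 * (1 + \<bar>e1\<bar> + \<bar>e2\<bar>) + \<epsilon> / 2" by (simp add: algebra_simps)
      also have "\<dots> \<le> \<epsilon>" using \<epsilon>1e by simp
      finally show "norm (W n h - Z n h *\<^sub>R e) \<le> \<epsilon>" .
    qed
  qed
  then show ?thesis by (simp add: W_def)
qed

end

section \<open>From the probability space to path laws\<close>

text \<open>Countability of one argument suffices: the map is glued from countably many sections,
  each a function of \<open>v\<close> alone.\<close>

lemma measurable_count_space_binary:
  fixes u :: "'a \<Rightarrow> 'b :: countable" and v :: "'a \<Rightarrow> 'c"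
  assumes u: "u \<in> N \<rightarrow>\<^sub>M count_space UNIV" and v: "v \<in> N \<rightarrow>\<^sub>M count_space UNIV"
  shows "(\<lambda>f. g (u f) (v f)) \<in> N \<rightarrow>\<^sub>M count_space UNIV"
  by (rule measurable_compose_countable[OF _ u, where f="\<lambda>i f. g i (v f)"])
    (rule measurable_compose[OF v], simp)

text \<open>The points of mass zero are countably many, so together they form a null set.\<close>

lemma countable_prob_space_pmf:
  fixes N :: "'b :: countable measure"
  assumes "prob_space N" and sets: "sets N = UNIV"
  obtains p where "N = measure_pmf p"
proof -
  interpret prob_space N by fact
  let ?Z = "{x. measure N {x} = 0}"
  have "(\<Union>x\<in>?Z. {x}) \<in> null_sets N"
    by (intro null_sets_UN') (auto simp: null_sets_def sets emeasure_eq_measure)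
  then have "AE x in N. measure N {x} \<noteq> 0"
    by (rule AE_I') auto
  then have "N = measure_pmf (Abs_pmf N)"
    using assms by (subst Abs_pmf_inverse) auto
  then show thesis by (rule that)
qed

lemma (in prob_space) distr_indep_pair:
  fixes U :: "'a \<Rightarrow> 'b :: countable" and V :: "'a \<Rightarrow> 'b"
  assumes ind: "indep_var (count_space UNIV) U (count_space UNIV) V"
    and U: "distr M (count_space UNIV) U = measure_pmf p" and V: "distr M (count_space UNIV) V = measure_pmf q"
  shows "distr M (count_space UNIV) (\<lambda>\<omega>. g (U \<omega>) (V \<omega>)) = measure_pmf (map_pmf (\<lambda>(u, v). g u v) (pair_pmf p q))"
proof -
  have [measurable]: "U \<in> M \<rightarrow>\<^sub>M count_space UNIV" "V \<in> M \<rightarrow>\<^sub>M count_space UNIV"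
    using ind by (auto dest: indep_var_rv1 indep_var_rv2)
  have UV [measurable]: "(\<lambda>\<omega>. (U \<omega>, V \<omega>)) \<in> M \<rightarrow>\<^sub>M count_space UNIV"
    by (rule measurable_count_space_binary[where g=Pair]) simp_all
  have "distr M (count_space UNIV) (\<lambda>\<omega>. (U \<omega>, V \<omega>)) = measure_pmf (pair_pmf p q)"
  proof (rule measure_eqI_countable[where A=UNIV])
    fix a :: "'b \<times> 'b"
    obtain u v where a: "a = (u, v)" by (cases a)
    have "measure (distr M (count_space UNIV) (\<lambda>\<omega>. (U \<omega>, V \<omega>))) {a} = prob ((\<lambda>\<omega>. (U \<omega>, V \<omega>)) -` ({u} \<times> {v}) \<inter> space M)"
      by (subst measure_distr) (auto simp: a)
    also have "\<dots> = prob (U -` {u} \<inter> space M) * prob (V -` {v} \<inter> space M)"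
      by (rule indep_varD[OF ind]) auto
    also have "prob (U -` {u} \<inter> space M) = pmf p u"
      using U by (subst measure_distr[symmetric, where N="count_space UNIV"]) (auto simp: measure_pmf_single)
    also have "prob (V -` {v} \<inter> space M) = pmf q v"
      using V by (subst measure_distr[symmetric, where N="count_space UNIV"]) (auto simp: measure_pmf_single)
    finally have 1: "measure (distr M (count_space UNIV) (\<lambda>\<omega>. (U \<omega>, V \<omega>))) {a} = measure (measure_pmf (pair_pmf p q)) {a}"
      by (simp add: a pmf_pair measure_pmf_single)
    interpret D: prob_space "distr M (count_space UNIV) (\<lambda>\<omega>. (U \<omega>, V \<omega>))"
      by (rule prob_space_distr) simp
    show "emeasure (distr M (count_space UNIV) (\<lambda>\<omega>. (U \<omega>, V \<omega>))) {a} = emeasure (measure_pmf (pair_pmf p q)) {a}"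
      using 1 by (simp add: D.emeasure_eq_measure measure_pmf.emeasure_eq_measure)
  qed auto
  from arg_cong[OF this, of "\<lambda>N. distr N (count_space UNIV) (\<lambda>(u, v). g u v)"]
  show ?thesis by (simp add: distr_distr o_def map_pmf_rep_eq)
qed

definition hist :: "('a \<Rightarrow> nat) \<Rightarrow> (nat \<Rightarrow> 'a \<Rightarrow> nat) \<Rightarrow> (nat \<Rightarrow> nat \<Rightarrow> 'a \<Rightarrow> nat) \<Rightarrow> nat \<Rightarrow> 'a \<Rightarrow> nat list" where
  "hist X0 eps xi n \<omega> = map (\<lambda>k. inar_X X0 eps xi k \<omega>) (rev [0..<Suc n])"

lemma hist_Suc: "hist X0 eps xi (Suc n) \<omega> = inar_X X0 eps xi (Suc n) \<omega> # hist X0 eps xi n \<omega>"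
  by (simp add: hist_def)

lemma hd_hist: "hd (hist X0 eps xi n \<omega>) = inar_X X0 eps xi n \<omega>"
  by (simp add: hist_def)

lemma length_hist: "length (hist X0 eps xi n \<omega>) = Suc n"
  by (simp add: hist_def)

lemma nth_hist: "k \<le> n \<Longrightarrow> rev (hist X0 eps xi n \<omega>) ! k = inar_X X0 eps xi k \<omega>"
  by (simp add: hist_def rev_map del: upt_Suc)

definition past :: "nat \<Rightarrow> inar_idx set" where
  "past n = {I0} \<union> IE ` {1..n} \<union> {IX k j | k j. 1 \<le> k \<and> k \<le> n \<and> 1 \<le> j}"

text \<open>The same recursion run on coordinate maps. It presents the chain as a measurable
  function of the independent family, so that independence of blocks of coordinates carries over to
  the chain.\<close>

definition proj_X :: "nat \<Rightarrow> (inar_idx \<Rightarrow> nat) \<Rightarrow> nat" where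
  "proj_X = inar_X (\<lambda>f. f I0) (\<lambda>k f. f (IE k)) (\<lambda>k j f. f (IX k j))"

lemma proj_X_restrict:
  "k \<le> n \<Longrightarrow> proj_X k (\<lambda>i\<in>past n. inar_family X0 eps xi i \<omega>) = inar_X X0 eps xi k \<omega>"
proof (induction k)
  case (Suc k)
  then have "Suc k \<le> n" by simp
  then show ?case using Suc unfolding proj_X_def
    by (auto simp: past_def inar_family_def intro!: arg_cong2[where f="(+)"] sum.cong)
qed (simp add: proj_X_def past_def inar_family_def)

lemma measurable_sum_nat:
  fixes u :: "nat \<Rightarrow> 'b \<Rightarrow> nat"
  assumes "\<And>j. j \<in> {1..i} \<Longrightarrow> u j \<in> N \<rightarrow>\<^sub>M count_space UNIV"
  shows "(\<lambda>f. \<Sum>j = 1..i. u j f) \<in> N \<rightarrow>\<^sub>M count_space UNIV"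
  using assms
proof (induction i)
  case (Suc i)
  have "(\<lambda>f. (\<Sum>j = 1..i. u j f) + u (Suc i) f) \<in> N \<rightarrow>\<^sub>M count_space UNIV"
    by (rule measurable_count_space_binary[where g="(+)"]; rule Suc) (auto intro: Suc.prems)
  then show ?case by simp
qed simp

lemma measurable_component_count: "i \<in> I \<Longrightarrow> (\<lambda>f. f i) \<in> PiM I (\<lambda>_. count_space UNIV) \<rightarrow>\<^sub>M count_space UNIV"
  by (rule measurable_component_singleton)

lemma measurable_proj_X:
  "k \<le> n \<Longrightarrow> proj_X k \<in> PiM (past n) (\<lambda>_. count_space UNIV) \<rightarrow>\<^sub>M count_space UNIV"
proof (induction k)
  case 0
  show ?case unfolding proj_X_def
    by (simp add: measurable_component_count past_def)
next
  case (Suc k)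
  have "(\<lambda>f. (\<Sum>j = 1..proj_X k f. f (IX (Suc k) j)) + f (IE (Suc k))) \<in> PiM (past n) (\<lambda>_. count_space UNIV) \<rightarrow>\<^sub>M count_space UNIV"
  proof (rule measurable_count_space_binary[where g="(+)"])
    show "(\<lambda>f. \<Sum>j = 1..proj_X k f. f (IX (Suc k) j)) \<in> PiM (past n) (\<lambda>_. count_space UNIV) \<rightarrow>\<^sub>M count_space UNIV"
    \<comment> \<open>The random number of summands takes countably many values, so measurability is
      checked for each fixed number.\<close>
    proof (rule measurable_compose_countable[where g="proj_X k" and f="\<lambda>i f. \<Sum>j = 1..i. f (IX (Suc k) j)"])
      show "proj_X k \<in> PiM (past n) (\<lambda>_. count_space UNIV) \<rightarrow>\<^sub>M count_space UNIV" using Suc by simp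
      show "(\<lambda>f. \<Sum>j = 1..i. f (IX (Suc k) j) :: nat) \<in> PiM (past n) (\<lambda>_. count_space UNIV) \<rightarrow>\<^sub>M count_space UNIV" for i
        using Suc.prems by (intro measurable_sum_nat measurable_component_count) (auto simp: past_def)
    qed
    show "(\<lambda>f. f (IE (Suc k)) :: nat) \<in> PiM (past n) (\<lambda>_. count_space UNIV) \<rightarrow>\<^sub>M count_space UNIV"
      using Suc.prems by (intro measurable_component_count) (auto simp: past_def)
  qed
  then show ?case by (simp add: proj_X_def[abs_def] fun_eq_iff[symmetric] cong: measurable_cong)
qed

lemma measurable_map_count:
  fixes u :: "nat \<Rightarrow> 'b \<Rightarrow> nat"
  assumes "\<And>k. k \<in> set ks \<Longrightarrow> u k \<in> N \<rightarrow>\<^sub>M count_space UNIV"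
  shows "(\<lambda>f. map (\<lambda>k. u k f) ks) \<in> N \<rightarrow>\<^sub>M count_space UNIV"
  using assms
proof (induction ks)
  case (Cons k ks)
  show ?case unfolding list.map
    by (rule measurable_count_space_binary[where g="(#)"]) (auto intro!: Cons)
qed simp

text \<open>The outlier blocks read \<open>y\<close> up to \<open>s2 + 1\<close> even when
  \<open>n\<close> is smaller, hence the maximum.\<close>

lemma cls_est_cong:
  assumes "\<And>k. k \<le> max n (s2 + 1) \<Longrightarrow> y k = y' k" "s1 < s2"
  shows "cls_est \<mu> s1 s2 n y = cls_est \<mu> s1 s2 n y'"
proof -
  have "Qn \<mu> s1 s2 n y p = Qn \<mu> s1 s2 n y' p" for p
    unfolding Qn_def using assms(2)
    by (cases p) (auto intro!: arg_cong2[where f="(+)"] sum.cong simp: assms(1))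
  then show ?thesis unfolding cls_est_def by simp
qed

lemma scaled_error_cong:
  assumes "\<And>k. k \<le> max n (s2 + 1) \<Longrightarrow> y k = y' k" "s1 < s2"
  shows "scaled_error \<mu> \<alpha> s1 s2 n y = scaled_error \<mu> \<alpha> s1 s2 n y'"
proof -
  have "y k = y' k" if "k \<in> {s1 - 1, s1, s1 + 1, s2 - 1, s2, s2 + 1}" for k
    using that assms by auto
  then show ?thesis unfolding scaled_error_def by (simp add: cls_est_cong[OF assms])
qed

section \<open>The process as a Markov chain with kernel K\<close>

locale inar_process = inar \<alpha> pe + prob_space M
  for \<alpha> :: real and pe :: "nat pmf" and M :: "'a measure" +
  fixes X0 :: "'a \<Rightarrow> nat" and eps :: "nat \<Rightarrow> 'a \<Rightarrow> nat" and xi :: "nat \<Rightarrow> nat \<Rightarrow> 'a \<Rightarrow> nat"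
  assumes indep: "indep_vars (\<lambda>_. count_space UNIV) (inar_family X0 eps xi) inar_index_set"
    and eps_law: "\<And>k. 1 \<le> k \<Longrightarrow> distr M (count_space UNIV) (eps k) = measure_pmf pe"
    and xi_law: "\<And>k j. 1 \<le> k \<Longrightarrow> 1 \<le> j \<Longrightarrow>
           distr M (count_space UNIV) (xi k j) = measure_pmf (map_pmf of_bool (bernoulli_pmf \<alpha>))"
begin

abbreviation X where "X \<equiv> inar_X X0 eps xi"
abbreviation H where "H \<equiv> hist X0 eps xi"

lemma indep_composed:
  assumes "A \<inter> B = {}" "A \<subseteq> inar_index_set" "B \<subseteq> inar_index_set"
    and "f \<in> PiM A (\<lambda>_. count_space UNIV) \<rightarrow>\<^sub>M N1" "g \<in> PiM B (\<lambda>_. count_space UNIV) \<rightarrow>\<^sub>M N2"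
  shows "indep_var N1 (\<lambda>\<omega>. f (\<lambda>i\<in>A. inar_family X0 eps xi i \<omega>)) N2 (\<lambda>\<omega>. g (\<lambda>i\<in>B. inar_family X0 eps xi i \<omega>))"
  using indep_var_compose[OF indep_var_restrict[OF indep assms(1-3)] assms(4,5)] by (simp add: o_def)

lemma survivors_law:
  assumes k: "1 \<le> k"
  shows "distr M (count_space UNIV) (\<lambda>\<omega>. \<Sum>j = 1..x. xi k j \<omega>) = measure_pmf (binomial_pmf x \<alpha>)"
proof (induction x)
  case 0
  have "distr M (count_space UNIV) (\<lambda>\<omega>. 0) = return (count_space UNIV) (0::nat)"
    by (rule distr_const) simp
  then show ?case by (simp add: binomial_pmf_0 return_pmf.rep_eq)
next
  case (Suc x)
  let ?A = "{IX k j | j. 1 \<le> j \<and> j \<le> x}" and ?B = "{IX k (Suc x)}"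
  have "indep_var (count_space UNIV) (\<lambda>\<omega>. (\<lambda>f. \<Sum>j = 1..x. f (IX k j)) (\<lambda>i\<in>?A. inar_family X0 eps xi i \<omega>))
     (count_space UNIV) (\<lambda>\<omega>. (\<lambda>f. f (IX k (Suc x))) (\<lambda>i\<in>?B. inar_family X0 eps xi i \<omega>))"
    by (rule indep_composed)
      (use k in \<open>auto simp: inar_index_set_def intro!: measurable_sum_nat measurable_component_count\<close>)
  moreover have "(\<Sum>j = 1..x. (\<lambda>i\<in>?A. inar_family X0 eps xi i \<omega>) (IX k j)) = (\<Sum>j = 1..x. xi k j \<omega>)" for \<omega>
    by (intro sum.cong) (auto simp: inar_family_def)
  moreover have "(\<lambda>i\<in>?B. inar_family X0 eps xi i \<omega>) (IX k (Suc x)) = xi k (Suc x) \<omega>" for \<omega>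
    by (simp add: inar_family_def)
  ultimately have "indep_var (count_space UNIV) (\<lambda>\<omega>. \<Sum>j = 1..x. xi k j \<omega>) (count_space UNIV) (xi k (Suc x))"
    by simp
  from distr_indep_pair[OF this Suc xi_law, of "(+)"] k
  have "distr M (count_space UNIV) (\<lambda>\<omega>. \<Sum>j = 1..Suc x. xi k j \<omega>)
     = measure_pmf (map_pmf (\<lambda>(u, v). u + v) (pair_pmf (binomial_pmf x \<alpha>) (map_pmf of_bool (bernoulli_pmf \<alpha>))))"
    by simp
  also have "map_pmf (\<lambda>(u, v). u + v) (pair_pmf (binomial_pmf x \<alpha>) (map_pmf of_bool (bernoulli_pmf \<alpha>)))
     = bind_pmf (binomial_pmf x \<alpha>) (\<lambda>u. bind_pmf (bernoulli_pmf \<alpha>) (\<lambda>b. return_pmf ((if b then 1 else 0) + u)))"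
    by (simp add: pair_pmf_def map_bind_pmf map_pmf_def bind_assoc_pmf bind_return_pmf of_bool_def add.commute cong: if_cong)
  also have "\<dots> = binomial_pmf (Suc x) \<alpha>"
    by (subst bind_commute_pmf) (simp add: binomial_pmf_Suc)
  finally show ?case .
qed

text \<open>The number \<open>x\<close> of individuals is still deterministic here; the random
  current state is inserted in \<open>path_law_Suc\<close>.\<close>

lemma step_law:
  assumes k: "1 \<le> k"
  shows "distr M (count_space UNIV) (\<lambda>\<omega>. (\<Sum>j = 1..x. xi k j \<omega>) + eps k \<omega>) = measure_pmf (K x)"
proof -
  let ?A = "{IX k j | j. 1 \<le> j \<and> j \<le> x}" and ?B = "{IE k}"
  have "indep_var (count_space UNIV) (\<lambda>\<omega>. (\<lambda>f. \<Sum>j = 1..x. f (IX k j)) (\<lambda>i\<in>?A. inar_family X0 eps xi i \<omega>))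
     (count_space UNIV) (\<lambda>\<omega>. (\<lambda>f. f (IE k)) (\<lambda>i\<in>?B. inar_family X0 eps xi i \<omega>))"
    by (rule indep_composed)
      (use k in \<open>auto simp: inar_index_set_def intro!: measurable_sum_nat measurable_component_count\<close>)
  moreover have "(\<Sum>j = 1..x. (\<lambda>i\<in>?A. inar_family X0 eps xi i \<omega>) (IX k j)) = (\<Sum>j = 1..x. xi k j \<omega>)" for \<omega>
    by (intro sum.cong) (auto simp: inar_family_def)
  moreover have "(\<lambda>i\<in>?B. inar_family X0 eps xi i \<omega>) (IE k) = eps k \<omega>" for \<omega>
    by (simp add: inar_family_def)
  ultimately have "indep_var (count_space UNIV) (\<lambda>\<omega>. \<Sum>j = 1..x. xi k j \<omega>) (count_space UNIV) (eps k)"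
    by simp
  from distr_indep_pair[OF this survivors_law eps_law, of "(+)"] k
  show ?thesis
    by (simp add: inar_kernel_def pair_pmf_def map_bind_pmf map_pmf_def bind_assoc_pmf bind_return_pmf)
qed

lemma past_subset: "past n \<subseteq> inar_index_set"
  by (auto simp: past_def inar_index_set_def)

text \<open>The history uses coordinates up to time n, the candidate next state only those of time n
  + 1. The next state is wrapped in a list because both variables in \<open>indep_var\<close> share
  one value type.\<close>

lemma indep_future:
  "indep_var (count_space UNIV) (H n) (count_space UNIV) (\<lambda>\<omega>. [(\<Sum>j = 1..x. xi (Suc n) j \<omega>) + eps (Suc n) \<omega>])"
proof -
  let ?B = "insert (IE (Suc n)) {IX (Suc n) j | j. 1 \<le> j \<and> j \<le> x}"
  have "indep_var (count_space UNIV) (\<lambda>\<omega>. (\<lambda>f. map (\<lambda>k. proj_X k f) (rev [0..<Suc n])) (\<lambda>i\<in>past n. inar_family X0 eps xi i \<omega>))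
     (count_space UNIV) (\<lambda>\<omega>. (\<lambda>f. [(\<Sum>j = 1..x. f (IX (Suc n) j)) + f (IE (Suc n))]) (\<lambda>i\<in>?B. inar_family X0 eps xi i \<omega>))"
  proof (rule indep_composed[OF _ past_subset])
    show "past n \<inter> ?B = {}" by (auto simp: past_def)
    show "?B \<subseteq> inar_index_set" by (auto simp: inar_index_set_def)
    show "(\<lambda>f. map (\<lambda>k. proj_X k f) (rev [0..<Suc n])) \<in> PiM (past n) (\<lambda>_. count_space UNIV) \<rightarrow>\<^sub>M count_space UNIV"
      by (intro measurable_map_count measurable_proj_X) auto
    have "(\<lambda>f. (\<Sum>j = 1..x. f (IX (Suc n) j)) + f (IE (Suc n)) :: nat) \<in> PiM ?B (\<lambda>_. count_space UNIV) \<rightarrow>\<^sub>M count_space UNIV"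
      by (rule measurable_count_space_binary[where g="(+)"]; intro measurable_sum_nat measurable_component_count) auto
    then show "(\<lambda>f. [(\<Sum>j = 1..x. f (IX (Suc n) j)) + f (IE (Suc n)) :: nat]) \<in> PiM ?B (\<lambda>_. count_space UNIV) \<rightarrow>\<^sub>M count_space UNIV"
      by (rule measurable_compose) simp
  qed
  moreover have "map (\<lambda>k. proj_X k (\<lambda>i\<in>past n. inar_family X0 eps xi i \<omega>)) (rev [0..<Suc n]) = H n \<omega>" for \<omega>
    unfolding hist_def by (intro map_cong refl proj_X_restrict) auto
  moreover have "(\<Sum>j = 1..x. (\<lambda>i\<in>?B. inar_family X0 eps xi i \<omega>) (IX (Suc n) j)) = (\<Sum>j = 1..x. xi (Suc n) j \<omega>)" for \<omega>
    by (intro sum.cong) (auto simp: inar_family_def)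
  moreover have "(\<lambda>i\<in>?B. inar_family X0 eps xi i \<omega>) (IE (Suc n)) = eps (Suc n) \<omega>" for \<omega>
    by (simp add: inar_family_def)
  ultimately show ?thesis by simp
qed

lemma measurable_H [measurable]: "H n \<in> M \<rightarrow>\<^sub>M count_space UNIV"
  using indep_var_rv1[OF indep_future[of n 0]] .

definition path_law :: "nat \<Rightarrow> nat list pmf" where
  "path_law n = (SOME p. distr M (count_space UNIV) (H n) = measure_pmf p)"

lemma path_law: "distr M (count_space UNIV) (H n) = measure_pmf (path_law n)"
proof -
  have "prob_space (distr M (count_space UNIV) (H n))" by (rule prob_space_distr) simp
  then obtain p where "distr M (count_space UNIV) (H n) = measure_pmf p"
    by (rule countable_prob_space_pmf) simp
  then show ?thesis unfolding path_law_def by (rule someI)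
qed

lemma pmf_path_law: "pmf (path_law n) l = prob (H n -` {l} \<inter> space M)"
proof -
  have "pmf (path_law n) l = measure (distr M (count_space UNIV) (H n)) {l}"
    by (simp add: path_law measure_pmf_single)
  then show ?thesis by (simp add: measure_distr)
qed

text \<open>The Markov property on path level. On the event that the history is \<open>l\<close>,
  the random number of summands is the constant \<open>hd l\<close>, so the new state may be
  replaced by a variable independent of the history.\<close>

lemma path_law_Suc: "path_law (Suc n) = bind_pmf (path_law n) (\<lambda>h. map_pmf (\<lambda>y. y # h) (K (hd h)))"
proof (rule pmf_eqI)
  fix a :: "nat list"
  show "pmf (path_law (Suc n)) a = pmf (bind_pmf (path_law n) (\<lambda>h. map_pmf (\<lambda>y. y # h) (K (hd h)))) a"
  proof (cases a)
    case Nil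
    have "pmf (map_pmf (\<lambda>y. y # h) (K (hd h))) [] = 0" for h :: "nat list"
      by (auto simp: pmf_eq_0_set_pmf)
    moreover have "H (Suc n) -` {[]} \<inter> space M = {}" by (auto simp: hist_Suc)
    ultimately show ?thesis unfolding Nil pmf_bind pmf_path_law by simp
  next
    case (Cons y l)
    let ?V = "\<lambda>\<omega>. (\<Sum>j = 1..hd l. xi (Suc n) j \<omega>) + eps (Suc n) \<omega>"
    have "pmf (path_law (Suc n)) a = prob ((\<lambda>\<omega>. (H n \<omega>, [?V \<omega>])) -` ({l} \<times> {[y]}) \<inter> space M)"
      unfolding pmf_path_law Cons by (rule arg_cong[where f=prob]) (auto simp: hist_Suc hd_hist)
    also have "\<dots> = prob (H n -` {l} \<inter> space M) * prob ((\<lambda>\<omega>. [?V \<omega>]) -` {[y]} \<inter> space M)"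
      by (rule indep_varD[OF indep_future]) auto
    also have "prob ((\<lambda>\<omega>. [?V \<omega>]) -` {[y]} \<inter> space M) = pmf (K (hd l)) y"
    proof -
      have "(\<lambda>\<omega>. hd [?V \<omega>]) \<in> M \<rightarrow>\<^sub>M count_space UNIV"
        by (rule measurable_compose[OF indep_var_rv2[OF indep_future[of n "hd l"]]]) simp
      then have "measure (distr M (count_space UNIV) ?V) {y} = prob ((\<lambda>\<omega>. [?V \<omega>]) -` {[y]} \<inter> space M)"
        by (subst measure_distr) (auto intro!: arg_cong[where f=prob])
      then have "prob ((\<lambda>\<omega>. [?V \<omega>]) -` {[y]} \<inter> space M) = measure (distr M (count_space UNIV) ?V) {y}" ..
      then show ?thesis by (simp only: step_law measure_pmf_single le_add1 Suc_eq_plus1_left)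
    qed
    also have "prob (H n -` {l} \<inter> space M) * pmf (K (hd l)) y = pexp (path_law n) (\<lambda>h. indicator {l} h * pmf (K (hd l)) y)"
      by (simp add: pmf_path_law measure_pmf_single)
    also have "\<dots> = pexp (path_law n) (\<lambda>h. pmf (map_pmf (\<lambda>y. y # h) (K (hd h))) (y # l))"
    proof (rule arg_cong[where f="pexp (path_law n)"], rule ext)
      fix h
      show "indicator {l} h * pmf (K (hd l)) y = pmf (map_pmf (\<lambda>y. y # h) (K (hd h))) (y # l)"
      proof (cases "h = l")
        case True
        then show ?thesis
          using pmf_map_inj'[of "\<lambda>y. y # l" "K (hd l)" y] by (simp add: inj_def)
      next
        case False
        then have "pmf (map_pmf (\<lambda>y. y # h) (K (hd h))) (y # l) = 0"
          by (auto simp: pmf_eq_0_set_pmf)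
        then show ?thesis using False by simp
      qed
    qed
    finally show ?thesis by (simp add: pmf_bind Cons)
  qed
qed

lemma path_law_ext: "path_law (s + n) = bind_pmf (path_law s) (ext n)"
proof (induction n)
  case 0
  have "ext 0 = return_pmf" by auto
  then show ?case by (simp add: bind_return_pmf')
next
  case (Suc n)
  have "ext (Suc n) = (\<lambda>l. bind_pmf (ext n l) (\<lambda>h. map_pmf (\<lambda>y. y # h) (K (hd h))))" by auto
  then show ?case using Suc by (simp only: add_Suc_right path_law_Suc bind_assoc_pmf)
qed

lemma length_path_law: "h \<in> set_pmf (path_law n) \<Longrightarrow> length h = Suc n"
proof (rule ccontr)
  assume h: "h \<in> set_pmf (path_law n)" and "length h \<noteq> Suc n"
  then have "H n -` {h} \<inter> space M = {}" by (auto simp: length_hist)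
  then show False using h by (simp add: set_pmf_iff pmf_path_law)
qed

lemma expectation_path:
  fixes f :: "nat list \<Rightarrow> real"
  assumes B: "\<And>h. norm (f h) \<le> B"
  shows "expectation (\<lambda>\<omega>. f (H (s + n) \<omega>)) = pexp (path_law s) (\<lambda>l. pexp (ext n l) f)"
proof -
  have "expectation (\<lambda>\<omega>. f (H (s + n) \<omega>)) = integral\<^sup>L (distr M (count_space UNIV) (H (s + n))) f"
    by (subst integral_distr) auto
  also have "\<dots> = pexp (bind_pmf (path_law s) (ext n)) f"
    by (simp only: path_law path_law_ext)
  also have "\<dots> = pexp (path_law s) (\<lambda>l. pexp (ext n l) f)"
    by (rule integral_bind_pmf_bounded[OF B])
  finally show ?thesis .
qed

end

section \<open>Limit theorems\<close>

lemma drop_hist: "drop n (hist X0 eps xi (s + n) \<omega>) = hist X0 eps xi s \<omega>"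
  by (induction n) (simp_all add: hist_Suc)

lemma integral_uniform_measure:
  fixes f :: "'a \<Rightarrow> real"
  assumes "prob_space M" and A: "A \<in> sets M" "measure M A > 0" and f: "f \<in> borel_measurable M"
  shows "integral\<^sup>L (uniform_measure M A) f = (\<integral>x. indicator A x * f x \<partial>M) / measure M A"
proof -
  interpret prob_space M by fact
  have "uniform_measure M A = density M (\<lambda>x. ennreal (indicator A x / measure M A))"
    unfolding uniform_measure_def
  proof (rule arg_cong[where f="density M"], rule ext)
    fix x
    show "indicator A x / emeasure M A = ennreal (indicator A x / measure M A)"
      using A(2) by (auto simp: emeasure_eq_measure divide_ennreal[symmetric] split: split_indicator)
  qed
  then have "integral\<^sup>L (uniform_measure M A) f = (\<integral>x. (indicator A x / measure M A) *\<^sub>R f x \<partial>M)"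
    using A f by (simp only:) (subst integral_density, auto)
  then show ?thesis by simp
qed

context inar_process
begin

abbreviation Yr :: "nat \<Rightarrow> nat \<Rightarrow> nat \<Rightarrow> nat \<Rightarrow> 'a \<Rightarrow> nat \<Rightarrow> real" where
  "Yr s1 s2 \<theta>1 \<theta>2 \<omega> \<equiv> (\<lambda>k. real (inar_Y X0 eps xi s1 s2 \<theta>1 \<theta>2 k \<omega>))"

lemma path_Y_H: "k \<le> n \<Longrightarrow> path_Y s1 s2 \<theta>1 \<theta>2 (H n \<omega>) k = Yr s1 s2 \<theta>1 \<theta>2 \<omega> k"
  by (simp add: path_Y_def inar_Y_def nth_hist)

lemma scaled_error_H:
  assumes "s1 < s2" "max n (s2 + 1) \<le> j"
  shows "scaled_error \<mu> \<alpha> s1 s2 n (path_Y s1 s2 \<theta>1 \<theta>2 (H j \<omega>)) = scaled_error \<mu> \<alpha> s1 s2 n (Yr s1 s2 \<theta>1 \<theta>2 \<omega>)"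
  by (rule scaled_error_cong) (use assms in \<open>auto intro!: path_Y_H\<close>)

lemma measurable_scaled_error:
  assumes "s1 < s2"
  shows "(\<lambda>\<omega>. scaled_error \<mu> \<alpha> s1 s2 n (Yr s1 s2 \<theta>1 \<theta>2 \<omega>)) \<in> borel_measurable M"
proof -
  have "(\<lambda>\<omega>. scaled_error \<mu> \<alpha> s1 s2 n (path_Y s1 s2 \<theta>1 \<theta>2 (H (max n (s2 + 1)) \<omega>))) \<in> borel_measurable M"
    by (rule measurable_compose[OF measurable_H]) simp
  then show ?thesis by (simp only: scaled_error_H[OF assms order_refl])
qed

text \<open>\<open>A\<close> is a set of initial segments on which the limit functional has a common
  value \<open>c\<close>, so dominated convergence over the segments gives the mass of
  \<open>A\<close> times \<open>c\<close>. The index is shifted by \<open>s2 + 1\<close> so that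
  every path contains its initial segment.\<close>

lemma restricted_limit:
  fixes F :: "real \<times> real \<times> real \<Rightarrow> real" and s1 s2 \<theta>1 \<theta>2 :: nat
  assumes s: "1 \<le> s1" "s1 < s2 - 1"
    and F: "continuous_on UNIV F" "\<And>x. norm (F x) \<le> B"
    and c: "\<And>l. l \<in> A \<Longrightarrow> length l = s2 + 2 \<Longrightarrow>
      (\<integral>z. F (z *\<^sub>R (1, slope \<mu> \<alpha> (real (rev l ! (s1 - 1))) (real (rev l ! (s1 + 1))),
          slope \<mu> \<alpha> (real (rev l ! (s2 - 1))) (real (rev l ! (s2 + 1)))))
        \<partial>normal_law (sigma2_ae \<alpha> pe \<sigma>2)) = c"
  shows "(\<lambda>n. expectation (\<lambda>\<omega>. indicator A (H (s2 + 1) \<omega>) * F (scaled_error \<mu> \<alpha> s1 s2 n (Yr s1 s2 \<theta>1 \<theta>2 \<omega>))))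
    \<longlonglongrightarrow> prob {\<omega> \<in> space M. H (s2 + 1) \<omega> \<in> A} * c"
proof (rule LIMSEQ_offset[where k="s2 + 1"])
  have s12: "s1 < s2" using s by simp
  have B0: "0 \<le> B" using F(2) norm_ge_zero order_trans by blast
  let ?W = "\<lambda>n h. scaled_error \<mu> \<alpha> s1 s2 (n + (s2 + 1)) (path_Y s1 s2 \<theta>1 \<theta>2 h)"
  have eq: "expectation (\<lambda>\<omega>. indicator A (H (s2 + 1) \<omega>) * F (scaled_error \<mu> \<alpha> s1 s2 (n + (s2 + 1)) (Yr s1 s2 \<theta>1 \<theta>2 \<omega>)))
    = pexp (path_law (s2 + 1)) (\<lambda>l. indicator A l * pexp (ext n l) (\<lambda>h. F (?W n h)))" for n
  proof -
    \<comment> \<open>\<open>drop n\<close> recovers the initial segment from the extended path, so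
      both factors become functions of a single history.\<close>
    let ?f = "\<lambda>h. indicator A (drop n h) * F (?W n h)"
    have b: "norm (?f h) \<le> B" for h using F(2)[of "?W n h"] B0 by (auto split: split_indicator)
    have le: "max (n + (s2 + 1)) (s2 + 1) \<le> s2 + 1 + n" by simp
    have "expectation (\<lambda>\<omega>. indicator A (H (s2 + 1) \<omega>) * F (scaled_error \<mu> \<alpha> s1 s2 (n + (s2 + 1)) (Yr s1 s2 \<theta>1 \<theta>2 \<omega>)))
      = expectation (\<lambda>\<omega>. ?f (H (s2 + 1 + n) \<omega>))"
      by (simp only: scaled_error_H[OF s12 le] drop_hist)
    also have "\<dots> = pexp (path_law (s2 + 1)) (\<lambda>l. pexp (ext n l) ?f)"
      by (rule expectation_path[OF b])
    also have "\<dots> = pexp (path_law (s2 + 1)) (\<lambda>l. indicator A l * pexp (ext n l) (\<lambda>h. F (?W n h)))"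
    proof (rule arg_cong[where f="pexp (path_law (s2 + 1))"], rule ext)
      fix l
      have "pexp (ext n l) ?f = pexp (ext n l) (\<lambda>h. indicator A l * F (?W n h))"
        by (intro integral_cong_AE AE_pmfI) (auto dest: ext_suffix)
      then show "pexp (ext n l) ?f = indicator A l * pexp (ext n l) (\<lambda>h. F (?W n h))"
        by simp
    qed
    finally show ?thesis .
  qed
  have "(\<lambda>n. pexp (path_law (s2 + 1)) (\<lambda>l. indicator A l * pexp (ext n l) (\<lambda>h. F (?W n h))))
    \<longlonglongrightarrow> pexp (path_law (s2 + 1)) (\<lambda>l. indicator A l * c)"
  proof (rule integral_dominated_convergence[where w="\<lambda>_. B"])
    show "AE l in path_law (s2 + 1). (\<lambda>n. indicator A l * pexp (ext n l) (\<lambda>h. F (?W n h))) \<longlonglongrightarrow> indicator A l * c"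
    proof (rule AE_pmfI)
      fix l assume "l \<in> set_pmf (path_law (s2 + 1))"
      then have l: "length l = s2 + 2" using length_path_law by fastforce
      show "(\<lambda>n. indicator A l * pexp (ext n l) (\<lambda>h. F (?W n h))) \<longlonglongrightarrow> indicator A l * c"
      proof (cases "l \<in> A")
        case True
        show ?thesis
          using conditional_limit[OF s l F, of \<theta>1 \<theta>2] c[OF True l] by (intro tendsto_mult_left) simp
      qed simp
    qed
    show "AE l in path_law (s2 + 1). norm (indicator A l * pexp (ext n l) (\<lambda>h. F (?W n h))) \<le> B" for n
    proof (rule AE_pmfI)
      fix l
      have "norm (pexp (ext n l) (\<lambda>h. F (?W n h))) \<le> B"
        by (rule norm_expectation_le[OF F(2)])
      then show "norm (indicator A l * pexp (ext n l) (\<lambda>h. F (?W n h))) \<le> B"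
        using B0 by (auto split: split_indicator)
    qed
  qed auto
  moreover have "pexp (path_law (s2 + 1)) (\<lambda>l. indicator A l * c) = prob {\<omega> \<in> space M. H (s2 + 1) \<omega> \<in> A} * c"
  proof -
    have "pexp (path_law (s2 + 1)) (\<lambda>l. indicator A l * c) = measure (distr M (count_space UNIV) (H (s2 + 1))) A * c"
      by (simp add: path_law)
    also have "measure (distr M (count_space UNIV) (H (s2 + 1))) A = prob {\<omega> \<in> space M. H (s2 + 1) \<omega> \<in> A}"
      by (subst measure_distr) (auto intro!: arg_cong[where f=prob])
    finally show ?thesis .
  qed
  ultimately show "(\<lambda>n. expectation (\<lambda>\<omega>. indicator A (H (s2 + 1) \<omega>) * F (scaled_error \<mu> \<alpha> s1 s2 (n + (s2 + 1)) (Yr s1 s2 \<theta>1 \<theta>2 \<omega>))))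
    \<longlonglongrightarrow> prob {\<omega> \<in> space M. H (s2 + 1) \<omega> \<in> A} * c"
    by (simp only: eq)
qed

text \<open>The first coordinate of the limiting direction is 1 for every segment, so no restriction
  on the segments is needed and \<open>A\<close> may be the whole space.\<close>

theorem alpha_limit:
  assumes s: "1 \<le> s1" "s1 < s2 - 1"
  shows "weak_conv_m (\<lambda>n. distr M borel (\<lambda>\<omega>. fst (scaled_error \<mu> \<alpha> s1 s2 n (Yr s1 s2 \<theta>1 \<theta>2 \<omega>))))
     (normal_law (sigma2_ae \<alpha> pe \<sigma>2))"
proof -
  let ?\<nu> = "normal_law (sigma2_ae \<alpha> pe \<sigma>2)"
  let ?T = "\<lambda>n \<omega>. fst (scaled_error \<mu> \<alpha> s1 s2 n (Yr s1 s2 \<theta>1 \<theta>2 \<omega>))"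
  have rd\<nu>: "real_distribution ?\<nu>" by (rule real_distribution_normal_law[OF limit_variance_nonneg])
  interpret \<nu>: real_distribution ?\<nu> by (rule rd\<nu>)
  have s12: "s1 < s2" using s by simp
  have meas [measurable]: "?T n \<in> borel_measurable M" for n
    by (rule measurable_compose[OF measurable_scaled_error[OF s12]])
      (intro borel_measurable_continuous_onI continuous_intros)
  show ?thesis
  proof (rule levy_continuity[OF _ rd\<nu>])
    show "real_distribution (distr M borel (?T n))" for n
      by (rule real_distribution_distr) (rule meas)
    fix t
    have part: "(\<lambda>n. expectation (\<lambda>\<omega>. f (t * ?T n \<omega>))) \<longlonglongrightarrow> (\<integral>z. f (t * z) \<partial>?\<nu>)"
      if f: "continuous_on UNIV f" "\<And>x. \<bar>f x\<bar> \<le> 1" for f :: "real \<Rightarrow> real"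
    proof -
      have "(\<lambda>n. expectation (\<lambda>\<omega>. indicator UNIV (H (s2 + 1) \<omega>) * (\<lambda>w. f (t * fst w)) (scaled_error \<mu> \<alpha> s1 s2 n (Yr s1 s2 \<theta>1 \<theta>2 \<omega>))))
        \<longlonglongrightarrow> prob {\<omega> \<in> space M. H (s2 + 1) \<omega> \<in> UNIV} * (\<integral>z. f (t * z) \<partial>?\<nu>)"
        by (rule restricted_limit[OF s, where B=1])
          (auto intro!: continuous_on_compose2[OF f(1)] continuous_intros f(2))
      then show ?thesis by (simp add: prob_space)
    qed
    \<comment> \<open>\<open>restricted_limit\<close> concerns real test functions, so the
      characteristic function is treated through its cosine and sine parts.\<close>
    have split: "(\<integral>x. iexp (t * g x) \<partial>N) = complex_of_real (\<integral>x. cos (t * g x) \<partial>N) + \<i> * complex_of_real (\<integral>x. sin (t * g x) \<partial>N)"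
      if "prob_space N" and [measurable]: "g \<in> borel_measurable N" for N :: "'z measure" and g
    proof -
      interpret N: prob_space N by fact
      have int: "integrable N (\<lambda>x. complex_of_real (cos (t * g x)))" "integrable N (\<lambda>x. complex_of_real (sin (t * g x)))"
        by (auto intro!: N.integrable_const_bound[where B=1])
      have "(\<integral>x. iexp (t * g x) \<partial>N) = (\<integral>x. complex_of_real (cos (t * g x)) + \<i> * complex_of_real (sin (t * g x)) \<partial>N)"
        by (intro Bochner_Integration.integral_cong refl) (simp only: cis_conv_exp[symmetric], simp add: complex_eq_iff)
      also have "\<dots> = (\<integral>x. complex_of_real (cos (t * g x)) \<partial>N) + \<i> * (\<integral>x. complex_of_real (sin (t * g x)) \<partial>N)"
        using int by simp
      finally show ?thesis by (simp only: integral_complex_of_real)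
    qed
    have "char (distr M borel (?T n)) t = complex_of_real (expectation (\<lambda>\<omega>. cos (t * ?T n \<omega>))) + \<i> * complex_of_real (expectation (\<lambda>\<omega>. sin (t * ?T n \<omega>)))" for n
      unfolding char_def by (subst integral_distr) (auto simp: split[OF prob_space_axioms meas, simplified])
    moreover have "char ?\<nu> t = complex_of_real (\<integral>z. cos (t * z) \<partial>?\<nu>) + \<i> * complex_of_real (\<integral>z. sin (t * z) \<partial>?\<nu>)"
      unfolding char_def using split[OF \<nu>.prob_space_axioms, of "\<lambda>z. z"] by simp
    moreover have "(\<lambda>n. complex_of_real (expectation (\<lambda>\<omega>. cos (t * ?T n \<omega>))) + \<i> * complex_of_real (expectation (\<lambda>\<omega>. sin (t * ?T n \<omega>))))
      \<longlonglongrightarrow> complex_of_real (\<integral>z. cos (t * z) \<partial>?\<nu>) + \<i> * complex_of_real (\<integral>z. sin (t * z) \<partial>?\<nu>)"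
      by (intro tendsto_intros part) (auto intro!: continuous_intros)
    ultimately show "(\<lambda>n. char (distr M borel (?T n)) t) \<longlonglongrightarrow> char ?\<nu> t" by simp
  qed
qed

theorem theta_limit:
  fixes s1 s2 \<theta>1 \<theta>2 m1 m2 m3 m4 :: nat
  defines "D \<equiv> {\<omega> \<in> space M. (inar_Y X0 eps xi s1 s2 \<theta>1 \<theta>2 (s1 - 1) \<omega>, inar_Y X0 eps xi s1 s2 \<theta>1 \<theta>2 (s2 - 1) \<omega>,
               inar_Y X0 eps xi s1 s2 \<theta>1 \<theta>2 (s1 + 1) \<omega>, inar_Y X0 eps xi s1 s2 \<theta>1 \<theta>2 (s2 + 1) \<omega>) = (m1, m2, m3, m4)}"
  assumes s: "1 \<le> s1" "s1 < s2 - 1" and D: "0 < prob D"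
  shows "weak_conv2 (\<lambda>n. distr (uniform_measure M D) borel (\<lambda>\<omega>. snd (scaled_error \<mu> \<alpha> s1 s2 n (Yr s1 s2 \<theta>1 \<theta>2 \<omega>))))
     (distr (normal_law (sigma2_ae \<alpha> pe \<sigma>2)) borel (\<lambda>z. z *\<^sub>R (slope \<mu> \<alpha> m1 m3, slope \<mu> \<alpha> m2 m4)))"
proof -
  let ?\<nu> = "normal_law (sigma2_ae \<alpha> pe \<sigma>2)"
  let ?e = "(slope \<mu> \<alpha> m1 m3, slope \<mu> \<alpha> m2 m4)"
  let ?W = "\<lambda>n \<omega>. snd (scaled_error \<mu> \<alpha> s1 s2 n (Yr s1 s2 \<theta>1 \<theta>2 \<omega>))"
  interpret \<nu>: real_distribution ?\<nu> by (rule real_distribution_normal_law[OF limit_variance_nonneg])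
  have s12: "s1 < s2" using s by simp
  have meas [measurable]: "?W n \<in> borel_measurable M" for n
    by (rule measurable_compose[OF measurable_scaled_error[OF s12]])
      (intro borel_measurable_continuous_onI continuous_intros)
  define A where "A = {l :: nat list. (rev l ! (s1 - 1), rev l ! (s2 - 1), rev l ! (s1 + 1), rev l ! (s2 + 1)) = (m1, m2, m3, m4)}"
  \<comment> \<open>At the four conditioning times the observation equals the chain. The condition
    \<open>s1 < s2 - 1\<close> excludes that the neighbour of one outlier is the other
    outlier.\<close>
  have DA: "D = {\<omega> \<in> space M. H (s2 + 1) \<omega> \<in> A}"
    using s unfolding D_def A_def by (auto simp: inar_Y_def nth_hist)
  have D_sets: "D \<in> sets M" unfolding DA by measurable
  show ?thesis
    unfolding weak_conv2_def
  proof (intro allI impI)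
    fix f :: "real \<times> real \<Rightarrow> real" assume f: "continuous_on UNIV f \<and> bounded (range f)"
    then obtain B where B: "\<And>x. norm (f x) \<le> B" by (auto simp: bounded_iff)
    have [measurable]: "f \<in> borel_measurable borel" using f by (intro borel_measurable_continuous_onI) auto
    have "(\<lambda>n. expectation (\<lambda>\<omega>. indicator A (H (s2 + 1) \<omega>) * (\<lambda>w. f (snd w)) (scaled_error \<mu> \<alpha> s1 s2 n (Yr s1 s2 \<theta>1 \<theta>2 \<omega>))))
        \<longlonglongrightarrow> prob {\<omega> \<in> space M. H (s2 + 1) \<omega> \<in> A} * (\<integral>z. f (z *\<^sub>R ?e) \<partial>?\<nu>)"
      using f B by (intro restricted_limit[OF s, where B=B])
        (auto intro!: continuous_on_compose2[of UNIV f] continuous_intros simp: A_def)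
    then have "(\<lambda>n. expectation (\<lambda>\<omega>. indicator A (H (s2 + 1) \<omega>) * f (?W n \<omega>)) / prob D)
        \<longlonglongrightarrow> prob D * (\<integral>z. f (z *\<^sub>R ?e) \<partial>?\<nu>) / prob D"
      unfolding DA[symmetric] by (intro tendsto_divide) (use D in auto)
    then have lim: "(\<lambda>n. expectation (\<lambda>\<omega>. indicator A (H (s2 + 1) \<omega>) * f (?W n \<omega>)) / prob D)
        \<longlonglongrightarrow> (\<integral>z. f (z *\<^sub>R ?e) \<partial>?\<nu>)" using D by simp
    have "integral\<^sup>L (distr (uniform_measure M D) borel (?W n)) f = expectation (\<lambda>\<omega>. indicator A (H (s2 + 1) \<omega>) * f (?W n \<omega>)) / prob D" for n
    proof -
      have "?W n \<in> borel_measurable (uniform_measure M D)"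
        using meas[of n] by (simp cong: measurable_cong_sets)
      then have "integral\<^sup>L (distr (uniform_measure M D) borel (?W n)) f = (\<integral>\<omega>. f (?W n \<omega>) \<partial>uniform_measure M D)"
        by (rule integral_distr) simp
      also have "\<dots> = (\<integral>\<omega>. indicator D \<omega> * f (?W n \<omega>) \<partial>M) / prob D"
        by (rule integral_uniform_measure[OF prob_space_axioms D_sets D]) measurable
      also have "(\<integral>\<omega>. indicator D \<omega> * f (?W n \<omega>) \<partial>M) = expectation (\<lambda>\<omega>. indicator A (H (s2 + 1) \<omega>) * f (?W n \<omega>))"
        by (rule Bochner_Integration.integral_cong) (auto simp: DA split: split_indicator)
      finally show ?thesis .
    qed
    moreover have "integral\<^sup>L (distr ?\<nu> borel (\<lambda>z. z *\<^sub>R ?e)) f = (\<integral>z. f (z *\<^sub>R ?e) \<partial>?\<nu>)"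
      by (rule integral_distr) measurable
    ultimately show "(\<lambda>n. integral\<^sup>L (distr (uniform_measure M D) borel (?W n)) f) \<longlonglongrightarrow> integral\<^sup>L (distr ?\<nu> borel (\<lambda>z. z *\<^sub>R ?e)) f"
      using lim by simp
  qed
qed

end

theorem theorem3p4p2:
  fixes M :: "'a measure"
    and \<alpha> :: real
    and X0 :: "'a \<Rightarrow> nat"
    and eps :: "nat \<Rightarrow> 'a \<Rightarrow> nat"
    and xi :: "nat \<Rightarrow> nat \<Rightarrow> 'a \<Rightarrow> nat"
    and pe :: "nat pmf"
    and s1 s2 \<theta>1 \<theta>2 :: nat
  defines "\<mu> \<equiv> prob_space.expectation M (\<lambda>\<omega>. real (eps 1 \<omega>))"
    and "s2e \<equiv> prob_space.variance M (\<lambda>\<omega>. real (eps 1 \<omega>))"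
    and "Y \<equiv> (\<lambda>k \<omega>. real (inar_Y X0 eps xi s1 s2 \<theta>1 \<theta>2 k \<omega>))"
  assumes "prob_space M"
    and "0 < \<alpha>" and "\<alpha> < 1"
    and indep: "prob_space.indep_vars M (\<lambda>_. count_space UNIV) (inar_family X0 eps xi) inar_index_set"
    and eps_law: "\<And>k. 1 \<le> k \<Longrightarrow> distr M (count_space UNIV) (eps k) = measure_pmf pe"
    and xi_law: "\<And>k j. 1 \<le> k \<Longrightarrow> 1 \<le> j \<Longrightarrow>
           distr M (count_space UNIV) (xi k j) = measure_pmf (map_pmf of_bool (bernoulli_pmf \<alpha>))"
    and "integrable M (\<lambda>\<omega>. real (eps 1 \<omega>) ^ 2)"
    and "integrable M (\<lambda>\<omega>. real (eps 1 \<omega>) ^ 3)"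
    and "measure M {\<omega> \<in> space M. eps 1 \<omega> \<noteq> 0} > 0"
    and "integrable M (\<lambda>\<omega>. real (X0 \<omega>) ^ 2)"
    and "integrable M (\<lambda>\<omega>. real (X0 \<omega>) ^ 3)"
    and "1 \<le> s1" and "s1 < s2 - 1"
    and "1 \<le> \<theta>1" and "1 \<le> \<theta>2"
  shows "weak_conv_m
           (\<lambda>n. distr M borel (\<lambda>\<omega>.
              sqrt (real n) * (fst (cls_est \<mu> s1 s2 n (\<lambda>k. Y k \<omega>)) - \<alpha>)))
           (normal_law (sigma2_ae \<alpha> pe s2e))
       \<and> (\<forall>m :: nat \<times> nat \<times> nat \<times> nat.
           measure M {\<omega> \<in> space M.
              (inar_Y X0 eps xi s1 s2 \<theta>1 \<theta>2 (s1 - 1) \<omega>, inar_Y X0 eps xi s1 s2 \<theta>1 \<theta>2 (s2 - 1) \<omega>,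
               inar_Y X0 eps xi s1 s2 \<theta>1 \<theta>2 (s1 + 1) \<omega>, inar_Y X0 eps xi s1 s2 \<theta>1 \<theta>2 (s2 + 1) \<omega>) = m} > 0
         \<longrightarrow> (case m of (m1, m2, m3, m4) \<Rightarrow>
           let e1 = ((\<alpha>\<^sup>2 - 1) * (real m1 + real m3) + (1 + 2 * \<alpha> - \<alpha>\<^sup>2) * \<mu>) / (1 + \<alpha>\<^sup>2)\<^sup>2;
               e2 = ((\<alpha>\<^sup>2 - 1) * (real m2 + real m4) + (1 + 2 * \<alpha> - \<alpha>\<^sup>2) * \<mu>) / (1 + \<alpha>\<^sup>2)\<^sup>2;
               \<sigma>2 = sigma2_ae \<alpha> pe s2e;
               A = {\<omega> \<in> space M.
                 (inar_Y X0 eps xi s1 s2 \<theta>1 \<theta>2 (s1 - 1) \<omega>, inar_Y X0 eps xi s1 s2 \<theta>1 \<theta>2 (s2 - 1) \<omega>,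
                  inar_Y X0 eps xi s1 s2 \<theta>1 \<theta>2 (s1 + 1) \<omega>, inar_Y X0 eps xi s1 s2 \<theta>1 \<theta>2 (s2 + 1) \<omega>) = m};
               L1 = (\<lambda>\<omega>. Y s1 \<omega> - \<alpha> / (1 + \<alpha>\<^sup>2) * (Y (s1 - 1) \<omega> + Y (s1 + 1) \<omega>)
                          - (1 - \<alpha>) / (1 + \<alpha>\<^sup>2) * \<mu>);
               L2 = (\<lambda>\<omega>. Y s2 \<omega> - \<alpha> / (1 + \<alpha>\<^sup>2) * (Y (s2 - 1) \<omega> + Y (s2 + 1) \<omega>)
                          - (1 - \<alpha>) / (1 + \<alpha>\<^sup>2) * \<mu>)
           in \<exists>P. gaussian2 (\<sigma>2 * e1\<^sup>2) (\<sigma>2 * e1 * e2) (\<sigma>2 * e2\<^sup>2) P \<and>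
                weak_conv2
                  (\<lambda>n. distr (uniform_measure M A) borel (\<lambda>\<omega>.
                     (sqrt (real n) * (fst (snd (cls_est \<mu> s1 s2 n (\<lambda>k. Y k \<omega>))) - L1 \<omega>),
                      sqrt (real n) * (snd (snd (cls_est \<mu> s1 s2 n (\<lambda>k. Y k \<omega>))) - L2 \<omega>))))
                  P))"
proof -
  interpret M: prob_space M by fact
  \<comment> \<open>Measurability of the innovation is extracted from the independence assumption,
    which contains it.\<close>
  have mE [measurable]: "eps 1 \<in> M \<rightarrow>\<^sub>M count_space UNIV"
  proof -
    have "IE 1 \<in> inar_index_set" by (auto simp: inar_index_set_def)
    then have rv: "M.random_variable (count_space UNIV) (inar_family X0 eps xi (IE 1))"
      using indep unfolding M.indep_vars_def by blast
    have "inar_family X0 eps xi (IE 1) = eps 1"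
      by (rule ext) (simp add: inar_family_def)
    from rv[unfolded this] show ?thesis .
  qed
  have push: "M.expectation (\<lambda>\<omega>. f (eps 1 \<omega>)) = pexp pe f" for f :: "nat \<Rightarrow> real"
    unfolding eps_law[OF order_refl, symmetric] by (subst integral_distr[OF mE]) auto
  have pushi: "integrable (measure_pmf pe) f" if "integrable M (\<lambda>\<omega>. f (eps 1 \<omega>))" for f :: "nat \<Rightarrow> real"
    unfolding eps_law[OF order_refl, symmetric] using that by (subst integrable_distr_eq[OF mE]) auto
  have locale_inar: "inar \<alpha> pe"
  proof
    show "integrable (measure_pmf pe) (\<lambda>e. real e ^ 3)" by (rule pushi) fact
    have "measure (distr M (count_space UNIV) (eps 1)) (- {0}) = measure M {\<omega> \<in> space M. eps 1 \<omega> \<noteq> 0}"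
      by (subst measure_distr[OF mE]) (auto intro!: arg_cong[where f="measure M"])
    then have "0 < measure_pmf.prob pe (UNIV - {0})"
      using assms(12) by (simp add: eps_law Compl_eq_Diff_UNIV)
    then show "pmf pe 0 < 1"
      using measure_pmf.prob_compl[of "{0}" pe] by (simp add: measure_pmf_single)
  qed fact+
  interpret N: inar_process \<alpha> pe M X0 eps xi
    by (intro inar_process.intro locale_inar assms(4) inar_process_axioms.intro indep eps_law xi_law)
  have mu: "inar.\<mu> pe = \<mu>"
    unfolding \<mu>_def inar.\<mu>_def[OF locale_inar] by (rule push[symmetric])
  have var: "inar.\<sigma>2 pe = s2e"
  proof -
    have "s2e = measure_pmf.variance pe real"
      unfolding s2e_def push[of real] by (rule push)
    then show ?thesis
      using measure_pmf.variance_eq[OF N.integrable_pe] by (simp add: inar.\<sigma>2_def[OF locale_inar] inar.\<mu>_def[OF locale_inar])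
  qed
  have s: "1 \<le> s1" "s1 < s2 - 1" by fact+
  show ?thesis
  proof (intro conjI allI impI)
    show "weak_conv_m (\<lambda>n. distr M borel (\<lambda>\<omega>. sqrt (real n) * (fst (cls_est \<mu> s1 s2 n (\<lambda>k. Y k \<omega>)) - \<alpha>)))
       (normal_law (sigma2_ae \<alpha> pe s2e))"
      using N.alpha_limit[OF s, of \<theta>1 \<theta>2] by (simp only: mu var scaled_error_def fst_conv Y_def)
  next
    fix m :: "nat \<times> nat \<times> nat \<times> nat"
    obtain m1 m2 m3 m4 where m: "m = (m1, m2, m3, m4)" by (cases m)
    assume pos: "0 < measure M {\<omega> \<in> space M.
              (inar_Y X0 eps xi s1 s2 \<theta>1 \<theta>2 (s1 - 1) \<omega>, inar_Y X0 eps xi s1 s2 \<theta>1 \<theta>2 (s2 - 1) \<omega>,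
               inar_Y X0 eps xi s1 s2 \<theta>1 \<theta>2 (s1 + 1) \<omega>, inar_Y X0 eps xi s1 s2 \<theta>1 \<theta>2 (s2 + 1) \<omega>) = m}"
    \<comment> \<open>The limit law here, a normal law on the line spanned by the two slopes, is the
      witness for P.\<close>
    note T = N.theta_limit[OF s pos[unfolded m]]
    show "case m of (m1, m2, m3, m4) \<Rightarrow>
           let e1 = ((\<alpha>\<^sup>2 - 1) * (real m1 + real m3) + (1 + 2 * \<alpha> - \<alpha>\<^sup>2) * \<mu>) / (1 + \<alpha>\<^sup>2)\<^sup>2;
               e2 = ((\<alpha>\<^sup>2 - 1) * (real m2 + real m4) + (1 + 2 * \<alpha> - \<alpha>\<^sup>2) * \<mu>) / (1 + \<alpha>\<^sup>2)\<^sup>2;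
               \<sigma>2 = sigma2_ae \<alpha> pe s2e;
               A = {\<omega> \<in> space M.
                 (inar_Y X0 eps xi s1 s2 \<theta>1 \<theta>2 (s1 - 1) \<omega>, inar_Y X0 eps xi s1 s2 \<theta>1 \<theta>2 (s2 - 1) \<omega>,
                  inar_Y X0 eps xi s1 s2 \<theta>1 \<theta>2 (s1 + 1) \<omega>, inar_Y X0 eps xi s1 s2 \<theta>1 \<theta>2 (s2 + 1) \<omega>) = m};
               L1 = (\<lambda>\<omega>. Y s1 \<omega> - \<alpha> / (1 + \<alpha>\<^sup>2) * (Y (s1 - 1) \<omega> + Y (s1 + 1) \<omega>)
                          - (1 - \<alpha>) / (1 + \<alpha>\<^sup>2) * \<mu>);
               L2 = (\<lambda>\<omega>. Y s2 \<omega> - \<alpha> / (1 + \<alpha>\<^sup>2) * (Y (s2 - 1) \<omega> + Y (s2 + 1) \<omega>)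
                          - (1 - \<alpha>) / (1 + \<alpha>\<^sup>2) * \<mu>)
           in \<exists>P. gaussian2 (\<sigma>2 * e1\<^sup>2) (\<sigma>2 * e1 * e2) (\<sigma>2 * e2\<^sup>2) P \<and>
                weak_conv2
                  (\<lambda>n. distr (uniform_measure M A) borel (\<lambda>\<omega>.
                     (sqrt (real n) * (fst (snd (cls_est \<mu> s1 s2 n (\<lambda>k. Y k \<omega>))) - L1 \<omega>),
                      sqrt (real n) * (snd (snd (cls_est \<mu> s1 s2 n (\<lambda>k. Y k \<omega>))) - L2 \<omega>))))
                  P"
      unfolding m prod.case Let_def
      using gaussian2_rank_one[OF N.limit_variance_nonneg, of "slope \<mu> \<alpha> m1 m3" "slope \<mu> \<alpha> m2 m4"] T
      unfolding mu var scaled_error_def snd_conv theta_of_def slope_def Y_def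
      by (intro exI conjI)
  qed
qed

end
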